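(* Let $A,B\in\mathbb{R}^{3\times 3}$ be symmetric matrices such that the pair $(A,B)$ satisfies both the (D) condition and the ($R_1$) condition, let $K\subset\mathbb{R}^3$ be compact, and let $$S=\{\Sigma(\xi):=(\xi,Q_A(\xi),Q_B(\xi)) : \xi\in K\}\subset\mathbb{R}^5.$$ 1. If $(Q_A,Q_B)$ is equivalent to $(\xi_1\xi_2,\ \xi_1\xi_3+\xi_2^2)$, then $R^*_S(p\rightarrow 4)$ holds for every $p>3$. 2. If $(Q_A,Q_B)$ is equivalent to $(\xi_1\xi_2,\ \xi_1^2+\xi_3^2)$ or to $(\xi_1\xi_2,\ \xi_1^2-\xi_3^2)$, then $R^*_S(p\rightarrow 4)$ holds for every $p>8/3$. Moreover, these results are sharp except possibly for the endpoint: if $K$ has nonempty interior, then $R^*_S(p\rightarrow 4)$ fails for every $1\le p<3$ in case 1, and fails for every $1\le p<8/3$ in case 2.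
   Context: For a symmetric matrix $A\in\mathbb{R}^{3\times 3}$ write $Q_A(\xi)=\xi^\top A\xi$, $\xi=(\xi_1,\xi_2,\xi_3)\in\mathbb{R}^3$. The extension operator associated to $S$ is, for $f\in L^1(K)$ and $x\in\mathbb{R}^5$, $$E_Sf(x)=\int_K e^{ix\cdot\Sigma(\xi)}f(\xi)\,d\xi .$$ $R_S^*(p\rightarrow q)$ is said to hold if there is a constant $C_{p,q}>0$ (which may depend on $S$) such that $\|E_Sf\|_{L^q(\mathbb{R}^5)}\le C_{p,q}\|f\|_{L^p(K)}$ for all $f\in L^p(K)$. A pair $(A,B)$ of symmetric real $3\times 3$ matrices is irreducible if $A$ and $B$ are linearly independent and $\ker(A)\cap\ker(B)=\{0\}$. Two irreducible pairs $(A,B)$ and $(\tilde A,\tilde B)$ (equivalently, the pairs of quadratic forms $(Q_A,Q_B)$ and $(Q_{\tilde A},Q_{\tilde B})$) are equivalent if there exist invertible matrices $M_1\in\mathbb{R}^{3\times 3}$ and $M_2\in\mathbb{R}^{2\times 2}$ such that $$(Q_{\tilde A}(\xi),Q_{\tilde B}(\xi))^\top=M_2\cdot(Q_A(M_1\xi),Q_B(M_1\xi))^\top\quad\text{for every }\xi\in\mathbb{R}^3.$$ The pair $(A,B)$ satisfies the (D) condition if for every $w\in\mathbb{R}^3\setminus\{0\}$ there exists $\xi\in\mathbb{R}^3$ such that $\det[A\xi,B\xi,w]\ne 0$ (the determinant of the $3\times 3$ matrix with columns $A\xi,B\xi,w$). For an integer $0\le d'\le 2$, the pair $(A,B)$ satisfies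 the ($R_{d'}$) condition if $$\min_{H}\ \max_{\lambda_1,\lambda_2\in\mathbb{R}}\ \mathrm{rank}\big(E_H^\top(\lambda_1A+\lambda_2B)E_H\big)=d',$$ where the minimum is over all hyperplanes (two-dimensional linear subspaces) $H\subset\mathbb{R}^3$ and $E_H\in\mathbb{R}^{3\times 2}$ is any matrix whose columns form a basis of $H$. *)

theory Defs
  imports "HOL-Analysis.Analysis" "HOL-Probability.Essential_Supremum"
begin

definition symmetric_matrix :: "real^'n^'n \<Rightarrow> bool" where
  "symmetric_matrix A \<longleftrightarrow> transpose A = A"

definition quadratic_form :: "real^3^3 \<Rightarrow> real^3 \<Rightarrow> real" where
  "quadratic_form A \<xi> = \<xi> \<bullet> (A *v \<xi>)"

definition irreducible_pair :: "real^3^3 \<Rightarrow> real^3^3 \<Rightarrow> bool" where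
  "irreducible_pair A B \<longleftrightarrow>
     symmetric_matrix A \<and> symmetric_matrix B \<and>
     (\<forall>a b. a *\<^sub>R A + b *\<^sub>R B = 0 \<longrightarrow> a = 0 \<and> b = 0) \<and>
     {\<xi>. A *v \<xi> = 0} \<inter> {\<xi>. B *v \<xi> = 0} = {0}"

definition equivalent_pairs ::
    "real^3^3 \<Rightarrow> real^3^3 \<Rightarrow> real^3^3 \<Rightarrow> real^3^3 \<Rightarrow> bool" where
  "equivalent_pairs A B A' B' \<longleftrightarrow>
     irreducible_pair A B \<and> irreducible_pair A' B' \<and>
     (\<exists>(M1::real^3^3) (M2::real^2^2). invertible M1 \<and> invertible M2 \<and>
       (\<forall>\<xi>. (vector [quadratic_form A' \<xi>, quadratic_form B' \<xi>] :: real^2) =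
            M2 *v vector [quadratic_form A (M1 *v \<xi>), quadratic_form B (M1 *v \<xi>)]))"

text \<open>Equivalence of two pairs of quadratic forms is equivalence of the (uniquely determined)
  symmetric matrices representing them.\<close>

definition equivalent_forms ::
    "(real^3 \<Rightarrow> real) \<times> (real^3 \<Rightarrow> real) \<Rightarrow> (real^3 \<Rightarrow> real) \<times> (real^3 \<Rightarrow> real) \<Rightarrow> bool" where
  "equivalent_forms P P' \<longleftrightarrow>
     (\<exists>A B A' B'. P = (quadratic_form A, quadratic_form B) \<and>
        P' = (quadratic_form A', quadratic_form B') \<and> equivalent_pairs A B A' B')"

text \<open>\<^term>\<open>vector [u, v, w]\<close> has rows \<open>u\<close>, \<open>v\<close>, \<open>w\<close>;
  its transpose has them as columns.\<close>

definition D_condition :: "real^3^3 \<Rightarrow> real^3^3 \<Rightarrow> bool" where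
  "D_condition A B \<longleftrightarrow>
     (\<forall>w. w \<noteq> 0 \<longrightarrow>
       (\<exists>\<xi>. det (transpose (vector [A *v \<xi>, B *v \<xi>, w] :: real^3^3)) \<noteq> 0))"

definition basis_matrix :: "(real^3) set \<Rightarrow> real^2^3 \<Rightarrow> bool" where
  "basis_matrix H E \<longleftrightarrow> independent (columns E) \<and> span (columns E) = H"

text \<open>The rank below does not depend on the choice of the basis matrix \<open>E\<close> of \<open>H\<close>, so the minimum
  over \<open>H\<close> is taken over all pairs \<open>(H, E)\<close>. Both sets consist of ranks of 2 by 2 matrices and are
  thus finite and nonempty, so that \<^const>\<open>Min\<close> and \<^const>\<open>Max\<close> have their usual meaning.\<close>

definition R_condition :: "nat \<Rightarrow> real^3^3 \<Rightarrow> real^3^3 \<Rightarrow> bool" where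
  "R_condition d A B \<longleftrightarrow>
     Min {Max {rank (transpose E ** (l1 *\<^sub>R A + l2 *\<^sub>R B) ** E) | l1 l2 :: real. True} | H E.
            subspace H \<and> dim H = 2 \<and> basis_matrix H E} = d"

definition surface_map :: "real^3^3 \<Rightarrow> real^3^3 \<Rightarrow> real^3 \<Rightarrow> real^5" where
  "surface_map A B \<xi> =
     vector [\<xi> $ 1, \<xi> $ 2, \<xi> $ 3, quadratic_form A \<xi>, quadratic_form B \<xi>]"

text \<open>The \<open>L\<^sup>p\<close> norm for \<open>0 < p \<le> \<infinity>\<close>, infinite for functions that are not in \<open>L\<^sup>p\<close>. The outer power
  \<open>1 / p\<close> is taken separately at infinity because \<^const>\<open>enn2real\<close> sends \<^term>\<open>\<infinity> :: ennreal\<close> to 0.\<close>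

definition Lp_norm :: "ennreal \<Rightarrow> 'a measure \<Rightarrow> ('a \<Rightarrow> complex) \<Rightarrow> ennreal" where
  "Lp_norm p M f =
     (if p = \<infinity> then esssup M (\<lambda>x. ennreal (norm (f x)))
      else let I = (\<integral>\<^sup>+x. ennreal (norm (f x) powr enn2real p) \<partial>M)
           in if I = \<infinity> then \<infinity> else ennreal (enn2real I powr (1 / enn2real p)))"

definition Lp_space :: "ennreal \<Rightarrow> 'a measure \<Rightarrow> ('a \<Rightarrow> complex) set" where
  "Lp_space p M = {f \<in> borel_measurable M. Lp_norm p M f < \<infinity>}"

text \<open>A surface \<open>S\<close> is given by its parametrization \<open>\<Sigma>\<close> and the parameter set \<open>K\<close>.\<close>

definition extension_operator ::
    "(real^3 \<Rightarrow> real^5) \<Rightarrow> (real^3) set \<Rightarrow> (real^3 \<Rightarrow> complex) \<Rightarrow> real^5 \<Rightarrow> complex" where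
  "extension_operator \<Sigma> K f x =
     (LINT \<xi>|lebesgue_on K. exp (\<i> * complex_of_real (x \<bullet> \<Sigma> \<xi>)) * f \<xi>)"

definition restriction_estimate ::
    "(real^3 \<Rightarrow> real^5) \<Rightarrow> (real^3) set \<Rightarrow> ennreal \<Rightarrow> ennreal \<Rightarrow> bool" where
  "restriction_estimate \<Sigma> K p q \<longleftrightarrow>
     (\<exists>C::real. C > 0 \<and>
       (\<forall>f \<in> Lp_space p (lebesgue_on K).
          Lp_norm q lebesgue (extension_operator \<Sigma> K f)
            \<le> ennreal C * Lp_norm p (lebesgue_on K) f))"

end

(* Since |Ef|^4 = |(Ef)^2|^2 and (Ef)^2 is the Fourier transform of the image of f(xi) f(eta) under
   (xi, eta) |-> Sigma(xi) + Sigma(eta), Plancherel's theorem reduces the L^4 bound to an L^2 bound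
   for that image. In the variables s = xi + eta, u = xi - eta the fibres are the level curves of
   (Q_A, Q_B) in u. By Cauchy-Schwarz with a weight w(u) the L^2 norm is controlled by the double
   integral of |f(xi)|^2 |f(eta)|^2 w(xi - eta) as soon as du / w(u) has an image with bounded
   density under (Q_A, Q_B), and Young's inequality then gives the L^p bound if w is locally in L^r
   with 1/r = 2 - 4/p. The weights are |u_1 u_2|^(-2/3) for (u_1 u_2, u_1 u_3 + u_2^2), which is
   locally in L^r for r < 3/2, and |u_1 u_3|^(-alpha) with alpha > 1/2 for
   (u_1 u_2, u_1^2 +- u_3^2), which is locally in L^r for r < 1 / alpha. Sharpness follows from
   indicators of boxes with sides (delta^2, delta, 1) and (delta, 1, delta). *)

theory Submission
  imports Defs "HOL-Probability.Characteristic_Functions"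
begin

subsection \<open>Lebesgue measure in coordinates\<close>

text \<open>The image of f(xi) f(eta) is never constructed, since its density would require
  disintegrating along the noncompact fibres of (Q_A, Q_B). Instead |(Ef)^2|^2 is damped by a
  Gaussian, which turns its integral into a double integral against an approximate identity, and a
  weighted Schur test bounds that uniformly in the damping. A weight is forced: the unweighted image
  of a cube has unbounded density. For (u_1 u_2, u_1 u_3 + u_2^2) = (a, b) the coordinates (a, b,
  u_2) have Jacobian 1/|a|, and a bound on |u_3| confines u_2 to a set of measure at most a constant
  times |a|^(1/3); hence the power 2/3. For the other forms the fibre integral at b = 0 is that of
  |u_1|^(2 alpha - 2), divergent at alpha = 1/2. With 1/r = 2 - 4/p, the conditions r < 3/2 and r <
  2 are p > 3 and p > 8/3. A box of volume delta^N on which the forms have sizes delta^(beta_k),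
  with sum beta of the exponents, gives at least delta^(3N - beta) for the fourth power of the L^4
  norm against delta^(4N/p) on the right, up to constants; (N, beta) = (3, 5) and (2, 3) give the
  same thresholds.\<close>

lemma nn_integral_lborel_pair:
  fixes f :: "'a::euclidean_space \<times> 'b::euclidean_space \<Rightarrow> ennreal"
  assumes [measurable]: "f \<in> borel_measurable borel"
  shows "(\<integral>\<^sup>+z. f z \<partial>lborel) = (\<integral>\<^sup>+x. \<integral>\<^sup>+y. f (x, y) \<partial>lborel \<partial>lborel)"
proof -
  have "f \<in> borel_measurable (lborel \<Otimes>\<^sub>M lborel)" by (simp add: lborel_prod)
  from lborel.nn_integral_fst[OF this] show ?thesis by (simp add: lborel_prod)
qed

lemma nn_integral_lborel_affine:
  fixes f :: "'a::euclidean_space \<Rightarrow> ennreal"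
  assumes [measurable]: "f \<in> borel_measurable borel" and c: "c \<noteq> 0"
  shows "(\<integral>\<^sup>+x. f x \<partial>lborel) = ennreal (\<bar>c\<bar> ^ DIM('a)) * (\<integral>\<^sup>+x. f (t + c *\<^sub>R x) \<partial>lborel)"
  by (subst lborel_affine[OF c, of t])
     (simp add: nn_integral_density nn_integral_distr nn_integral_cmult ennreal_power[symmetric])

lemma nn_integral_lborel_distr:
  assumes "distr lborel borel \<phi> = lborel" and [measurable]: "\<phi> \<in> borel_measurable borel"
    "f \<in> borel_measurable borel"
  shows "(\<integral>\<^sup>+x. f x \<partial>lborel) = (\<integral>\<^sup>+x. f (\<phi> x) \<partial>lborel)"
  by (subst assms(1)[symmetric]) (simp add: nn_integral_distr)

section \<open>Cartesian coordinates in dimensions 2, 3 and 5\<close>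

lemma borel_measurable_vec_lambda:
  fixes f :: "'a \<Rightarrow> 'n::finite \<Rightarrow> real"
  assumes "\<And>i. (\<lambda>x. f x i) \<in> borel_measurable M"
  shows "(\<lambda>x. \<chi> i. f x i) \<in> borel_measurable M"
proof -
  have "(\<lambda>x. (\<chi> i. f x i) \<bullet> b) \<in> borel_measurable M" if "b \<in> Basis" for b :: "real^'n"
    using that assms by (auto simp: Basis_vec_def inner_axis)
  then show ?thesis by (subst borel_measurable_euclidean_space) auto
qed

lemma borel_measurable_vec_nth [measurable]: "(\<lambda>x::real^'n. x $ i) \<in> borel_measurable borel"
  by (intro borel_measurable_continuous_onI continuous_intros)

lemma borel_measurable_vector2 [measurable (raw)]:
  assumes "f \<in> borel_measurable M" "g \<in> borel_measurable M"
  shows "(\<lambda>x. vector [f x, g x] :: real^2) \<in> borel_measurable M"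
proof -
  have "(\<lambda>x. vector [f x, g x] :: real^2) = (\<lambda>x. \<chi> i. if i = 1 then f x else g x)"
    by (simp add: fun_eq_iff vec_eq_iff forall_2)
  then show ?thesis using assms by (auto intro!: borel_measurable_vec_lambda)
qed

lemma borel_measurable_vector3 [measurable (raw)]:
  assumes "f \<in> borel_measurable M" "g \<in> borel_measurable M" "h \<in> borel_measurable M"
  shows "(\<lambda>x. vector [f x, g x, h x] :: real^3) \<in> borel_measurable M"
proof -
  have "(\<lambda>x. vector [f x, g x, h x] :: real^3) = (\<lambda>x. \<chi> i. if i = 1 then f x else if i = 2 then g x else h x)"
    by (simp add: fun_eq_iff vec_eq_iff forall_3)
  then show ?thesis using assms by (auto intro!: borel_measurable_vec_lambda)
qed

lemma exhaust_5: "(x::5) = 1 \<or> x = 2 \<or> x = 3 \<or> x = 4 \<or> x = 5"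
proof (induct x)
  case (of_int z)
  then have "0 \<le> z" "z < 5" by simp_all
  then have "z = 0 \<or> z = 1 \<or> z = 2 \<or> z = 3 \<or> z = 4" by arith
  then show ?case by auto
qed

lemma forall_5: "(\<forall>i::5. P i) \<longleftrightarrow> P 1 \<and> P 2 \<and> P 3 \<and> P 4 \<and> P 5"
  by (metis exhaust_5)

lemma UNIV_5: "UNIV = {1::5, 2, 3, 4, 5}"
  using exhaust_5 by auto

lemma prod_UNIV_2: "prod f (UNIV::2 set) = f 1 * f 2"
  unfolding UNIV_2 by simp

lemma prod_UNIV_3: "prod f (UNIV::3 set) = f 1 * f 2 * f 3"
  unfolding UNIV_3 by (simp add: ac_simps)

lemma prod_UNIV_5: "prod f (UNIV::5 set) = f 1 * f 2 * f 3 * f 4 * f 5"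
  unfolding UNIV_5 by (simp add: ac_simps)

lemma vector_5 [simp]:
  "(vector [a, b, c, d, e] :: 'a::zero^5) $ 1 = a"
  "(vector [a, b, c, d, e] :: 'a::zero^5) $ 2 = b"
  "(vector [a, b, c, d, e] :: 'a::zero^5) $ 3 = c"
  "(vector [a, b, c, d, e] :: 'a::zero^5) $ 4 = d"
  "(vector [a, b, c, d, e] :: 'a::zero^5) $ 5 = e"
  by (simp_all add: vector_def)

lemma borel_measurable_vector5 [measurable (raw)]:
  assumes "a \<in> borel_measurable M" "b \<in> borel_measurable M" "c \<in> borel_measurable M"
    "d \<in> borel_measurable M" "e \<in> borel_measurable M"
  shows "(\<lambda>x. vector [a x, b x, c x, d x, e x] :: real^5) \<in> borel_measurable M"
proof -
  have "(\<lambda>x. vector [a x, b x, c x, d x, e x] :: real^5) =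
    (\<lambda>x. \<chi> i. if i = 1 then a x else if i = 2 then b x else if i = 3 then c x else if i = 4 then d x else e x)"
    by (simp add: fun_eq_iff vec_eq_iff forall_5)
  then show ?thesis using assms by (auto intro!: borel_measurable_vec_lambda)
qed

lemma prod_Basis_vec: "(\<Prod>b\<in>Basis. f (b::real^'n)) = (\<Prod>i\<in>UNIV. f (axis i 1))"
proof -
  have "Basis = range (\<lambda>i. axis i 1 :: real^'n)" by (auto simp: Basis_vec_def)
  moreover have "inj (\<lambda>i. axis i 1 :: real^'n)" by (simp add: inj_on_def axis_eq_axis)
  ultimately show ?thesis using prod.reindex[of "\<lambda>i. axis i 1 :: real^'n" UNIV f] by (simp add: o_def)
qed

lemma all_Basis_vec: "(\<forall>b\<in>Basis. P (b::real^'n)) \<longleftrightarrow> (\<forall>i. P (axis i 1))"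
  by (auto simp: Basis_vec_def)

lemma emeasure_lborel_Times:
  assumes "A \<in> sets borel" "B \<in> sets borel"
  shows "emeasure lborel (A \<times> B) = emeasure lborel A * emeasure lborel B"
proof -
  have "emeasure (lborel \<Otimes>\<^sub>M lborel) (A \<times> B) = emeasure lborel A * emeasure lborel B"
    using assms by (intro lborel.emeasure_pair_measure_Times) auto
  then show ?thesis by (simp only: lborel_prod)
qed

lemma borel_measurable_vector2_pair [measurable]:
  "(\<lambda>(x, y). vector [x, y] :: real^2) \<in> borel_measurable borel"
  unfolding borel_prod[symmetric] by measurable

lemma borel_measurable_vector3_pair [measurable]:
  "(\<lambda>(x, y, z). vector [x, y, z] :: real^3) \<in> borel_measurable borel"
  unfolding borel_prod[symmetric] by measurable

text \<open>Lebesgue measure is determined by its values on boxes, and the preimage of a box is a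
  product of intervals. The versions for three and five coordinates follow the same scheme.\<close>

lemma lborel_vector2: "distr lborel borel (\<lambda>(x, y). vector [x, y] :: real^2) = lborel"
proof (rule lborel_eqI[symmetric])
  fix l u :: "real^2" assume lu: "\<And>b. b \<in> Basis \<Longrightarrow> l \<bullet> b \<le> u \<bullet> b"
  have lu': "l $ 1 \<le> u $ 1" "l $ 2 \<le> u $ 2"
    using lu[of "axis 1 1"] lu[of "axis 2 1"] by (auto simp: inner_axis)
  have "(\<lambda>(x, y). vector [x, y] :: real^2) -` box l u = {l$1<..<u$1} \<times> {l$2<..<u$2}"
    by (auto simp: mem_box_cart forall_2)
  then show "emeasure (distr lborel borel (\<lambda>(x, y). vector [x, y] :: real^2)) (box l u) = ennreal (\<Prod>b\<in>Basis. (u - l) \<bullet> b)"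
    using lu' by (simp add: emeasure_distr emeasure_lborel_Times
       prod_Basis_vec prod_UNIV_2 inner_axis ennreal_mult)
qed simp

lemma nn_integral_vector2:
  fixes f :: "real^2 \<Rightarrow> ennreal"
  assumes [measurable]: "f \<in> borel_measurable borel"
  shows "(\<integral>\<^sup>+z. f z \<partial>lborel) = (\<integral>\<^sup>+x. \<integral>\<^sup>+y. f (vector [x, y]) \<partial>lborel \<partial>lborel)"
proof -
  have "(\<integral>\<^sup>+z. f z \<partial>lborel) = (\<integral>\<^sup>+z. f ((\<lambda>(x, y). vector [x, y]) z) \<partial>lborel)"
    by (rule nn_integral_lborel_distr[OF lborel_vector2]) measurable
  also have "\<dots> = (\<integral>\<^sup>+x. \<integral>\<^sup>+y. f ((\<lambda>(x, y). vector [x, y]) (x, y)) \<partial>lborel \<partial>lborel)"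
    by (rule nn_integral_lborel_pair) measurable
  finally show ?thesis by simp
qed

lemma lborel_vector3: "distr lborel borel (\<lambda>(x, y, z). vector [x, y, z] :: real^3) = lborel"
proof (rule lborel_eqI[symmetric])
  fix l u :: "real^3" assume lu: "\<And>b. b \<in> Basis \<Longrightarrow> l \<bullet> b \<le> u \<bullet> b"
  have lu': "l $ 1 \<le> u $ 1" "l $ 2 \<le> u $ 2" "l $ 3 \<le> u $ 3"
    using lu[of "axis 1 1"] lu[of "axis 2 1"] lu[of "axis 3 1"] by (auto simp: inner_axis)
  let ?f = "\<lambda>(x, y, z). vector [x, y, z] :: real^3"
  have 1: "?f -` box l u = {l$1<..<u$1} \<times> {l$2<..<u$2} \<times> {l$3<..<u$3}"
    by (auto simp: mem_box_cart forall_3)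
  have "emeasure (distr lborel borel ?f) (box l u) = emeasure lborel (?f -` box l u)"
    using emeasure_distr[of ?f lborel borel "box l u"] by simp
  also have "\<dots> = emeasure lborel {l$1<..<u$1} * (emeasure lborel {l$2<..<u$2} * emeasure lborel {l$3<..<u$3})"
    unfolding 1 by (subst emeasure_lborel_Times; (subst emeasure_lborel_Times)?) (auto simp: borel_Times)
  also have "\<dots> = ennreal (u$1 - l$1) * (ennreal (u$2 - l$2) * ennreal (u$3 - l$3))"
    using lu' by simp
  also have "\<dots> = ennreal ((u$1 - l$1) * ((u$2 - l$2) * (u$3 - l$3)))"
    using lu' by (simp only: ennreal_mult[symmetric] diff_ge_0_iff_ge mult_nonneg_nonneg)
  also have "\<dots> = ennreal (\<Prod>b\<in>Basis. (u - l) \<bullet> b)"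
    by (simp add: prod_Basis_vec prod_UNIV_3 inner_axis mult.assoc)
  finally show "emeasure (distr lborel borel ?f) (box l u) = ennreal (\<Prod>b\<in>Basis. (u - l) \<bullet> b)" .
qed simp

lemma nn_integral_vector3:
  fixes f :: "real^3 \<Rightarrow> ennreal"
  assumes [measurable]: "f \<in> borel_measurable borel"
  shows "(\<integral>\<^sup>+z. f z \<partial>lborel) =
    (\<integral>\<^sup>+x. \<integral>\<^sup>+y. \<integral>\<^sup>+z. f (vector [x, y, z]) \<partial>lborel \<partial>lborel \<partial>lborel)"
proof -
  have 1: "(\<lambda>(y, z). f (vector [x, y, z])) \<in> borel_measurable borel" for x
    unfolding borel_prod[symmetric] by measurable
  have "(\<integral>\<^sup>+z. f z \<partial>lborel) = (\<integral>\<^sup>+z. f ((\<lambda>(x, y, z). vector [x, y, z]) z) \<partial>lborel)"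
    by (rule nn_integral_lborel_distr[OF lborel_vector3]) measurable
  also have "\<dots> = (\<integral>\<^sup>+x. \<integral>\<^sup>+p. f ((\<lambda>(x, y, z). vector [x, y, z]) (x, p)) \<partial>lborel \<partial>lborel)"
    by (rule nn_integral_lborel_pair) measurable
  also have "\<dots> = (\<integral>\<^sup>+x. \<integral>\<^sup>+p. (\<lambda>(y, z). f (vector [x, y, z])) p \<partial>lborel \<partial>lborel)"
    by (intro nn_integral_cong) (simp add: split_beta)
  also have "\<dots> = (\<integral>\<^sup>+x. \<integral>\<^sup>+y. \<integral>\<^sup>+z. f (vector [x, y, z]) \<partial>lborel \<partial>lborel \<partial>lborel)"
    by (simp add: nn_integral_lborel_pair[OF 1])
  finally show ?thesis .
qed

text \<open>Splits R^5 into the three linear and the two quadratic coordinates: the surface map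
  becomes \<open>join5 \<xi> (q \<xi>)\<close>, and integrals over R^5 become iterated ones.\<close>

definition join5 :: "real^3 \<Rightarrow> real^2 \<Rightarrow> real^5" where
  "join5 s t = vector [s $ 1, s $ 2, s $ 3, t $ 1, t $ 2]"

lemma join5_nth [simp]:
  "join5 s t $ 1 = s $ 1" "join5 s t $ 2 = s $ 2" "join5 s t $ 3 = s $ 3"
  "join5 s t $ 4 = t $ 1" "join5 s t $ 5 = t $ 2"
  by (simp_all add: join5_def)

lemma borel_measurable_join5 [measurable (raw)]:
  assumes [measurable]: "f \<in> borel_measurable M" "g \<in> borel_measurable M"
  shows "(\<lambda>x. join5 (f x) (g x)) \<in> borel_measurable M"
  unfolding join5_def by measurable

lemma borel_measurable_join5_pair [measurable]:
  "(\<lambda>(s, t). join5 s t) \<in> borel_measurable borel"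
  unfolding borel_prod[symmetric] by measurable

lemma lborel_join5: "distr lborel borel (\<lambda>(s, t). join5 s t) = lborel"
proof (rule lborel_eqI[symmetric])
  fix l u :: "real^5" assume lu: "\<And>b. b \<in> Basis \<Longrightarrow> l \<bullet> b \<le> u \<bullet> b"
  have lu': "l $ i \<le> u $ i" for i
    using lu[of "axis i 1"] by (auto simp: inner_axis)
  let ?s = "\<lambda>l::real^5. vector [l$1, l$2, l$3] :: real^3"
  let ?t = "\<lambda>l::real^5. vector [l$4, l$5] :: real^2"
  have *: "(\<lambda>(s, t). join5 s t) -` box l u = box (?s l) (?s u) \<times> box (?t l) (?t u)"
    by (auto simp: mem_box_cart forall_3 forall_2 forall_5)
  have "\<forall>b\<in>Basis. ?s l \<bullet> b \<le> ?s u \<bullet> b"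
    unfolding all_Basis_vec by (simp add: inner_axis forall_3 lu')
  from emeasure_lborel_box[OF this[rule_format]] have "emeasure lborel (box (?s l) (?s u)) = ennreal (\<Prod>b\<in>Basis. (?s u - ?s l) \<bullet> b)" .
  moreover have "\<forall>b\<in>Basis. ?t l \<bullet> b \<le> ?t u \<bullet> b"
    unfolding all_Basis_vec by (simp add: inner_axis forall_2 lu')
  from emeasure_lborel_box[OF this[rule_format]] have "emeasure lborel (box (?t l) (?t u)) = ennreal (\<Prod>b\<in>Basis. (?t u - ?t l) \<bullet> b)" .
  ultimately have "emeasure lborel (box (?s l) (?s u)) * emeasure lborel (box (?t l) (?t u)) =
      ennreal ((\<Prod>b\<in>Basis. (?s u - ?s l) \<bullet> b) * (\<Prod>b\<in>Basis. (?t u - ?t l) \<bullet> b))"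
    using lu' by (simp add: ennreal_mult prod_Basis_vec prod_UNIV_3 prod_UNIV_2 inner_axis)
  moreover have "(\<Prod>b\<in>Basis. (?s u - ?s l) \<bullet> b) * (\<Prod>b\<in>Basis. (?t u - ?t l) \<bullet> b) = (\<Prod>b\<in>Basis. (u - l) \<bullet> b)"
    unfolding prod_Basis_vec prod_UNIV_3 prod_UNIV_2 prod_UNIV_5 by (simp add: inner_axis)
  moreover have "emeasure (distr lborel borel (\<lambda>(s, t). join5 s t)) (box l u) = emeasure lborel (box (?s l) (?s u)) * emeasure lborel (box (?t l) (?t u))"
    using emeasure_distr[of "\<lambda>(s, t). join5 s t" lborel borel "box l u"] * by (simp add: emeasure_lborel_Times)
  ultimately show "emeasure (distr lborel borel (\<lambda>(s, t). join5 s t)) (box l u) = ennreal (\<Prod>b\<in>Basis. (u - l) \<bullet> b)"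
    by simp
qed simp

lemma nn_integral_join5:
  assumes [measurable]: "f \<in> borel_measurable borel"
  shows "(\<integral>\<^sup>+z. f z \<partial>lborel) = (\<integral>\<^sup>+s. \<integral>\<^sup>+t. f (join5 s t) \<partial>lborel \<partial>lborel)"
proof -
  have "(\<integral>\<^sup>+z. f z \<partial>lborel) = (\<integral>\<^sup>+z. f ((\<lambda>(s, t). join5 s t) z) \<partial>lborel)"
    by (rule nn_integral_lborel_distr[OF lborel_join5]) measurable
  also have "\<dots> = (\<integral>\<^sup>+s. \<integral>\<^sup>+t. f ((\<lambda>(s, t). join5 s t) (s, t)) \<partial>lborel \<partial>lborel)"
    by (rule nn_integral_lborel_pair) measurable
  finally show ?thesis by simp
qed

section \<open>Linear and affine changes of variables\<close>

lemma borel_measurable_matrix_vector_mult [measurable]: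
  fixes M :: "real^'n^'m"
  shows "(\<lambda>x. M *v x) \<in> borel_measurable borel"
  by (intro borel_measurable_continuous_onI matrix_vector_mult_linear_continuous_on)

text \<open>It is enough to compare both measures on boxes. The preimage of a box is the image of
  that box under the inverse matrix, hence measurable of finite measure, and the determinant formula
  for linear images applies to it.\<close>

lemma lborel_linear:
  fixes M :: "real^'n::{finite,wellorder}^'n::{finite,wellorder}"
  assumes M: "invertible M"
  shows "lborel = density (distr lborel borel (\<lambda>x. M *v x)) (\<lambda>_. ennreal \<bar>det M\<bar>)"
proof (rule lborel_eqI)
  fix l u :: "real^'n::{finite,wellorder}" assume lu: "\<And>b. b \<in> Basis \<Longrightarrow> l \<bullet> b \<le> u \<bullet> b"
  let ?S = "(\<lambda>x. M *v x) -` box l u"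
  have d: "det M \<noteq> 0" using M invertible_det_nz by blast
  obtain N where N: "M ** N = mat 1" "N ** M = mat 1" using M invertible_def by blast
  have MN: "M *v (N *v x) = x" "N *v (M *v x) = x" for x
    by (simp_all add: matrix_vector_mul_assoc N)
  have im: "(\<lambda>x. M *v x) ` ?S = box l u"
    by safe (metis MN(1) image_eqI vimageI)
  have S: "?S = (\<lambda>x. N *v x) ` box l u"
    by safe (metis MN(2) image_eqI, simp add: MN)
  have Sm: "?S \<in> lmeasurable"
    unfolding S by (intro measurable_linear_image) auto
  have "measure lebesgue (box l u) = \<bar>det M\<bar> * measure lebesgue ?S"
    using measure_linear_image[OF matrix_vector_mul_linear Sm, of M] im by simp
  moreover have "measure lebesgue (box l u) = (\<Prod>b\<in>Basis. (u - l) \<bullet> b)"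
    using lu by (simp add: measure_lborel_box_eq)
  moreover have "emeasure lborel ?S = ennreal (measure lebesgue ?S)"
  proof -
    have "?S \<in> sets borel"
      using measurable_sets[OF borel_measurable_matrix_vector_mult[of M], of "box l u"] by simp
    then have "emeasure lborel ?S = emeasure lebesgue ?S"
      by (simp add: emeasure_completion)
    then show ?thesis using emeasure_eq_measure2[OF Sm] by simp
  qed
  ultimately show "emeasure (density (distr lborel borel (\<lambda>x. M *v x)) (\<lambda>_. ennreal \<bar>det M\<bar>)) (box l u) = ennreal (\<Prod>b\<in>Basis. (u - l) \<bullet> b)"
    by (simp add: emeasure_density nn_integral_cmult emeasure_distr ennreal_mult[symmetric])
qed simp

lemma nn_integral_linear:
  fixes M :: "real^'n::{finite,wellorder}^'n::{finite,wellorder}" and f :: "real^'n::{finite,wellorder} \<Rightarrow> ennreal"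
  assumes M: "invertible M" and [measurable]: "f \<in> borel_measurable borel"
  shows "(\<integral>\<^sup>+x. f x \<partial>lborel) = ennreal \<bar>det M\<bar> * (\<integral>\<^sup>+x. f (M *v x) \<partial>lborel)"
  by (subst lborel_linear[OF M]) (simp add: nn_integral_density nn_integral_distr nn_integral_cmult)

lemma nn_integral_lborel_affine_image:
  fixes f :: "'a::euclidean_space \<Rightarrow> ennreal"
  assumes [measurable]: "f \<in> borel_measurable borel" and c: "c \<noteq> 0"
  shows "(\<integral>\<^sup>+x. f (t + c *\<^sub>R x) \<partial>lborel) = ennreal (1 / \<bar>c\<bar> ^ DIM('a)) * (\<integral>\<^sup>+x. f x \<partial>lborel)"
proof -
  have "ennreal (1 / \<bar>c\<bar> ^ DIM('a)) * (\<integral>\<^sup>+x. f x \<partial>lborel) =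
      ennreal (1 / \<bar>c\<bar> ^ DIM('a)) * ennreal (\<bar>c\<bar> ^ DIM('a)) * (\<integral>\<^sup>+x. f (t + c *\<^sub>R x) \<partial>lborel)"
    by (subst nn_integral_lborel_affine[OF assms, of t]) (simp add: mult.assoc)
  also have "ennreal (1 / \<bar>c\<bar> ^ DIM('a)) * ennreal (\<bar>c\<bar> ^ DIM('a)) = 1"
    using c by (subst ennreal_mult[symmetric]) auto
  finally show ?thesis by simp
qed

lemma nn_integral_lborel_translate:
  fixes f :: "'a::euclidean_space \<Rightarrow> ennreal"
  assumes "f \<in> borel_measurable borel"
  shows "(\<integral>\<^sup>+x. f (t + x) \<partial>lborel) = (\<integral>\<^sup>+x. f x \<partial>lborel)"
  using nn_integral_lborel_affine_image[OF assms, of 1 t] by simp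

lemma nn_integral_lborel_reflect:
  fixes f :: "'a::euclidean_space \<Rightarrow> ennreal"
  assumes "f \<in> borel_measurable borel"
  shows "(\<integral>\<^sup>+x. f (t - x) \<partial>lborel) = (\<integral>\<^sup>+x. f x \<partial>lborel)"
  using nn_integral_lborel_affine_image[OF assms, of "-1" t] by simp

lemma nn_integral_affine_image:
  fixes f :: "real \<Rightarrow> ennreal"
  assumes [measurable]: "f \<in> borel_measurable borel" and c: "c \<noteq> 0"
  shows "(\<integral>\<^sup>+x. f (t + c * x) \<partial>lborel) = ennreal (1 / \<bar>c\<bar>) * (\<integral>\<^sup>+x. f x \<partial>lborel)"
  using nn_integral_lborel_affine_image[OF assms, of t] by simp

lemma nn_integral_swap:
  fixes f :: "'a::euclidean_space \<Rightarrow> 'b::euclidean_space \<Rightarrow> ennreal"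
  assumes "(\<lambda>(x, y). f x y) \<in> borel_measurable borel"
  shows "(\<integral>\<^sup>+x. \<integral>\<^sup>+y. f x y \<partial>lborel \<partial>lborel) = (\<integral>\<^sup>+y. \<integral>\<^sup>+x. f x y \<partial>lborel \<partial>lborel)"
  using assms by (intro lborel_pair.Fubini'[symmetric]) (simp add: lborel_prod)

text \<open>By Tonelli, the pairs whose difference lies in a null set form a null set, because every
  slice is a reflected translate. The weights below are positive only almost everywhere and are
  evaluated at differences.\<close>

lemma AE_lborel_diff:
  fixes P :: "'a::euclidean_space \<Rightarrow> bool"
  assumes "AE u in lborel. P u"
  shows "AE z in lborel. P (fst z - snd z)"
proof -
  obtain N where N: "{u. \<not> P u} \<subseteq> N" "N \<in> sets borel" "emeasure lborel N = 0"
    using AE_E[OF assms] by auto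
  have [measurable]: "N \<in> sets borel" by fact
  have "(\<lambda>z::'a \<times> 'a. indicator N (fst z - snd z) :: ennreal) \<in> borel_measurable borel"
    unfolding borel_prod[symmetric] by measurable
  then have m: "(\<lambda>z::'a \<times> 'a. indicator N (fst z - snd z) :: ennreal) \<in> borel_measurable lborel"
    by simp
  have "(\<integral>\<^sup>+z. indicator N (fst z - snd z) \<partial>lborel) = (\<integral>\<^sup>+x. \<integral>\<^sup>+y. indicator N (x - y) \<partial>lborel \<partial>lborel)"
    using m by (subst nn_integral_lborel_pair) auto
  also have "\<dots> = (\<integral>\<^sup>+x. 0 \<partial>(lborel :: 'a measure))"
    by (intro nn_integral_cong) (subst nn_integral_lborel_reflect, auto simp: N)
  finally have "AE z in lborel. indicator N (fst z - snd z) = (0::ennreal)"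
    using nn_integral_0_iff_AE[OF m] by simp
  then show ?thesis by eventually_elim (use N(1) in \<open>auto simp: indicator_def split: if_splits\<close>)
qed

lemma nn_integral_linear_image:
  fixes M :: "real^'n::{finite,wellorder}^'n::{finite,wellorder}"
  assumes M: "invertible M" and f: "f \<in> borel_measurable borel"
  shows "(\<integral>\<^sup>+x. f (M *v x) \<partial>lborel) = ennreal (1 / \<bar>det M\<bar>) * (\<integral>\<^sup>+x. f x \<partial>lborel)"
proof -
  have d: "det M \<noteq> 0" using M invertible_det_nz by blast
  have "ennreal (1 / \<bar>det M\<bar>) * (\<integral>\<^sup>+x. f x \<partial>lborel) =
      ennreal (1 / \<bar>det M\<bar>) * ennreal \<bar>det M\<bar> * (\<integral>\<^sup>+x. f (M *v x) \<partial>lborel)"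
    by (subst nn_integral_linear[OF M f]) (simp add: mult.assoc)
  also have "ennreal (1 / \<bar>det M\<bar>) * ennreal \<bar>det M\<bar> = 1"
    using d by (subst ennreal_mult[symmetric]) auto
  finally show ?thesis by simp
qed

lemma AE_lborel_linear:
  fixes N :: "real^'n::{finite,wellorder}^'n::{finite,wellorder}"
  assumes N: "invertible N" and P: "AE v in lborel. P v"
  shows "AE u in lborel. P (N *v u)"
proof -
  obtain Z where Z: "{v. \<not> P v} \<subseteq> Z" "Z \<in> sets borel" "emeasure lborel Z = 0"
    using AE_E[OF P] by auto
  have [measurable]: "Z \<in> sets borel" by fact
  have d: "ennreal \<bar>det N\<bar> \<noteq> 0" using N invertible_det_nz by auto
  have "ennreal \<bar>det N\<bar> * (\<integral>\<^sup>+u. indicator Z (N *v u) \<partial>lborel) = 0"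
    using Z(3) by (subst nn_integral_linear[OF N, symmetric]) auto
  then have "(\<integral>\<^sup>+u. indicator Z (N *v u) \<partial>lborel) = 0" using d by simp
  then have "AE u in lborel. indicator Z (N *v u) = (0::ennreal)"
    by (subst (asm) nn_integral_0_iff_AE) auto
  then show ?thesis by eventually_elim (use Z(1) in \<open>auto simp: indicator_def split: if_splits\<close>)
qed

section \<open>Coordinate hyperplanes and symmetric boxes\<close>

lemma AE_vec_nth_nonzero: "AE v in lborel. (v::real^'n) $ i \<noteq> 0"
proof -
  have "negligible {v::real^'n. v $ i = 0}"
    by (rule negligible_standard_hyperplane_cart)
  then have "AE v in lebesgue. v \<notin> {v::real^'n. v $ i = 0}"
    by (intro AE_not_in) (simp add: negligible_iff_null_sets)
  then show ?thesis by (simp add: AE_completion_iff)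
qed

lemma emeasure_symmetric_box:
  fixes d :: "'n::finite \<Rightarrow> real"
  assumes d: "\<And>i. 0 \<le> d i"
  shows "emeasure lborel {v::real^'n. \<forall>i. \<bar>v $ i\<bar> \<le> d i} = ennreal (\<Prod>i\<in>UNIV. 2 * d i)"
proof -
  have "{v::real^'n. \<forall>i. \<bar>v $ i\<bar> \<le> d i} = cbox (\<chi> i. - d i) (\<chi> i. d i)"
    by (auto simp: mem_box_cart abs_le_iff minus_le_iff)
  moreover have "emeasure lborel (cbox (\<chi> i. - d i) (\<chi> i. d i)) =
      ennreal (\<Prod>b\<in>Basis. ((\<chi> i. d i) - (\<chi> i. - d i)) \<bullet> (b :: real^'n))"
    by (rule emeasure_lborel_cbox)
      (use all_Basis_vec[of "\<lambda>b. (\<chi> i. - d i) \<bullet> b \<le> (\<chi> i. d i) \<bullet> (b :: real^'n)"] d in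
        \<open>auto simp: inner_axis intro: order_trans[of _ 0]\<close>)
  ultimately show ?thesis by (simp add: prod_Basis_vec inner_axis)
qed

lemma symmetric_box_compact: "compact {v::real^'n. \<forall>i. \<bar>v $ i\<bar> \<le> d i}"
proof -
  have "{v::real^'n. \<forall>i. \<bar>v $ i\<bar> \<le> d i} = cbox (\<chi> i. - d i) (\<chi> i. d i)"
    by (auto simp: mem_box_cart abs_le_iff minus_le_iff)
  then show ?thesis by (simp add: compact_cbox)
qed

lemma sum_UNIV_5: "sum f (UNIV::5 set) = f 1 + f 2 + f 3 + f 4 + f 5"
  unfolding UNIV_5 by (simp add: add.assoc)

subsection \<open>Plancherel's inequality for images with bounded density\<close>

text \<open>This is exp(-(e |x|)^2 / 2), written as a product over the basis so that its Fourier
  transform factors into one-dimensional ones.\<close>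

definition gauss_damp :: "real \<Rightarrow> 'b::euclidean_space \<Rightarrow> real" where
  "gauss_damp e x = (\<Prod>b\<in>Basis. exp (- (e * (x \<bullet> b))\<^sup>2 / 2))"

text \<open>The Fourier transform of \<open>gauss_damp e\<close>: (2 pi)^d times the centred
  Gaussian density of standard deviation \<open>e\<close> in each coordinate, hence an approximate
  identity, up to the constant, as \<open>e\<close> tends to 0.\<close>

definition gauss_kernel :: "real \<Rightarrow> 'b::euclidean_space \<Rightarrow> real" where
  "gauss_kernel e y = (\<Prod>b\<in>Basis. 2 * pi * normal_density 0 e (y \<bullet> b))"

lemma gauss_damp_nonneg [simp]: "0 \<le> gauss_damp e x"
  by (simp add: gauss_damp_def prod_nonneg)

lemma gauss_kernel_nonneg [simp]: "0 \<le> gauss_kernel e x"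
  by (simp add: gauss_kernel_def prod_nonneg)

lemma gauss_kernel_minus: "gauss_kernel e (x - y) = gauss_kernel e (y - x)"
proof -
  have "normal_density 0 e (t - s) = normal_density 0 e (s - t)" for s t
    by (simp add: normal_density_def power2_commute)
  then show ?thesis by (simp add: gauss_kernel_def inner_diff_left)
qed

lemma gauss_damp_measurable [measurable]: "gauss_damp e \<in> borel_measurable borel"
  unfolding gauss_damp_def[abs_def] by measurable

lemma gauss_kernel_measurable [measurable]: "gauss_kernel e \<in> borel_measurable borel"
  unfolding gauss_kernel_def[abs_def] by measurable

text \<open>The scaling \<open>e * x\<close> reduces the integral to the characteristic function of
  the standard normal distribution, evaluated at \<open>t / e\<close>.\<close>

lemma gauss_fourier_real:
  assumes e: "e > 0"
  shows "integrable lborel (\<lambda>x. exp (\<i> * of_real (x * t)) * of_real (exp (- (e * x)\<^sup>2 / 2)) :: complex)"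
    and "(LINT x|lborel. exp (\<i> * of_real (x * t)) * of_real (exp (- (e * x)\<^sup>2 / 2)) :: complex) =
      of_real (2 * pi * normal_density 0 e t)"
proof -
  define g where "g = (\<lambda>x. exp (\<i> * of_real (x * (t / e))) * of_real (exp (- x\<^sup>2 / 2)) :: complex)"
  have gd: "g x = of_real (sqrt (2 * pi)) * (std_normal_density x *\<^sub>R iexp (t / e * x))" for x
    by (simp add: g_def std_normal_density_def scaleR_conv_of_real mult_ac)
  have "integrable std_normal_distribution (\<lambda>x. iexp (t / e * x))"
    by (intro finite_measure.integrable_const_bound[where B=1] prob_space.finite_measure prob_space_normal_density AE_I2) auto
  then have "integrable lborel (\<lambda>x. std_normal_density x *\<^sub>R iexp (t / e * x))"
    by (simp add: integrable_density)
  then have gi: "integrable lborel g" unfolding gd by (rule integrable_mult_right)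
  have "char std_normal_distribution (t / e) = (LINT x|lborel. std_normal_density x *\<^sub>R iexp (t / e * x))"
    unfolding char_def by (subst integral_density) auto
  then have gv: "integral\<^sup>L lborel g = of_real (sqrt (2 * pi)) * of_real (exp (- (t / e)\<^sup>2 / 2))"
    unfolding gd by (simp only: integral_mult_right_zero char_std_normal_distribution)
  have eq: "exp (\<i> * of_real (x * t)) * of_real (exp (- (e * x)\<^sup>2 / 2)) = g (0 + e * x)" for x
    using e by (simp add: g_def)
  show "integrable lborel (\<lambda>x. exp (\<i> * of_real (x * t)) * of_real (exp (- (e * x)\<^sup>2 / 2)) :: complex)"
    unfolding eq by (intro lborel_integrable_real_affine gi) (use e in auto)
  have "integral\<^sup>L lborel g = \<bar>e\<bar> *\<^sub>R (\<integral>x. g (0 + e * x) \<partial>lborel)"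
    using e by (intro lborel_integral_real_affine) auto
  then have "(\<integral>x. g (0 + e * x) \<partial>lborel) = of_real (sqrt (2 * pi) / e * exp (- (t / e)\<^sup>2 / 2))"
    using e gv by (simp add: scaleR_conv_of_real field_simps)
  also have "sqrt (2 * pi) / e * exp (- (t / e)\<^sup>2 / 2) = 2 * pi * normal_density 0 e t"
    using e by (simp add: normal_density_def real_sqrt_mult power_divide field_simps)
  finally show "(LINT x|lborel. exp (\<i> * of_real (x * t)) * of_real (exp (- (e * x)\<^sup>2 / 2)) :: complex) =
      of_real (2 * pi * normal_density 0 e t)" unfolding eq .
qed

lemma gauss_fourier:
  fixes y :: "'b::euclidean_space"
  assumes e: "e > 0"
  shows "(LINT x|lborel. exp (\<i> * of_real (x \<bullet> y)) * of_real (gauss_damp e x) :: complex) = of_real (gauss_kernel e y)"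
proof -
  interpret product_sigma_finite "\<lambda>_::'b. lborel :: real measure" ..
  let ?f = "\<lambda>b x. exp (\<i> * of_real (x * (y \<bullet> b))) * of_real (exp (- (e * x)\<^sup>2 / 2)) :: complex"
  have eq: "exp (\<i> * of_real (x \<bullet> y)) * of_real (gauss_damp e x) = (\<Prod>b\<in>Basis. ?f b (x \<bullet> b))" for x :: 'b
  proof -
    have "\<i> * of_real (x \<bullet> y) = (\<Sum>b\<in>Basis. \<i> * of_real ((x \<bullet> b) * (y \<bullet> b)))"
      by (subst euclidean_inner) (simp add: sum_distrib_left)
    then show ?thesis by (simp add: gauss_damp_def prod.distrib exp_sum)
  qed
  have "(LINT x|lborel. exp (\<i> * of_real (x \<bullet> y)) * of_real (gauss_damp e x) :: complex) =
    (LINT x|(\<Pi>\<^sub>M b\<in>Basis. lborel). (\<Prod>b\<in>Basis. ?f b ((\<Sum>b\<in>Basis. x b *\<^sub>R b) \<bullet> b)))"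
    unfolding eq by (subst lborel_eq, subst integral_distr) auto
  also have "\<dots> = (LINT x|(\<Pi>\<^sub>M b\<in>Basis. lborel). (\<Prod>b\<in>Basis. ?f b (x b)))"
    by (intro Bochner_Integration.integral_cong prod.cong refl) simp
  also have "\<dots> = (\<Prod>b\<in>Basis. LINT x|lborel. ?f b x)"
    by (intro product_integral_prod gauss_fourier_real(1) e) auto
  also have "\<dots> = of_real (gauss_kernel e y)"
    by (simp only: gauss_fourier_real(2)[OF e] gauss_kernel_def of_real_prod)
  finally show ?thesis .
qed

lemma nn_integral_gauss_kernel:
  assumes e: "e > 0"
  shows "(\<integral>\<^sup>+y. ennreal (gauss_kernel e (y::'b::euclidean_space)) \<partial>lborel) = ennreal ((2 * pi) ^ DIM('b))"
proof -
  have "(\<integral>\<^sup>+y. ennreal (gauss_kernel e (y::'b)) \<partial>lborel) =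
     (\<integral>\<^sup>+y. (\<Prod>b\<in>Basis. ennreal (2 * pi * normal_density 0 e ((y::'b) \<bullet> b))) \<partial>lborel)"
    by (simp add: gauss_kernel_def prod_ennreal)
  also have "\<dots> = (\<Prod>b\<in>(Basis::'b set). \<integral>\<^sup>+x. ennreal (2 * pi * normal_density 0 e x) \<partial>lborel)"
    by (intro nn_integral_lborel_prod) auto
  also have "(\<integral>\<^sup>+x. ennreal (2 * pi * normal_density 0 e x) \<partial>lborel) = ennreal (2 * pi)"
    using e by (subst nn_integral_eq_integral) (auto)
  finally show ?thesis by (simp add: ennreal_power)
qed

lemma integrable_gauss_damp:
  assumes e: "e > 0"
  shows "integrable lborel (gauss_damp e :: 'b::euclidean_space \<Rightarrow> real)"
proof (rule integrableI_nonneg)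
  have 1: "(\<integral>\<^sup>+x. ennreal (exp (- (e * x)\<^sup>2 / 2)) \<partial>lborel) < \<infinity>"
    using gauss_fourier_real(1)[OF e, of 0] by (auto simp: integrable_iff_bounded)
  have "(\<integral>\<^sup>+x. ennreal (gauss_damp e (x::'b)) \<partial>lborel) =
     (\<integral>\<^sup>+x. (\<Prod>b\<in>Basis. ennreal (exp (- (e * ((x::'b) \<bullet> b))\<^sup>2 / 2))) \<partial>lborel)"
    by (simp add: gauss_damp_def prod_ennreal)
  also have "\<dots> = (\<Prod>b\<in>(Basis::'b set). \<integral>\<^sup>+x. ennreal (exp (- (e * x)\<^sup>2 / 2)) \<partial>lborel)"
    by (intro nn_integral_lborel_prod) auto
  also have "\<dots> < \<infinity>" using 1 by (simp add: power_less_top_ennreal)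
  finally show "(\<integral>\<^sup>+x. ennreal (gauss_damp e (x::'b)) \<partial>lborel) < \<infinity>" .
qed auto

section \<open>Gaussian damping and the weighted Schur test\<close>

lemma integrable_pair_mult:
  fixes f :: "'a \<Rightarrow> complex" and g :: "'b \<Rightarrow> complex"
  assumes "sigma_finite_measure M" "sigma_finite_measure N" and f: "integrable M f" and g: "integrable N g"
  shows "integrable (M \<Otimes>\<^sub>M N) (\<lambda>(x, y). f x * g y)"
proof -
  interpret M: sigma_finite_measure M by fact
  interpret N: sigma_finite_measure N by fact
  interpret P: pair_sigma_finite M N ..
  note [measurable] = borel_measurable_integrable[OF f] borel_measurable_integrable[OF g]
  show ?thesis
    by (rule P.Fubini_integrable) (auto simp: norm_mult f g intro!: integrable_mult_left integrable_norm)
qed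

text \<open>The squared modulus is a double integral over (z, z') with phase
  \<open>x \<bullet> (\<Psi> z - \<Psi> z')\<close>. The damping makes the integral over (x, z, z')
  absolutely convergent, so x can be integrated first, which produces the Gaussian kernel. Passing
  to absolute values at the end costs the equality.\<close>

lemma gaussian_plancherel:
  fixes k :: "'z \<Rightarrow> complex" and \<Psi> :: "'z \<Rightarrow> 'b::euclidean_space"
  assumes M: "sigma_finite_measure M" and k: "integrable M k"
    and \<Psi>[measurable]: "\<Psi> \<in> borel_measurable M" and e: "e > 0"
  shows "(\<integral>\<^sup>+x. ennreal ((norm (LINT z|M. exp (\<i> * of_real (x \<bullet> \<Psi> z)) * k z))\<^sup>2 * gauss_damp e x) \<partial>lborel)
    \<le> (\<integral>\<^sup>+z. \<integral>\<^sup>+z'. ennreal (norm (k z) * norm (k z') * gauss_kernel e (\<Psi> z - \<Psi> z')) \<partial>M \<partial>M)"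
proof -
  interpret M: sigma_finite_measure M by fact
  interpret MM: pair_sigma_finite M M ..
  interpret P: pair_sigma_finite "lborel :: 'b measure" "M \<Otimes>\<^sub>M M" ..
  note [measurable] = borel_measurable_integrable[OF k]
  define H where "H x = (LINT z|M. exp (\<i> * of_real (x \<bullet> \<Psi> z)) * k z)" for x
  define q where "q = (\<lambda>(z, z'). k z * cnj (k z'))"
  define \<Theta> where "\<Theta> = (\<lambda>(z, z'). \<Psi> z - \<Psi> z')"
  have q: "integrable (M \<Otimes>\<^sub>M M) q" unfolding q_def
    using k by (intro integrable_pair_mult M) auto
  note [measurable] = borel_measurable_integrable[OF q]
  have [measurable]: "\<Theta> \<in> borel_measurable (M \<Otimes>\<^sub>M M)"
    unfolding \<Theta>_def split_beta' by measurable
  define F where "F = (\<lambda>(x, p). of_real (gauss_damp e x) * (exp (\<i> * of_real (x \<bullet> \<Theta> p)) * q p))"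
  have Fi: "integrable (lborel \<Otimes>\<^sub>M (M \<Otimes>\<^sub>M M)) F"
  proof (rule Bochner_Integration.integrable_bound)
    show "integrable (lborel \<Otimes>\<^sub>M (M \<Otimes>\<^sub>M M)) (\<lambda>(x, p). of_real (gauss_damp e x) * q p)"
      by (intro integrable_pair_mult q integrable_of_real integrable_gauss_damp e) unfold_locales
    show "F \<in> borel_measurable (lborel \<Otimes>\<^sub>M (M \<Otimes>\<^sub>M M))" unfolding F_def by measurable
  qed (auto simp: F_def norm_mult)
  have ik: "integrable M (\<lambda>z. exp (\<i> * of_real (x \<bullet> \<Psi> z)) * k z)" for x
    by (rule Bochner_Integration.integrable_bound[OF k]) (auto simp: norm_mult)
  have HH: "(LINT p|(M \<Otimes>\<^sub>M M). exp (\<i> * of_real (x \<bullet> \<Theta> p)) * q p) = H x * cnj (H x)" for x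
  proof -
    have eq: "(\<lambda>p. exp (\<i> * of_real (x \<bullet> \<Theta> p)) * q p) =
       (\<lambda>(z, z'). (exp (\<i> * of_real (x \<bullet> \<Psi> z)) * k z) * cnj (exp (\<i> * of_real (x \<bullet> \<Psi> z')) * k z'))"
      by (auto simp: fun_eq_iff \<Theta>_def q_def inner_diff_right exp_cnj right_diff_distrib exp_diff exp_minus field_simps)
    have "integrable (M \<Otimes>\<^sub>M M) (\<lambda>(z, z'). (exp (\<i> * of_real (x \<bullet> \<Psi> z)) * k z) * cnj (exp (\<i> * of_real (x \<bullet> \<Psi> z')) * k z'))"
      by (intro integrable_pair_mult M ik) (simp only: complex_integrable_cnj ik)
    from MM.integral_fst[OF this] show ?thesis
      unfolding eq H_def by (simp only: integral_mult_left_zero integral_mult_right_zero Bochner_Integration.integral_cnj)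
  qed
  have inner: "(LINT p|(M \<Otimes>\<^sub>M M). F (x, p)) = of_real ((norm (H x))\<^sup>2 * gauss_damp e x)" for x
  proof -
    have "(LINT p|(M \<Otimes>\<^sub>M M). F (x, p)) = of_real (gauss_damp e x) * (H x * cnj (H x))"
      unfolding F_def by (simp add: HH)
    then show ?thesis by (simp add: complex_mult_cnj cmod_power2 mult.commute)
  qed
  have innerx: "(LINT x|lborel. F (x, p)) = of_real (gauss_kernel e (\<Theta> p)) * q p" for p
  proof -
    have "(LINT x|lborel. F (x, p)) = (LINT x|lborel. (exp (\<i> * of_real (x \<bullet> \<Theta> p)) * of_real (gauss_damp e x)) * q p)"
      unfolding F_def by (intro Bochner_Integration.integral_cong) auto
    then show ?thesis using gauss_fourier[OF e, of "\<Theta> p"] by simp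
  qed
  have int1: "integrable lborel (\<lambda>x. of_real ((norm (H x))\<^sup>2 * gauss_damp e x) :: complex)"
    using P.integrable_fst'[OF Fi] unfolding inner .
  have int2: "integrable (M \<Otimes>\<^sub>M M) (\<lambda>p. of_real (gauss_kernel e (\<Theta> p)) * q p)"
    using P.integrable_snd[of "\<lambda>x p. F (x, p)"] Fi by (simp add: innerx)
  have "(LINT x|lborel. LINT p|(M \<Otimes>\<^sub>M M). F (x, p)) = (LINT p|(M \<Otimes>\<^sub>M M). LINT x|lborel. F (x, p))"
    using P.Fubini_integral[of "\<lambda>x p. F (x, p)"] Fi by simp
  then have eq: "of_real (LINT x|lborel. (norm (H x))\<^sup>2 * gauss_damp e x) = (LINT p|(M \<Otimes>\<^sub>M M). of_real (gauss_kernel e (\<Theta> p)) * q p)"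
    unfolding inner innerx by (simp only: integral_complex_of_real)
  have "integrable lborel (\<lambda>x. (norm (H x))\<^sup>2 * gauss_damp e x)"
    using integrable_Re[OF int1] by simp
  then have "(\<integral>\<^sup>+x. ennreal ((norm (H x))\<^sup>2 * gauss_damp e x) \<partial>lborel) = ennreal (LINT x|lborel. (norm (H x))\<^sup>2 * gauss_damp e x)"
    by (intro nn_integral_eq_integral) auto
  also have "\<dots> \<le> ennreal (norm (LINT p|(M \<Otimes>\<^sub>M M). of_real (gauss_kernel e (\<Theta> p)) * q p))"
    unfolding eq[symmetric] by (intro ennreal_leI) simp
  also have "\<dots> \<le> (\<integral>\<^sup>+p. ennreal (norm (of_real (gauss_kernel e (\<Theta> p)) * q p)) \<partial>(M \<Otimes>\<^sub>M M))"
    by (rule integral_norm_bound_ennreal[OF int2])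
  also have "\<dots> = (\<integral>\<^sup>+p. (\<lambda>(z, z'). ennreal (norm (k z) * norm (k z') * gauss_kernel e (\<Psi> z - \<Psi> z'))) p \<partial>(M \<Otimes>\<^sub>M M))"
    by (intro nn_integral_cong) (auto simp: q_def \<Theta>_def norm_mult mult_ac)
  also have "\<dots> = (\<integral>\<^sup>+z. \<integral>\<^sup>+z'. ennreal (norm (k z) * norm (k z') * gauss_kernel e (\<Psi> z - \<Psi> z')) \<partial>M \<partial>M)"
    by (subst M.nn_integral_fst[symmetric]) auto
  finally show ?thesis unfolding H_def .
qed

text \<open>Where k does not vanish, the arithmetic-geometric mean inequality bounds |k(z)| |k(z')|
  by the average of |k(z)|^2 V(z') / V(z) and its mirror image. Both halves contribute equally
  because the kernel is symmetric. The remaining integral of the kernel against V is handled by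
  \<open>dens\<close>, and the mass of the kernel is (2 pi)^d for every \<open>e\<close>.\<close>

lemma schur_bound:
  fixes k :: "'z \<Rightarrow> complex" and \<Psi> :: "'z \<Rightarrow> 'b::euclidean_space"
  assumes M: "sigma_finite_measure M" and [measurable]: "k \<in> borel_measurable M"
    "\<Psi> \<in> borel_measurable M" "V \<in> borel_measurable M" and e: "e > 0"
    and V: "\<And>z. 0 \<le> V z" and pos: "AE z in M. k z \<noteq> 0 \<longrightarrow> 0 < V z"
    and dens: "\<And>h. h \<in> borel_measurable borel \<Longrightarrow>
      (\<integral>\<^sup>+z. h (\<Psi> z) * ennreal (V z) \<partial>M) \<le> C * (\<integral>\<^sup>+y. h y \<partial>lborel)"
  shows "(\<integral>\<^sup>+z. \<integral>\<^sup>+z'. ennreal (norm (k z) * norm (k z') * gauss_kernel e (\<Psi> z - \<Psi> z')) \<partial>M \<partial>M)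
    \<le> ennreal ((2 * pi) ^ DIM('b)) * C * (\<integral>\<^sup>+z. ennreal ((norm (k z))\<^sup>2 / V z) \<partial>M)"
proof -
  interpret M: sigma_finite_measure M by fact
  interpret MM: pair_sigma_finite M M ..
  define a where "a z = ennreal ((norm (k z))\<^sup>2 / V z)" for z
  define G where "G z z' = ennreal (gauss_kernel e (\<Psi> z - \<Psi> z'))" for z z'
  have G_sym: "G z z' = G z' z" for z z' by (simp add: G_def gauss_kernel_minus)
  have [measurable]: "(\<lambda>(z, z'). G z z') \<in> borel_measurable (M \<Otimes>\<^sub>M M)" "a \<in> borel_measurable M"
    unfolding a_def G_def by measurable
  have [measurable]: "G z \<in> borel_measurable M" for z unfolding G_def by measurable
  let ?I = "\<integral>\<^sup>+z. a z * (\<integral>\<^sup>+z'. G z z' * ennreal (V z') \<partial>M) \<partial>M"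
  have "(\<integral>\<^sup>+z. \<integral>\<^sup>+z'. ennreal (norm (k z) * norm (k z') * gauss_kernel e (\<Psi> z - \<Psi> z')) \<partial>M \<partial>M)
    \<le> (\<integral>\<^sup>+z. \<integral>\<^sup>+z'. ennreal (1/2) * (a z * (G z z' * ennreal (V z'))) + ennreal (1/2) * (a z' * (G z z' * ennreal (V z))) \<partial>M \<partial>M)"
  proof (rule nn_integral_mono_AE, use pos in eventually_elim, rule nn_integral_mono_AE, use pos in eventually_elim)
    fix z z' assume z: "k z \<noteq> 0 \<longrightarrow> 0 < V z" and z': "k z' \<noteq> 0 \<longrightarrow> 0 < V z'"
    define A where "A = (norm (k z))\<^sup>2 / V z * V z'"
    define B where "B = (norm (k z'))\<^sup>2 / V z' * V z"
    have AB: "0 \<le> A" "0 \<le> B" using V by (auto simp: A_def B_def)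
    have "norm (k z) * norm (k z') \<le> (A + B) / 2"
    proof (cases "k z = 0 \<or> k z' = 0")
      case True then show ?thesis using AB by auto
    next
      case False
      then have p: "0 < V z" "0 < V z'" using z z' by auto
      have "(norm (k z) * norm (k z'))\<^sup>2 = A * B" using p by (simp add: A_def B_def power_mult_distrib)
      moreover have "A * B \<le> ((A + B) / 2)\<^sup>2"
        using zero_le_power2[of "A - B"] by (simp add: power2_eq_square algebra_simps)
      ultimately show ?thesis using AB by (metis add_nonneg_nonneg divide_nonneg_nonneg order_refl power2_le_imp_le zero_le_numeral)
    qed
    then have "norm (k z) * norm (k z') * gauss_kernel e (\<Psi> z - \<Psi> z') \<le> (A + B) / 2 * gauss_kernel e (\<Psi> z - \<Psi> z')"
      by (intro mult_right_mono) auto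
    also have "\<dots> = 1/2 * ((norm (k z))\<^sup>2 / V z * (gauss_kernel e (\<Psi> z - \<Psi> z') * V z')) +
       1/2 * ((norm (k z'))\<^sup>2 / V z' * (gauss_kernel e (\<Psi> z - \<Psi> z') * V z))"
      by (simp add: A_def B_def algebra_simps add_divide_distrib)
    finally have "ennreal (norm (k z) * norm (k z') * gauss_kernel e (\<Psi> z - \<Psi> z')) \<le> ennreal \<dots>"
      by (rule ennreal_leI)
    also have "\<dots> = ennreal (1/2) * (a z * (G z z' * ennreal (V z'))) + ennreal (1/2) * (a z' * (G z z' * ennreal (V z)))"
      using V unfolding a_def G_def
      by (subst ennreal_plus) (simp_all add: ennreal_mult[symmetric] del: ennreal_half)
    finally show "ennreal (norm (k z) * norm (k z') * gauss_kernel e (\<Psi> z - \<Psi> z')) \<le>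
      ennreal (1/2) * (a z * (G z z' * ennreal (V z'))) + ennreal (1/2) * (a z' * (G z z' * ennreal (V z)))" .
  qed
  also have "\<dots> = ennreal (1/2) * ?I + ennreal (1/2) * (\<integral>\<^sup>+z. \<integral>\<^sup>+z'. a z' * (G z z' * ennreal (V z)) \<partial>M \<partial>M)"
  proof -
    have 1: "(\<lambda>z. \<integral>\<^sup>+z'. G z z' * ennreal (V z') \<partial>M) \<in> borel_measurable M"
      "(\<lambda>z. \<integral>\<^sup>+z'. a z' * (G z z' * ennreal (V z)) \<partial>M) \<in> borel_measurable M"
      by (auto intro!: M.borel_measurable_nn_integral)
    show ?thesis using 1
      by (simp add: nn_integral_add nn_integral_cmult del: ennreal_half)
  qed
  also have "(\<integral>\<^sup>+z. \<integral>\<^sup>+z'. a z' * (G z z' * ennreal (V z)) \<partial>M \<partial>M) = (\<integral>\<^sup>+z'. \<integral>\<^sup>+z. a z' * (G z z' * ennreal (V z)) \<partial>M \<partial>M)"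
    by (rule MM.Fubini'[symmetric]) measurable
  also have "\<dots> = ?I"
    by (subst G_sym) (simp add: nn_integral_cmult)
  also have "ennreal (1/2) * ?I + ennreal (1/2) * ?I = ?I"
    unfolding distrib_right[symmetric] by (subst ennreal_plus[symmetric]) auto
  also have "?I \<le> (\<integral>\<^sup>+z. a z * (C * ennreal ((2 * pi) ^ DIM('b))) \<partial>M)"
  proof (intro nn_integral_mono mult_left_mono)
    fix z
    have "(\<integral>\<^sup>+z'. G z z' * ennreal (V z') \<partial>M) \<le> C * (\<integral>\<^sup>+y. ennreal (gauss_kernel e (\<Psi> z - y)) \<partial>lborel)"
      unfolding G_def by (rule dens) measurable
    also have "(\<integral>\<^sup>+y. ennreal (gauss_kernel e (\<Psi> z - y)) \<partial>lborel) = (\<integral>\<^sup>+y. ennreal (gauss_kernel e (y - \<Psi> z)) \<partial>lborel)"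
      by (simp add: gauss_kernel_minus)
    also have "\<dots> = (\<integral>\<^sup>+y. ennreal (gauss_kernel e ((\<Psi> z + 1 *\<^sub>R y) - \<Psi> z)) \<partial>lborel)"
      by (subst nn_integral_lborel_affine[where c=1 and t="\<Psi> z"]) auto
    also have "\<dots> = ennreal ((2 * pi) ^ DIM('b))"
      by (simp add: nn_integral_gauss_kernel e)
    finally show "(\<integral>\<^sup>+z'. G z z' * ennreal (V z') \<partial>M) \<le> C * ennreal ((2 * pi) ^ DIM('b))" .
  qed simp
  also have "\<dots> = ennreal ((2 * pi) ^ DIM('b)) * C * (\<integral>\<^sup>+z. a z \<partial>M)"
    by (subst nn_integral_multc) (simp_all only: mult_ac \<open>a \<in> borel_measurable M\<close>)
  finally show ?thesis unfolding a_def .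
qed

text \<open>The Schur bound does not depend on the damping, so Fatou's lemma along
  \<open>e = 1 / Suc n\<close> removes it. The hypothesis \<open>dens\<close> says, by testing
  against functions h, that the image of V dM under \<Psi> has density at most C; this dual form
  never names the density.\<close>

theorem fourier_L2_bound:
  fixes k :: "'z \<Rightarrow> complex" and \<Psi> :: "'z \<Rightarrow> 'b::euclidean_space"
  assumes M: "sigma_finite_measure M" and k: "integrable M k"
    and [measurable]: "\<Psi> \<in> borel_measurable M" "V \<in> borel_measurable M"
    and V: "\<And>z. 0 \<le> V z" and pos: "AE z in M. k z \<noteq> 0 \<longrightarrow> 0 < V z"
    and dens: "\<And>h. h \<in> borel_measurable borel \<Longrightarrow>
      (\<integral>\<^sup>+z. h (\<Psi> z) * ennreal (V z) \<partial>M) \<le> C * (\<integral>\<^sup>+y. h y \<partial>lborel)"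
  shows "(\<integral>\<^sup>+x. ennreal ((norm (LINT z|M. exp (\<i> * of_real (x \<bullet> \<Psi> z)) * k z))\<^sup>2) \<partial>lborel)
    \<le> ennreal ((2 * pi) ^ DIM('b)) * C * (\<integral>\<^sup>+z. ennreal ((norm (k z))\<^sup>2 / V z) \<partial>M)"
    (is "_ \<le> ?R")
proof -
  interpret M: sigma_finite_measure M by fact
  note [measurable] = borel_measurable_integrable[OF k]
  define H where "H x = (LINT z|M. exp (\<i> * of_real (x \<bullet> \<Psi> z)) * k z)" for x
  define u where "u n x = ennreal ((norm (H x))\<^sup>2 * gauss_damp (1 / Suc n) x)" for n and x
  have [measurable]: "H \<in> borel_measurable borel" unfolding H_def by measurable
  have [measurable]: "u n \<in> borel_measurable lborel" for n unfolding u_def by measurable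
  have lim: "(\<lambda>n. u n x) \<longlonglongrightarrow> ennreal ((norm (H x))\<^sup>2)" for x
  proof -
    have "(\<lambda>n. gauss_damp (1 / Suc n) x) \<longlonglongrightarrow> (\<Prod>b\<in>Basis. exp (- (0 * (x \<bullet> b))\<^sup>2 / 2))"
      unfolding gauss_damp_def by (intro tendsto_intros LIMSEQ_Suc[OF lim_1_over_n]) auto
    then have "(\<lambda>n. (norm (H x))\<^sup>2 * gauss_damp (1 / Suc n) x) \<longlonglongrightarrow> (norm (H x))\<^sup>2 * 1"
      by (intro tendsto_intros) simp
    then show ?thesis unfolding u_def by (intro tendsto_ennrealI) simp
  qed
  have "(\<integral>\<^sup>+x. ennreal ((norm (H x))\<^sup>2) \<partial>lborel) = (\<integral>\<^sup>+x. liminf (\<lambda>n. u n x) \<partial>lborel)"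
    by (intro nn_integral_cong lim_imp_Liminf[symmetric] lim) auto
  also have "\<dots> \<le> liminf (\<lambda>n. \<integral>\<^sup>+x. u n x \<partial>lborel)"
    by (rule nn_integral_liminf) measurable
  also have "\<dots> \<le> liminf (\<lambda>n::nat. ?R)"
  proof (rule Liminf_mono, rule always_eventually, rule allI)
    fix n
    have "(\<integral>\<^sup>+x. u n x \<partial>lborel) \<le> (\<integral>\<^sup>+z. \<integral>\<^sup>+z'. ennreal (norm (k z) * norm (k z') * gauss_kernel (1 / Suc n) (\<Psi> z - \<Psi> z')) \<partial>M \<partial>M)"
      unfolding u_def H_def by (rule gaussian_plancherel[OF M k]) auto
    also have "\<dots> \<le> ?R"
      by (rule schur_bound[OF M _ _ _ _ V pos dens]) auto
    finally show "(\<integral>\<^sup>+x. u n x \<partial>lborel) \<le> ?R" .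
  qed
  also have "\<dots> = ?R" by (simp add: Liminf_const)
  finally show ?thesis unfolding H_def .
qed

subsection \<open>The form \<open>(\<xi>\<^sub>1\<xi>\<^sub>2, \<xi>\<^sub>1\<xi>\<^sub>3 + \<xi>\<^sub>2\<^sup>2)\<close>\<close>

text \<open>For b \<ge> 0 the difference factors as (|x| - c)(|x| + c) up to sign, and |x| + c \<ge>
  |x|. For b < 0 the choice c = 0 covers the case without real roots, so that later bounds are
  uniform in b.\<close>

lemma abs_diff_square_ge:
  fixes b x :: real
  defines "c \<equiv> sqrt (max b 0)"
  shows "\<bar>x\<bar> * \<bar>\<bar>x\<bar> - c\<bar> \<le> \<bar>b - x\<^sup>2\<bar>"
proof (cases "0 \<le> b")
  case True
  then have c: "0 \<le> c" "b = c * c" by (simp_all add: c_def)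
  have "\<bar>b - x\<^sup>2\<bar> = \<bar>(\<bar>x\<bar> - c) * (\<bar>x\<bar> + c)\<bar>"
    using abs_mult_self_eq[of x] by (simp add: c power2_eq_square algebra_simps abs_minus_commute)
  also have "\<dots> = \<bar>\<bar>x\<bar> - c\<bar> * (\<bar>x\<bar> + c)" using c by (simp add: abs_mult)
  also have "\<bar>\<bar>x\<bar> - c\<bar> * \<bar>x\<bar> \<le> \<dots>" using c by (intro mult_left_mono) auto
  ultimately show ?thesis by (simp add: mult.commute)
next
  case False
  then have "c = 0" by (simp add: c_def)
  moreover have "x\<^sup>2 \<le> \<bar>b - x\<^sup>2\<bar>" using False by auto
  ultimately show ?thesis by (simp add: power2_eq_square)
qed

text \<open>The cubic dominates |y| * ||y| - c| * |y|. If y has distance more than t from each of 0,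
  c and -c, all three factors exceed t. The sublevel set therefore lies in three intervals of length
  2t, whatever b is.\<close>

lemma cubic_sublevel_measure:
  fixes b t :: real
  assumes t: "0 \<le> t"
  shows "emeasure lborel {y. \<bar>b - y\<^sup>2\<bar> * \<bar>y\<bar> \<le> t ^ 3} \<le> ennreal (6 * t)"
proof -
  define c where "c = sqrt (max b 0)"
  have "{y. \<bar>b - y\<^sup>2\<bar> * \<bar>y\<bar> \<le> t ^ 3} \<subseteq> {- t..t} \<union> ({c - t..c + t} \<union> {- c - t..- c + t})"
  proof safe
    fix y assume y: "\<bar>b - y\<^sup>2\<bar> * \<bar>y\<bar> \<le> t ^ 3" and 1: "y \<notin> {- t..t}" and 2: "y \<notin> {- c - t..- c + t}"
    show "y \<in> {c - t..c + t}"
    proof (rule ccontr)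
      assume 3: "y \<notin> {c - t..c + t}"
      have "t < \<bar>y\<bar>" using 1 by auto
      moreover have "t < \<bar>\<bar>y\<bar> - c\<bar>" using 2 3 by auto
      ultimately have "t * t * t < \<bar>y\<bar> * \<bar>\<bar>y\<bar> - c\<bar> * \<bar>y\<bar>"
        using t by (intro mult_strict_mono) auto
      also have "\<dots> \<le> \<bar>b - y\<^sup>2\<bar> * \<bar>y\<bar>"
        unfolding c_def by (intro mult_right_mono abs_diff_square_ge) auto
      finally show False using y by (simp add: power3_eq_cube)
    qed
  qed
  then have "emeasure lborel {y. \<bar>b - y\<^sup>2\<bar> * \<bar>y\<bar> \<le> t ^ 3} \<le>
      emeasure lborel ({- t..t} \<union> ({c - t..c + t} \<union> {- c - t..- c + t}))"
    by (intro emeasure_mono) auto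
  also have "\<dots> \<le> emeasure lborel {- t..t} + (emeasure lborel {c - t..c + t} + emeasure lborel {- c - t..- c + t})"
    by (intro order_trans[OF emeasure_subadditive] add_left_mono emeasure_subadditive) auto
  also have "\<dots> = ennreal (2 * t) + (ennreal (2 * t) + ennreal (2 * t))"
    using t by simp
  also have "\<dots> = ennreal (6 * t)"
    using t by (simp add: ennreal_plus[symmetric] del: ennreal_plus)
  finally show ?thesis .
qed

definition form1 :: "real^3 \<Rightarrow> real^2" where
  "form1 v = vector [v $ 1 * v $ 2, v $ 1 * v $ 3 + (v $ 2)\<^sup>2]"

lemma form1_measurable [measurable]: "form1 \<in> borel_measurable borel"
  unfolding form1_def[abs_def] by measurable

text \<open>Write (a, b) for the value of the form and keep y = v_2 as the fibre coordinate. Then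
  v_1 = a / y and v_3 = (b - y^2) y / a, and the volume element is da db dy / |a|. The weight
  |a|^(2/3) leaves |a|^(-1/3), while |v_3| \<le> R becomes a cubic sublevel condition on y whose
  measure is at most 6 (R |a|)^(1/3), so the powers of |a| cancel.\<close>

lemma form1_density:
  fixes h :: "real^2 \<Rightarrow> ennreal"
  assumes R: "0 < R" and [measurable]: "h \<in> borel_measurable borel"
  shows "(\<integral>\<^sup>+v. h (form1 v) * ennreal (\<bar>v $ 1 * v $ 2\<bar> powr (2/3) * indicator {-R..R} (v $ 3)) \<partial>lborel)
    \<le> ennreal (6 * R powr (1/3)) * (\<integral>\<^sup>+y. h y \<partial>lborel)"
proof -
  define k where "k a b = h (vector [a, b])" for a b
  have k[measurable]: "(\<lambda>(a, b). k a b) \<in> borel_measurable (borel \<Otimes>\<^sub>M borel)"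
    unfolding k_def by measurable
  \<comment> \<open>\<open>J\<close> is the integrand in the final coordinates (a, b, y);
    \<open>F\<close> below is the intermediate form in which only v_3 has been replaced by
    b.\<close>
  define J where "J a b y = k a b * ennreal (\<bar>a\<bar> powr (-1/3) * indicator {s. s \<le> 0} (\<bar>b - y\<^sup>2\<bar> * \<bar>y\<bar> - R * \<bar>a\<bar>))" for a b y
  have J[measurable]: "(\<lambda>(a, b, y). J a b y) \<in> borel_measurable (borel \<Otimes>\<^sub>M borel \<Otimes>\<^sub>M borel)"
    unfolding J_def by measurable
  define F where "F x y b = k (x * y) b * ennreal (\<bar>x * y\<bar> powr (2/3) * indicator {- R..R} ((b - y\<^sup>2) / x))" for x y b
  have F[measurable]: "(\<lambda>(a, b, y). F a b y) \<in> borel_measurable (borel \<Otimes>\<^sub>M borel \<Otimes>\<^sub>M borel)"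
    unfolding F_def by measurable
  have "(\<integral>\<^sup>+v. h (form1 v) * ennreal (\<bar>v $ 1 * v $ 2\<bar> powr (2/3) * indicator {-R..R} (v $ 3)) \<partial>lborel) =
    (\<integral>\<^sup>+x. \<integral>\<^sup>+y. \<integral>\<^sup>+z. k (x * y) (x * z + y\<^sup>2) * ennreal (\<bar>x * y\<bar> powr (2/3) * indicator {-R..R} z) \<partial>lborel \<partial>lborel \<partial>lborel)"
    by (subst nn_integral_vector3) (auto simp: form1_def k_def)
  also have "\<dots> = (\<integral>\<^sup>+x. \<integral>\<^sup>+y. ennreal (1 / \<bar>x\<bar>) * (\<integral>\<^sup>+b. F x y b \<partial>lborel) \<partial>lborel \<partial>lborel)"
  proof (rule nn_integral_cong_AE, use AE_lborel_singleton[of "0::real"] in eventually_elim, rule nn_integral_cong)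
    fix x y :: real assume x: "x \<noteq> 0"
    have "(\<integral>\<^sup>+z. k (x * y) (x * z + y\<^sup>2) * ennreal (\<bar>x * y\<bar> powr (2/3) * indicator {-R..R} z) \<partial>lborel) =
      (\<integral>\<^sup>+z. F x y (y\<^sup>2 + x * z) \<partial>lborel)"
      using x by (simp add: F_def add.commute)
    also have "\<dots> = ennreal (1 / \<bar>x\<bar>) * (\<integral>\<^sup>+b. F x y b \<partial>lborel)"
      using x by (intro nn_integral_affine_image) auto
    finally show "(\<integral>\<^sup>+z. k (x * y) (x * z + y\<^sup>2) * ennreal (\<bar>x * y\<bar> powr (2/3) * indicator {-R..R} z) \<partial>lborel) =
       ennreal (1 / \<bar>x\<bar>) * (\<integral>\<^sup>+b. F x y b \<partial>lborel)" .
  qed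
  also have "\<dots> = (\<integral>\<^sup>+y. \<integral>\<^sup>+x. ennreal (1 / \<bar>x\<bar>) * (\<integral>\<^sup>+b. F x y b \<partial>lborel) \<partial>lborel \<partial>lborel)"
  proof (rule nn_integral_swap)
    show "(\<lambda>(x, y). ennreal (1 / \<bar>x\<bar>) * (\<integral>\<^sup>+b. F x y b \<partial>lborel)) \<in> borel_measurable borel"
      unfolding borel_prod[symmetric] split_beta' F_def by measurable
  qed
  also have "\<dots> = (\<integral>\<^sup>+y. \<integral>\<^sup>+a. \<integral>\<^sup>+b. J a b y \<partial>lborel \<partial>lborel \<partial>lborel)"
  proof (rule nn_integral_cong_AE, use AE_lborel_singleton[of "0::real"] in eventually_elim)
    fix y :: real assume y: "y \<noteq> 0"
    have "(\<integral>\<^sup>+x. ennreal (1 / \<bar>x\<bar>) * (\<integral>\<^sup>+b. F x y b \<partial>lborel) \<partial>lborel) = (\<integral>\<^sup>+x. ennreal \<bar>y\<bar> * (\<integral>\<^sup>+b. J (0 + y * x) b y \<partial>lborel) \<partial>lborel)"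
    proof (rule nn_integral_cong_AE, use AE_lborel_singleton[of "0::real"] in eventually_elim)
      fix x :: real assume x: "x \<noteq> 0"
      \<comment> \<open>The factor |y| split off here cancels the Jacobian 1 / |y| of the next
        substitution a = y * x.\<close>
      have "ennreal (1 / \<bar>x\<bar>) * F x y b = ennreal \<bar>y\<bar> * J (0 + y * x) b y" for b
      proof -
        have 1: "(\<bar>(b - y\<^sup>2) / x\<bar> \<le> R) = (\<bar>b - y\<^sup>2\<bar> * \<bar>y\<bar> \<le> R * \<bar>y * x\<bar>)"
          using x y by (simp add: abs_mult field_simps)
        have 2: "w \<in> {- R..R} \<longleftrightarrow> \<bar>w\<bar> \<le> R" for w by auto
        have "(indicator {- R..R} ((b - y\<^sup>2) / x) :: real) = indicator {s. s \<le> 0} (\<bar>b - y\<^sup>2\<bar> * \<bar>y\<bar> - R * \<bar>y * x\<bar>)"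
          using 1 by (simp only: indicator_def 2 mem_Collect_eq diff_le_0_iff_le)
        moreover have "1 / \<bar>x\<bar> * \<bar>x * y\<bar> powr (2/3) = \<bar>y\<bar> * \<bar>y * x\<bar> powr (-1/3)"
        proof -
          have "\<bar>y * x\<bar> powr (2/3) = \<bar>y * x\<bar> * \<bar>y * x\<bar> powr (-1/3)"
            using x y powr_add[of "\<bar>y * x\<bar>" 1 "-1/3"] by simp
          then show ?thesis using x by (simp add: abs_mult mult.commute)
        qed
        ultimately have "1 / \<bar>x\<bar> * (\<bar>x * y\<bar> powr (2/3) * indicator {- R..R} ((b - y\<^sup>2) / x)) =
          \<bar>y\<bar> * (\<bar>y * x\<bar> powr (-1/3) * indicator {s. s \<le> 0} (\<bar>b - y\<^sup>2\<bar> * \<bar>y\<bar> - R * \<bar>y * x\<bar>))"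
          by (simp only: mult.assoc[symmetric])
        then have "ennreal (1 / \<bar>x\<bar>) * ennreal (\<bar>x * y\<bar> powr (2/3) * indicator {- R..R} ((b - y\<^sup>2) / x)) =
          ennreal \<bar>y\<bar> * ennreal (\<bar>y * x\<bar> powr (-1/3) * indicator {s. s \<le> 0} (\<bar>b - y\<^sup>2\<bar> * \<bar>y\<bar> - R * \<bar>y * x\<bar>))"
          by (subst (1 2) ennreal_mult[symmetric]) auto
        then show ?thesis
          unfolding F_def J_def add_0 mult.commute[of x y] by (metis mult.left_commute)
      qed
      then show "ennreal (1 / \<bar>x\<bar>) * (\<integral>\<^sup>+b. F x y b \<partial>lborel) = ennreal \<bar>y\<bar> * (\<integral>\<^sup>+b. J (0 + y * x) b y \<partial>lborel)"
        by (simp add: nn_integral_cmult[symmetric])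
    qed
    also have "\<dots> = ennreal \<bar>y\<bar> * (\<integral>\<^sup>+x. \<integral>\<^sup>+b. J (0 + y * x) b y \<partial>lborel \<partial>lborel)"
      unfolding J_def by (rule nn_integral_cmult) measurable
    also have "(\<integral>\<^sup>+x. \<integral>\<^sup>+b. J (0 + y * x) b y \<partial>lborel \<partial>lborel) = ennreal (1 / \<bar>y\<bar>) * (\<integral>\<^sup>+a. \<integral>\<^sup>+b. J a b y \<partial>lborel \<partial>lborel)"
      unfolding J_def by (rule nn_integral_affine_image) (use y in auto)
    also have "ennreal \<bar>y\<bar> * (ennreal (1 / \<bar>y\<bar>) * (\<integral>\<^sup>+a. \<integral>\<^sup>+b. J a b y \<partial>lborel \<partial>lborel)) = (\<integral>\<^sup>+a. \<integral>\<^sup>+b. J a b y \<partial>lborel \<partial>lborel)"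
      using y by (simp add: mult.assoc[symmetric] ennreal_mult[symmetric])
    finally show "(\<integral>\<^sup>+x. ennreal (1 / \<bar>x\<bar>) * (\<integral>\<^sup>+b. F x y b \<partial>lborel) \<partial>lborel) = (\<integral>\<^sup>+a. \<integral>\<^sup>+b. J a b y \<partial>lborel \<partial>lborel)" .
  qed
  also have "\<dots> = (\<integral>\<^sup>+a. \<integral>\<^sup>+y. \<integral>\<^sup>+b. J a b y \<partial>lborel \<partial>lborel \<partial>lborel)"
  proof (rule nn_integral_swap)
    show "(\<lambda>(y, a). \<integral>\<^sup>+b. J a b y \<partial>lborel) \<in> borel_measurable borel"
      unfolding borel_prod[symmetric] split_beta' J_def by measurable
  qed
  also have "\<dots> = (\<integral>\<^sup>+a. \<integral>\<^sup>+b. \<integral>\<^sup>+y. J a b y \<partial>lborel \<partial>lborel \<partial>lborel)"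
    by (intro nn_integral_cong nn_integral_swap) (simp add: borel_prod[symmetric])
  also have "\<dots> \<le> (\<integral>\<^sup>+a. \<integral>\<^sup>+b. ennreal (6 * R powr (1/3)) * k a b \<partial>lborel \<partial>lborel)"
  proof (rule nn_integral_mono_AE, use AE_lborel_singleton[of "0::real"] in eventually_elim, rule nn_integral_mono)
    fix a b :: real assume a: "a \<noteq> 0"
    \<comment> \<open>Chosen so that the constraint reads as a sublevel set at height
      \<open>t ^ 3\<close>; the length 6t then cancels |a|^(-1/3).\<close>
    define t where "t = (R * \<bar>a\<bar>) powr (1/3)"
    have t: "0 \<le> t" "t ^ 3 = R * \<bar>a\<bar>"
      using R a by (simp_all add: t_def powr_powr flip: powr_realpow)
    have "(\<integral>\<^sup>+y. J a b y \<partial>lborel) = (\<integral>\<^sup>+y. (k a b * ennreal (\<bar>a\<bar> powr (-1/3))) * indicator {y. \<bar>b - y\<^sup>2\<bar> * \<bar>y\<bar> \<le> t ^ 3} y \<partial>lborel)"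
      unfolding J_def t by (intro nn_integral_cong) (auto simp: indicator_def)
    also have "\<dots> = (k a b * ennreal (\<bar>a\<bar> powr (-1/3))) * emeasure lborel {y. \<bar>b - y\<^sup>2\<bar> * \<bar>y\<bar> \<le> t ^ 3}"
      by (rule nn_integral_cmult_indicator) simp
    also have "\<dots> \<le> (k a b * ennreal (\<bar>a\<bar> powr (-1/3))) * ennreal (6 * t)"
      by (intro mult_left_mono cubic_sublevel_measure t) simp
    also have "\<dots> = k a b * ennreal (\<bar>a\<bar> powr (-1/3) * (6 * t))"
      using t by (simp add: mult.assoc ennreal_mult)
    also have "\<bar>a\<bar> powr (-1/3) * (6 * t) = 6 * R powr (1/3)"
      using R a by (simp add: t_def powr_mult powr_add[symmetric])
    finally show "(\<integral>\<^sup>+y. J a b y \<partial>lborel) \<le> ennreal (6 * R powr (1/3)) * k a b"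
      by (simp add: mult.commute)
  qed
  also have "\<dots> = ennreal (6 * R powr (1/3)) * (\<integral>\<^sup>+a. \<integral>\<^sup>+b. k a b \<partial>lborel \<partial>lborel)"
    by (simp add: nn_integral_cmult)
  also have "(\<integral>\<^sup>+a. \<integral>\<^sup>+b. k a b \<partial>lborel \<partial>lborel) = (\<integral>\<^sup>+y. h y \<partial>lborel)"
    unfolding k_def by (rule nn_integral_vector2[symmetric]) measurable
  finally show ?thesis .
qed

subsection \<open>The forms \<open>(\<xi>\<^sub>1\<xi>\<^sub>2, \<xi>\<^sub>1\<^sup>2 \<plusminus> \<xi>\<^sub>3\<^sup>2)\<close>\<close>

lemma nn_integral_powr_interval:
  fixes \<gamma> R :: real
  assumes \<gamma>: "\<gamma> < 1"
  shows "(\<integral>\<^sup>+u. ennreal (\<bar>u\<bar> powr (- \<gamma>) * indicator {- R..R} u) \<partial>lborel) < \<infinity>"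
proof (cases "0 < R")
  case R: True
  define f where "f u = ennreal (u powr (- \<gamma>) * indicator {0..R} u)" for u
  have [measurable]: "f \<in> borel_measurable borel" unfolding f_def by measurable
  have "((\<lambda>u. u powr (- \<gamma>)) has_integral (R powr (- \<gamma> + 1) / (- \<gamma> + 1))) {0..R}"
    using \<gamma> R by (intro has_integral_powr_from_0) auto
  then have "((\<lambda>u. if u \<in> {0..R} then u powr (- \<gamma>) else 0) has_integral (R powr (- \<gamma> + 1) / (- \<gamma> + 1))) UNIV"
    by (simp only: has_integral_restrict_UNIV)
  also have "(\<lambda>u. if u \<in> {0..R} then u powr (- \<gamma>) else 0) = (\<lambda>u. u powr (- \<gamma>) * indicator {0..R} u)"
    by (auto simp: fun_eq_iff)
  finally have "(\<integral>\<^sup>+u. f u \<partial>lborel) = ennreal (R powr (- \<gamma> + 1) / (- \<gamma> + 1))"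
    unfolding f_def by (intro nn_integral_has_integral_lborel) auto
  then have fin: "(\<integral>\<^sup>+u. f u \<partial>lborel) < \<infinity>" by simp
  have "(\<integral>\<^sup>+u. ennreal (\<bar>u\<bar> powr (- \<gamma>) * indicator {- R..R} u) \<partial>lborel) \<le> (\<integral>\<^sup>+u. f u + f (0 + (-1) * u) \<partial>lborel)"
    by (intro nn_integral_mono) (auto simp: f_def indicator_def abs_if)
  also have "\<dots> = (\<integral>\<^sup>+u. f u \<partial>lborel) + (\<integral>\<^sup>+u. f (0 + (-1) * u) \<partial>lborel)"
    by (rule nn_integral_add) measurable
  also have "(\<integral>\<^sup>+u. f (0 + (-1) * u) \<partial>lborel) = (\<integral>\<^sup>+u. f u \<partial>lborel)"
    by (subst nn_integral_affine_image) auto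
  also have "(\<integral>\<^sup>+u. f u \<partial>lborel) + (\<integral>\<^sup>+u. f u \<partial>lborel) < \<infinity>" using fin by simp
  finally show ?thesis .
next
  case False
  have "(\<integral>\<^sup>+u. ennreal (\<bar>u\<bar> powr (- \<gamma>) * indicator {- R..R} u) \<partial>lborel) = (\<integral>\<^sup>+u. 0 \<partial>(lborel :: real measure))"
    using False by (intro nn_integral_cong) (auto simp: indicator_def)
  then show ?thesis by simp
qed

text \<open>Within distance 1 of c the integrand is a translate of a fixed integrable singularity;
  farther away it is at most 1 on a bounded interval. Neither contribution depends on c.\<close>

lemma nn_integral_powr_translate:
  fixes \<gamma> R :: real
  assumes \<gamma>: "0 < \<gamma>" "\<gamma> < 1"
  shows "\<exists>C. \<forall>c. (\<integral>\<^sup>+u. ennreal (\<bar>u - c\<bar> powr (- \<gamma>) * indicator {- R..R} u) \<partial>lborel) \<le> ennreal C"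
proof -
  define K where "K = (\<integral>\<^sup>+u. ennreal (\<bar>u\<bar> powr (- \<gamma>) * indicator {- 1..1} u) \<partial>lborel) + ennreal (2 * \<bar>R\<bar>)"
  have "K < \<infinity>" unfolding K_def using nn_integral_powr_interval[OF \<gamma>(2), of 1] by simp
  have "(\<integral>\<^sup>+u. ennreal (\<bar>u - c\<bar> powr (- \<gamma>) * indicator {- R..R} u) \<partial>lborel) \<le> K" for c
  proof -
    have "(\<integral>\<^sup>+u. ennreal (\<bar>u - c\<bar> powr (- \<gamma>) * indicator {- R..R} u) \<partial>lborel) \<le>
      (\<integral>\<^sup>+u. ennreal (\<bar>-c + 1 * u\<bar> powr (- \<gamma>) * indicator {- 1..1} (-c + 1 * u)) + indicator {- \<bar>R\<bar>..\<bar>R\<bar>} u \<partial>lborel)"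
    proof (rule nn_integral_mono)
      fix u
      have "\<bar>u - c\<bar> powr (- \<gamma>) \<le> 1" if "1 < \<bar>u - c\<bar>"
        using that \<gamma> powr_mono2'[of "- \<gamma>" 1 "\<bar>u - c\<bar>"] by simp
      then show "ennreal (\<bar>u - c\<bar> powr (- \<gamma>) * indicator {- R..R} u) \<le>
        ennreal (\<bar>-c + 1 * u\<bar> powr (- \<gamma>) * indicator {- 1..1} (-c + 1 * u)) + indicator {- \<bar>R\<bar>..\<bar>R\<bar>} u"
        by (cases "\<bar>u - c\<bar> \<le> 1") (auto simp: indicator_def abs_le_iff add_increasing2)
    qed
    also have "\<dots> = (\<integral>\<^sup>+u. ennreal (\<bar>-c + 1 * u\<bar> powr (- \<gamma>) * indicator {- 1..1} (-c + 1 * u)) \<partial>lborel) + (\<integral>\<^sup>+u. indicator {- \<bar>R\<bar>..\<bar>R\<bar>} u \<partial>lborel)"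
      by (rule nn_integral_add) measurable
    also have "(\<integral>\<^sup>+u. ennreal (\<bar>-c + 1 * u\<bar> powr (- \<gamma>) * indicator {- 1..1} (-c + 1 * u)) \<partial>lborel) =
      (\<integral>\<^sup>+u. ennreal (\<bar>u\<bar> powr (- \<gamma>) * indicator {- 1..1} u) \<partial>lborel)"
      by (subst nn_integral_affine_image[where t = "-c" and c = 1 and f = "\<lambda>u. ennreal (\<bar>u\<bar> powr (- \<gamma>) * indicator {- 1..1} u)"]) auto
    also have "(\<integral>\<^sup>+u. indicator {- \<bar>R\<bar>..\<bar>R\<bar>} u \<partial>lborel) = ennreal (2 * \<bar>R\<bar>)"
      by simp
    finally show ?thesis unfolding K_def .
  qed
  then show ?thesis using \<open>K < \<infinity>\<close> by (intro exI[of _ "enn2real K"]) simp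
qed

text \<open>By \<open>abs_diff_square_ge\<close> the integrand is at most |x|^(3(\<alpha>-1)/2) *
  ||x| - c|^((\<alpha>-1)/2) on the interval, a product of total degree -\<gamma> with \<gamma> =
  2(1 - \<alpha>). It is dominated by single singularities of order \<gamma> at 0, c and -c, which
  are integrable because \<alpha> > 1/2 means \<gamma> < 1.\<close>

lemma fiber_integral_bound:
  fixes \<alpha> R :: real
  assumes \<alpha>: "1/2 < \<alpha>" "\<alpha> < 1"
  shows "\<exists>C. \<forall>b. (\<integral>\<^sup>+x. ennreal (\<bar>x\<bar> powr (\<alpha> - 1) * \<bar>b - x\<^sup>2\<bar> powr ((\<alpha> - 1) / 2) * indicator {-R..R} x) \<partial>lborel) \<le> ennreal C"
proof -
  define \<gamma> where "\<gamma> = 2 * (1 - \<alpha>)"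
  have \<gamma>: "0 < \<gamma>" "\<gamma> < 1" using \<alpha> by (auto simp: \<gamma>_def)
  define P where "P c u = ennreal (\<bar>u - c\<bar> powr (- \<gamma>) * indicator {- R..R} u)" for c u
  have [measurable]: "P c \<in> borel_measurable borel" for c unfolding P_def by measurable
  obtain C0 where C0: "(\<integral>\<^sup>+u. P c u \<partial>lborel) \<le> ennreal C0" for c
    using nn_integral_powr_translate[OF \<gamma>, of R] unfolding P_def by auto
  \<comment> \<open>\<open>C0\<close> might be negative, in which case \<open>ennreal\<close>
    truncates it to 0; adding the three bounds as reals requires a nonnegative constant.\<close>
  define C where "C = max C0 0"
  have C: "(\<integral>\<^sup>+u. P c u \<partial>lborel) \<le> ennreal C" "0 \<le> C" for c
    using C0[of c] by (auto simp: C_def max_def ennreal_neg split: if_splits)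
  have "(\<integral>\<^sup>+x. ennreal (\<bar>x\<bar> powr (\<alpha> - 1) * \<bar>b - x\<^sup>2\<bar> powr ((\<alpha> - 1) / 2) * indicator {-R..R} x) \<partial>lborel) \<le> ennreal (3 * C)" for b
  proof -
    define c where "c = sqrt (max b 0)"
    have "(\<integral>\<^sup>+x. ennreal (\<bar>x\<bar> powr (\<alpha> - 1) * \<bar>b - x\<^sup>2\<bar> powr ((\<alpha> - 1) / 2) * indicator {-R..R} x) \<partial>lborel) \<le>
      (\<integral>\<^sup>+x. P 0 x + (P c x + P (- c) x) \<partial>lborel)"
    proof (rule nn_integral_mono_AE)
      show "AE x in lborel. ennreal (\<bar>x\<bar> powr (\<alpha> - 1) * \<bar>b - x\<^sup>2\<bar> powr ((\<alpha> - 1) / 2) * indicator {-R..R} x) \<le> P 0 x + (P c x + P (- c) x)"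
        using AE_lborel_singleton[of 0] AE_lborel_singleton[of c] AE_lborel_singleton[of "- c"]
      proof eventually_elim
        case (elim x)
        let ?y = "\<bar>\<bar>x\<bar> - c\<bar>"
        have xy: "0 < \<bar>x\<bar>" "0 < ?y" using elim by auto
        have "\<bar>b - x\<^sup>2\<bar> powr ((\<alpha> - 1) / 2) \<le> (\<bar>x\<bar> * ?y) powr ((\<alpha> - 1) / 2)"
          using \<alpha> xy unfolding c_def by (intro powr_mono2' abs_diff_square_ge) (auto simp: c_def)
        also have "\<dots> = \<bar>x\<bar> powr ((\<alpha> - 1) / 2) * ?y powr ((\<alpha> - 1) / 2)"
          by (rule powr_mult)
        finally have "\<bar>x\<bar> powr (\<alpha> - 1) * \<bar>b - x\<^sup>2\<bar> powr ((\<alpha> - 1) / 2) \<le>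
          \<bar>x\<bar> powr (\<alpha> - 1) * (\<bar>x\<bar> powr ((\<alpha> - 1) / 2) * ?y powr ((\<alpha> - 1) / 2))"
          by (intro mult_left_mono) auto
        also have "\<dots> \<le> \<bar>x\<bar> powr (- \<gamma>) + ?y powr (- \<gamma>)"
        \<comment> \<open>All exponents are negative, so replacing the larger of the two distances
          by the smaller one increases the product and collects the whole exponent -\<gamma> on one
          of them.\<close>
        proof (cases "\<bar>x\<bar> \<le> ?y")
          case True
          then have "?y powr ((\<alpha> - 1) / 2) \<le> \<bar>x\<bar> powr ((\<alpha> - 1) / 2)"
            using xy \<alpha> by (intro powr_mono2') auto
          then have "\<bar>x\<bar> powr (\<alpha> - 1) * (\<bar>x\<bar> powr ((\<alpha> - 1) / 2) * ?y powr ((\<alpha> - 1) / 2)) \<le>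
            \<bar>x\<bar> powr (\<alpha> - 1) * (\<bar>x\<bar> powr ((\<alpha> - 1) / 2) * \<bar>x\<bar> powr ((\<alpha> - 1) / 2))"
            by (intro mult_left_mono) auto
          also have "\<dots> = \<bar>x\<bar> powr (- \<gamma>)"
            unfolding powr_add[symmetric] \<gamma>_def by (rule arg_cong[where f = "(powr) \<bar>x\<bar>"]) (simp add: field_simps)
          finally show ?thesis using powr_ge_zero[of ?y "- \<gamma>"] by linarith
        next
          case False
          then have "\<bar>x\<bar> powr ((\<alpha> - 1) / 2) \<le> ?y powr ((\<alpha> - 1) / 2)" "\<bar>x\<bar> powr (\<alpha> - 1) \<le> ?y powr (\<alpha> - 1)"
            using xy \<alpha> by (auto intro!: powr_mono2')
          then have "\<bar>x\<bar> powr (\<alpha> - 1) * (\<bar>x\<bar> powr ((\<alpha> - 1) / 2) * ?y powr ((\<alpha> - 1) / 2)) \<le>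
            ?y powr (\<alpha> - 1) * (?y powr ((\<alpha> - 1) / 2) * ?y powr ((\<alpha> - 1) / 2))"
            by (intro mult_mono) auto
          also have "\<dots> = ?y powr (- \<gamma>)"
            unfolding powr_add[symmetric] \<gamma>_def by (rule arg_cong[where f = "(powr) ?y"]) (simp add: field_simps)
          finally show ?thesis using powr_ge_zero[of "\<bar>x\<bar>" "- \<gamma>"] by linarith
        qed
        also have "?y powr (- \<gamma>) \<le> \<bar>x - c\<bar> powr (- \<gamma>) + \<bar>x - (- c)\<bar> powr (- \<gamma>)"
        proof (cases "0 \<le> x")
          case True
          then show ?thesis by simp
        next
          case False
          then have "?y = \<bar>x - (- c)\<bar>" by (simp add: abs_if)
          then show ?thesis by simp
        qed
        finally have *: "\<bar>x\<bar> powr (\<alpha> - 1) * \<bar>b - x\<^sup>2\<bar> powr ((\<alpha> - 1) / 2) \<le>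
          \<bar>x - 0\<bar> powr (- \<gamma>) + (\<bar>x - c\<bar> powr (- \<gamma>) + \<bar>x - (- c)\<bar> powr (- \<gamma>))" by simp
        have "P 0 x + (P c x + P (- c) x) = ennreal ((\<bar>x - 0\<bar> powr (- \<gamma>) + (\<bar>x - c\<bar> powr (- \<gamma>) + \<bar>x - (- c)\<bar> powr (- \<gamma>))) * indicator {- R..R} x)"
          unfolding P_def by (simp add: ennreal_plus[symmetric] distrib_right del: ennreal_plus)
        then show ?case using mult_right_mono[OF *, of "indicator {- R..R} x"] by (simp add: ennreal_leI)
      qed
    qed
    also have "\<dots> = (\<integral>\<^sup>+x. P 0 x \<partial>lborel) + ((\<integral>\<^sup>+x. P c x \<partial>lborel) + (\<integral>\<^sup>+x. P (- c) x \<partial>lborel))"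
      by (simp add: nn_integral_add)
    also have "\<dots> \<le> ennreal C + (ennreal C + ennreal C)"
      by (intro add_mono C)
    also have "\<dots> = ennreal (3 * C)"
      using C(2) by (simp add: ennreal_plus[symmetric] del: ennreal_plus)
    finally show ?thesis .
  qed
  then show ?thesis by blast
qed

text \<open>On each half-line t = z^2 gives dz = dt / (2 sqrt t), which turns |z|^\<alpha> into
  t^((\<alpha>-1)/2) / 2; the two half-lines cancel the 1/2. The inequality comes from enlarging
  [0, R^2] to the whole line.\<close>

lemma nn_integral_square_substitution:
  fixes k :: "real \<Rightarrow> ennreal"
  assumes R: "0 < R" and [measurable]: "k \<in> borel_measurable borel"
  shows "(\<integral>\<^sup>+z. k (z\<^sup>2) * ennreal (\<bar>z\<bar> powr \<alpha> * indicator {- R..R} z) \<partial>lborel) \<le>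
    (\<integral>\<^sup>+t. k t * ennreal (\<bar>t\<bar> powr ((\<alpha> - 1) / 2)) \<partial>lborel)"
proof -
  define f where "f t = k t * ennreal (\<bar>t\<bar> powr ((\<alpha> - 1) / 2) / 2)" for t
  have [measurable]: "f \<in> borel_measurable borel" unfolding f_def by measurable
  define g where "g z = k (z\<^sup>2) * ennreal (z powr \<alpha> * indicator {0..R} z)" for z
  have [measurable]: "g \<in> borel_measurable borel" unfolding g_def by measurable
  have "(\<integral>\<^sup>+z. g z \<partial>lborel) = (\<integral>\<^sup>+z. f (z\<^sup>2) * ennreal (2 * z) * indicator {0..R} z \<partial>lborel)"
  proof (rule nn_integral_cong)
    fix z
    show "g z = f (z\<^sup>2) * ennreal (2 * z) * indicator {0..R} z"
    proof (cases "0 < z \<and> z \<le> R")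
      case True
      have "(z\<^sup>2) powr ((\<alpha> - 1) / 2) / 2 * (2 * z) = z powr (\<alpha> - 1) * z powr 1"
        using True by (simp add: powr_powr diff_divide_distrib flip: powr_numeral)
      also have "\<dots> = z powr \<alpha>" unfolding powr_add[symmetric] by simp
      finally have "ennreal (z powr \<alpha>) = ennreal ((z\<^sup>2) powr ((\<alpha> - 1) / 2) / 2) * ennreal (2 * z)"
        using True by (subst ennreal_mult[symmetric]) auto
      then show ?thesis using True by (simp add: g_def f_def mult.assoc)
    next
      case False
      then show ?thesis by (cases "z = 0") (auto simp: g_def indicator_def)
    qed
  qed
  also have "\<dots> = (\<integral>\<^sup>+t. f t * indicator {0\<^sup>2..R\<^sup>2} t \<partial>lborel)"
    by (rule nn_integral_substitution_aux[symmetric])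
       (use R in \<open>auto intro!: derivative_eq_intros continuous_intros\<close>)
  also have "\<dots> \<le> (\<integral>\<^sup>+t. f t \<partial>lborel)"
    by (intro nn_integral_mono) (auto simp: indicator_def)
  finally have g: "(\<integral>\<^sup>+z. g z \<partial>lborel) \<le> (\<integral>\<^sup>+t. f t \<partial>lborel)" .
  have "(\<integral>\<^sup>+z. k (z\<^sup>2) * ennreal (\<bar>z\<bar> powr \<alpha> * indicator {- R..R} z) \<partial>lborel) \<le> (\<integral>\<^sup>+z. g z + g (0 + (-1) * z) \<partial>lborel)"
    by (intro nn_integral_mono) (auto simp: g_def indicator_def abs_if)
  also have "\<dots> = (\<integral>\<^sup>+z. g z \<partial>lborel) + (\<integral>\<^sup>+z. g (0 + (-1) * z) \<partial>lborel)"
    by (rule nn_integral_add) measurable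
  also have "(\<integral>\<^sup>+z. g (0 + (-1) * z) \<partial>lborel) = (\<integral>\<^sup>+z. g z \<partial>lborel)"
    by (subst nn_integral_affine_image) auto
  also have "(\<integral>\<^sup>+z. g z \<partial>lborel) + (\<integral>\<^sup>+z. g z \<partial>lborel) \<le> (\<integral>\<^sup>+t. f t \<partial>lborel) + (\<integral>\<^sup>+t. f t \<partial>lborel)"
    by (intro add_mono g)
  also have "\<dots> = (\<integral>\<^sup>+t. f t + f t \<partial>lborel)"
    by (rule nn_integral_add[symmetric]) measurable
  also have "\<dots> = (\<integral>\<^sup>+t. k t * ennreal (\<bar>t\<bar> powr ((\<alpha> - 1) / 2)) \<partial>lborel)"
    unfolding f_def distrib_left[symmetric] by (subst ennreal_plus[symmetric]) auto
  finally show ?thesis .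
qed

definition form2 :: "real \<Rightarrow> real^3 \<Rightarrow> real^2" where
  "form2 s v = vector [v $ 1 * v $ 2, (v $ 1)\<^sup>2 + s * (v $ 3)\<^sup>2]"

lemma form2_measurable [measurable]: "form2 s \<in> borel_measurable borel"
  unfolding form2_def[abs_def] by measurable

text \<open>The weight does not involve v_2, so integrating over v_2 turns h into its marginal in
  the second variable, at the cost of 1 / |v_1|. What remains is one-dimensional: replacing v_3 by b
  = v_1^2 + s v_3^2 produces |b - v_1^2|^((\<alpha>-1)/2), and the integral over v_1 at fixed b is
  the one in \<open>fiber_integral_bound\<close>.\<close>

lemma form2_density:
  fixes \<alpha> R :: real
  assumes s: "\<bar>s\<bar> = 1" and R: "0 < R" and \<alpha>: "1/2 < \<alpha>" "\<alpha> < 1"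
  shows "\<exists>C. \<forall>h \<in> borel_measurable borel.
    (\<integral>\<^sup>+v. h (form2 s v) * ennreal (\<bar>v $ 1 * v $ 3\<bar> powr \<alpha> * (indicator {-R..R} (v $ 1) * indicator {-R..R} (v $ 3))) \<partial>lborel)
    \<le> ennreal C * (\<integral>\<^sup>+y. h y \<partial>lborel)"
proof -
  obtain C where C: "(\<integral>\<^sup>+x. ennreal (\<bar>x\<bar> powr (\<alpha> - 1) * \<bar>b - x\<^sup>2\<bar> powr ((\<alpha> - 1) / 2) * indicator {-R..R} x) \<partial>lborel) \<le> ennreal C" for b
    using fiber_integral_bound[OF \<alpha>, of R] by auto
  have "(\<integral>\<^sup>+v. h (form2 s v) * ennreal (\<bar>v $ 1 * v $ 3\<bar> powr \<alpha> * (indicator {-R..R} (v $ 1) * indicator {-R..R} (v $ 3))) \<partial>lborel)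
    \<le> ennreal C * (\<integral>\<^sup>+y. h y \<partial>lborel)" if [measurable]: "h \<in> borel_measurable borel" for h
  proof -
    define k where "k a b = h (vector [a, b])" for a b
    have [measurable]: "(\<lambda>(a, b). k a b) \<in> borel_measurable (borel \<Otimes>\<^sub>M borel)"
      unfolding k_def by measurable
    define g where "g b = (\<integral>\<^sup>+a. k a b \<partial>lborel)" for b
    have g[measurable]: "g \<in> borel_measurable borel" unfolding g_def by measurable
    have s': "s * s = 1" "s \<noteq> 0" using s by (auto simp: abs_if split: if_splits)
    define V where "V x = \<bar>x\<bar> powr \<alpha> * indicator {-R..R} x" for x :: real
    have V[measurable]: "V \<in> borel_measurable borel" and V0: "0 \<le> V x" for x unfolding V_def by auto
    have Veq: "\<bar>x * z\<bar> powr \<alpha> * (indicator {-R..R} x * indicator {-R..R} z) = V x * V z" for x z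
      by (simp add: V_def abs_mult powr_mult)
    have "(\<integral>\<^sup>+v. h (form2 s v) * ennreal (\<bar>v $ 1 * v $ 3\<bar> powr \<alpha> * (indicator {-R..R} (v $ 1) * indicator {-R..R} (v $ 3))) \<partial>lborel) =
      (\<integral>\<^sup>+x. \<integral>\<^sup>+y. \<integral>\<^sup>+z. k (x * y) (x\<^sup>2 + s * z\<^sup>2) * ennreal (V x * V z) \<partial>lborel \<partial>lborel \<partial>lborel)"
      by (subst nn_integral_vector3) (auto simp: form2_def k_def Veq)
    also have "\<dots> = (\<integral>\<^sup>+x. \<integral>\<^sup>+z. \<integral>\<^sup>+y. k (x * y) (x\<^sup>2 + s * z\<^sup>2) * ennreal (V x * V z) \<partial>lborel \<partial>lborel \<partial>lborel)"
      by (intro nn_integral_cong nn_integral_swap) (simp add: borel_prod[symmetric])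
    also have "\<dots> \<le> (\<integral>\<^sup>+x. \<integral>\<^sup>+b. g b * ennreal (\<bar>x\<bar> powr (\<alpha> - 1) * \<bar>b - x\<^sup>2\<bar> powr ((\<alpha> - 1) / 2) * indicator {-R..R} x) \<partial>lborel \<partial>lborel)"
    proof (rule nn_integral_mono_AE, use AE_lborel_singleton[of "0::real"] in eventually_elim)
      fix x :: real assume x: "x \<noteq> 0"
      define c where "c = ennreal (1 / \<bar>x\<bar> * V x)"
      have "(\<integral>\<^sup>+y. k (x * y) (x\<^sup>2 + s * z\<^sup>2) * ennreal (V x * V z) \<partial>lborel) = c * (g (x\<^sup>2 + s * z\<^sup>2) * ennreal (V z))" for z
      proof -
        have "(\<integral>\<^sup>+y. k (x * y) (x\<^sup>2 + s * z\<^sup>2) * ennreal (V x * V z) \<partial>lborel) = (\<integral>\<^sup>+y. k (0 + x * y) (x\<^sup>2 + s * z\<^sup>2) \<partial>lborel) * ennreal (V x * V z)"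
          by (subst nn_integral_multc) auto
        also have "(\<integral>\<^sup>+y. k (0 + x * y) (x\<^sup>2 + s * z\<^sup>2) \<partial>lborel) = ennreal (1 / \<bar>x\<bar>) * g (x\<^sup>2 + s * z\<^sup>2)"
          unfolding g_def by (rule nn_integral_affine_image) (use x in auto)
        also have "ennreal (1 / \<bar>x\<bar>) * g (x\<^sup>2 + s * z\<^sup>2) * ennreal (V x * V z) = (ennreal (1 / \<bar>x\<bar>) * ennreal (V x)) * (g (x\<^sup>2 + s * z\<^sup>2) * ennreal (V z))"
          unfolding ennreal_mult[OF V0 V0] by (simp only: mult_ac)
        also have "ennreal (1 / \<bar>x\<bar>) * ennreal (V x) = c"
          unfolding c_def by (rule ennreal_mult[symmetric]) (auto simp: V0)
        finally show ?thesis .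
      qed
      then have "(\<integral>\<^sup>+z. \<integral>\<^sup>+y. k (x * y) (x\<^sup>2 + s * z\<^sup>2) * ennreal (V x * V z) \<partial>lborel \<partial>lborel) =
         c * (\<integral>\<^sup>+z. g (x\<^sup>2 + s * z\<^sup>2) * ennreal (V z) \<partial>lborel)"
        by (simp add: nn_integral_cmult)
      also have "(\<integral>\<^sup>+z. g (x\<^sup>2 + s * z\<^sup>2) * ennreal (V z) \<partial>lborel) \<le> (\<integral>\<^sup>+t. g (x\<^sup>2 + s * t) * ennreal (\<bar>t\<bar> powr ((\<alpha> - 1) / 2)) \<partial>lborel)"
        unfolding V_def by (rule nn_integral_square_substitution[OF R]) measurable
      also have "\<dots> = (\<integral>\<^sup>+t. g (x\<^sup>2 + s * t) * ennreal (\<bar>(x\<^sup>2 + s * t) - x\<^sup>2\<bar> powr ((\<alpha> - 1) / 2)) \<partial>lborel)"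
        using s by (simp add: abs_mult)
      also have "\<dots> = (\<integral>\<^sup>+b. g b * ennreal (\<bar>b - x\<^sup>2\<bar> powr ((\<alpha> - 1) / 2)) \<partial>lborel)"
        using s' s by (subst nn_integral_affine_image[where f = "\<lambda>b. g b * ennreal (\<bar>b - x\<^sup>2\<bar> powr ((\<alpha> - 1) / 2))"]) auto
      finally have "(\<integral>\<^sup>+z. \<integral>\<^sup>+y. k (x * y) (x\<^sup>2 + s * z\<^sup>2) * ennreal (V x * V z) \<partial>lborel \<partial>lborel) \<le>
        c * (\<integral>\<^sup>+b. g b * ennreal (\<bar>b - x\<^sup>2\<bar> powr ((\<alpha> - 1) / 2)) \<partial>lborel)" by (simp add: mult_left_mono)
      also have "\<dots> = (\<integral>\<^sup>+b. c * (g b * ennreal (\<bar>b - x\<^sup>2\<bar> powr ((\<alpha> - 1) / 2))) \<partial>lborel)"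
        by (rule nn_integral_cmult[symmetric]) measurable
      also have "\<dots> = (\<integral>\<^sup>+b. g b * ennreal (\<bar>x\<bar> powr (\<alpha> - 1) * \<bar>b - x\<^sup>2\<bar> powr ((\<alpha> - 1) / 2) * indicator {-R..R} x) \<partial>lborel)"
      proof (rule nn_integral_cong)
        fix b
        have "1 / \<bar>x\<bar> * V x = \<bar>x\<bar> powr (\<alpha> - 1) * indicator {-R..R} x"
          using x by (simp add: V_def powr_diff)
        then show "c * (g b * ennreal (\<bar>b - x\<^sup>2\<bar> powr ((\<alpha> - 1) / 2))) = g b * ennreal (\<bar>x\<bar> powr (\<alpha> - 1) * \<bar>b - x\<^sup>2\<bar> powr ((\<alpha> - 1) / 2) * indicator {-R..R} x)"
          unfolding c_def by (simp add: ennreal_mult mult_ac)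
      qed
      finally show "(\<integral>\<^sup>+z. \<integral>\<^sup>+y. k (x * y) (x\<^sup>2 + s * z\<^sup>2) * ennreal (V x * V z) \<partial>lborel \<partial>lborel) \<le>
        (\<integral>\<^sup>+b. g b * ennreal (\<bar>x\<bar> powr (\<alpha> - 1) * \<bar>b - x\<^sup>2\<bar> powr ((\<alpha> - 1) / 2) * indicator {-R..R} x) \<partial>lborel)" .
    qed
    also have "\<dots> = (\<integral>\<^sup>+b. \<integral>\<^sup>+x. g b * ennreal (\<bar>x\<bar> powr (\<alpha> - 1) * \<bar>b - x\<^sup>2\<bar> powr ((\<alpha> - 1) / 2) * indicator {-R..R} x) \<partial>lborel \<partial>lborel)"
      by (rule nn_integral_swap) (simp add: borel_prod[symmetric])
    also have "\<dots> = (\<integral>\<^sup>+b. g b * (\<integral>\<^sup>+x. ennreal (\<bar>x\<bar> powr (\<alpha> - 1) * \<bar>b - x\<^sup>2\<bar> powr ((\<alpha> - 1) / 2) * indicator {-R..R} x) \<partial>lborel) \<partial>lborel)"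
      by (intro nn_integral_cong nn_integral_cmult) measurable
    also have "\<dots> \<le> (\<integral>\<^sup>+b. g b * ennreal C \<partial>lborel)"
      by (intro nn_integral_mono mult_left_mono C) simp
    also have "\<dots> = ennreal C * (\<integral>\<^sup>+b. g b \<partial>lborel)"
      by (subst nn_integral_multc) (auto simp: mult.commute)
    also have "(\<integral>\<^sup>+b. g b \<partial>lborel) = (\<integral>\<^sup>+a. \<integral>\<^sup>+b. k a b \<partial>lborel \<partial>lborel)"
      unfolding g_def by (rule nn_integral_swap) (simp add: borel_prod[symmetric] split_beta')
    also have "\<dots> = (\<integral>\<^sup>+y. h y \<partial>lborel)"
      unfolding k_def by (rule nn_integral_vector2[symmetric]) measurable
    finally show ?thesis .
  qed
  then show ?thesis by blast
qed

subsection \<open>The bilinear estimate\<close>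

text \<open>The estimate \<open>abc \<le> max\<close> for a weighted geometric mean \<open>abc\<close> replaces the three-term
  Hoelder inequality; this is enough for normalized functions.\<close>

lemma young_pointwise:
  fixes a b w s r :: real
  assumes s: "1 < s" "s \<le> 2" and r: "r = s / (2 * (s - 1))" and nn: "0 \<le> a" "0 \<le> b" "0 \<le> w"
  shows "a * b * w \<le> a powr s * b powr s + a powr s * w powr r + b powr s * w powr r"
proof (cases "a = 0 \<or> b = 0 \<or> w = 0")
  case True
  then show ?thesis using nn by (auto intro!: add_nonneg_nonneg)
next
  case False
  then have pos: "0 < a" "0 < b" "0 < w" using nn by auto
  define x where "x = a powr s * b powr s"
  define y where "y = a powr s * w powr r"
  define z where "z = b powr s * w powr r"
  have xyz: "0 < x" "0 < y" "0 < z" using pos by (auto simp: x_def y_def z_def)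
  \<comment> \<open>The exponents solve e + 2f = 1, s(e + f) = 1 and 2rf = 1, which make the
    weighted geometric mean of x, y, z equal to a * b * w. The condition s \<le> 2 is what keeps e
    nonnegative.\<close>
  define e where "e = 2 / s - 1"
  define f where "f = 1 - 1 / s"
  have ef: "0 \<le> e" "0 \<le> f" using s by (auto simp: e_def f_def field_simps)
  have "f = (s - 1) / s" using s by (simp add: f_def diff_divide_distrib)
  then have rf: "r * f = 1/2" using s by (simp add: r)
  have "s * e = 2 - s" "s * f = s - 1" using s by (simp_all add: e_def f_def right_diff_distrib)
  then have 1: "s * e + s * f = 1" "r * f + r * f = 1"
    using rf by linarith+
  have 2: "e + f + f = 1" by (simp add: e_def f_def)
  have "x powr e * y powr f * z powr f = a powr (s * e + s * f) * b powr (s * e + s * f) * w powr (r * f + r * f)"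
    unfolding powr_add x_def y_def z_def using pos by (simp add: powr_mult powr_powr mult_ac)
  also have "\<dots> = a * b * w" using pos by (simp add: 1)
  finally have "a * b * w = x powr e * y powr f * z powr f" ..
  also have "\<dots> \<le> (x + y + z) powr e * (x + y + z) powr f * (x + y + z) powr f"
    using xyz ef by (intro mult_mono powr_mono2) auto
  also have "\<dots> = (x + y + z) powr (e + f + f)" by (simp only: powr_add)
  also have "\<dots> = x + y + z" using xyz by (simp add: 2)
  finally show ?thesis by (simp add: x_def y_def z_def)
qed

text \<open>Each of the three terms of the pointwise bound involves only two of the functions, so
  Tonelli and the invariance of Lebesgue measure under translation and reflection factor its
  integral.\<close>

lemma young_integral:
  fixes F w :: "'a::euclidean_space \<Rightarrow> real"
  assumes s: "1 < s" "s \<le> 2" and r: "r = s / (2 * (s - 1))"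
    and [measurable]: "F \<in> borel_measurable borel" "w \<in> borel_measurable borel"
    and nn: "\<And>x. 0 \<le> F x" "\<And>x. 0 \<le> w x"
  defines "A \<equiv> (\<integral>\<^sup>+x. ennreal (F x powr s) \<partial>lborel)" and "B \<equiv> (\<integral>\<^sup>+x. ennreal (w x powr r) \<partial>lborel)"
  shows "(\<integral>\<^sup>+x. \<integral>\<^sup>+y. ennreal (F x * F y * w (x - y)) \<partial>lborel \<partial>lborel) \<le> A * A + A * B + A * B"
proof -
  define G where "G x = ennreal (F x powr s)" for x
  define W where "W x = ennreal (w x powr r)" for x
  have [measurable]: "G \<in> borel_measurable borel" "W \<in> borel_measurable borel"
    unfolding G_def W_def by measurable
  have AG: "A = (\<integral>\<^sup>+x. G x \<partial>lborel)" and BW: "B = (\<integral>\<^sup>+x. W x \<partial>lborel)"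
    unfolding A_def B_def G_def W_def by (rule refl)+
  have "(\<integral>\<^sup>+x. \<integral>\<^sup>+y. ennreal (F x * F y * w (x - y)) \<partial>lborel \<partial>lborel) \<le>
    (\<integral>\<^sup>+x. \<integral>\<^sup>+y. G x * G y + G x * W (x - y) + G y * W (x - y) \<partial>lborel \<partial>lborel)"
  proof (intro nn_integral_mono)
    fix x y
    have "ennreal (F x * F y * w (x - y)) \<le> ennreal (F x powr s * F y powr s + F x powr s * w (x - y) powr r + F y powr s * w (x - y) powr r)"
      by (intro ennreal_leI young_pointwise s r nn)
    also have "\<dots> = G x * G y + G x * W (x - y) + G y * W (x - y)"
      unfolding G_def W_def by (simp add: ennreal_mult)
    finally show "ennreal (F x * F y * w (x - y)) \<le> G x * G y + G x * W (x - y) + G y * W (x - y)" .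
  qed
  also have "\<dots> = (\<integral>\<^sup>+x. \<integral>\<^sup>+y. G x * G y \<partial>lborel \<partial>lborel) + (\<integral>\<^sup>+x. \<integral>\<^sup>+y. G x * W (x - y) \<partial>lborel \<partial>lborel)
      + (\<integral>\<^sup>+x. \<integral>\<^sup>+y. G y * W (x - y) \<partial>lborel \<partial>lborel)"
    by (simp add: nn_integral_add)
  also have "(\<integral>\<^sup>+x. \<integral>\<^sup>+y. G x * G y \<partial>lborel \<partial>lborel) = A * A"
    by (simp add: nn_integral_cmult nn_integral_multc AG)
  also have "(\<integral>\<^sup>+x. \<integral>\<^sup>+y. G x * W (x - y) \<partial>lborel \<partial>lborel) = (\<integral>\<^sup>+x. G x * B \<partial>lborel)"
    by (intro nn_integral_cong) (simp add: nn_integral_cmult nn_integral_lborel_reflect BW)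
  also have "\<dots> = A * B" by (simp add: nn_integral_multc AG)
  also have "(\<integral>\<^sup>+x. \<integral>\<^sup>+y. G y * W (x - y) \<partial>lborel \<partial>lborel) = (\<integral>\<^sup>+y. \<integral>\<^sup>+x. G y * W (x - y) \<partial>lborel \<partial>lborel)"
    by (rule nn_integral_swap) (simp add: borel_prod[symmetric])
  also have "\<dots> = (\<integral>\<^sup>+y. G y * B \<partial>lborel)"
  proof (intro nn_integral_cong)
    fix y
    have "(\<integral>\<^sup>+x. W (x - y) \<partial>lborel) = B"
      using nn_integral_lborel_translate[of W "- y"] by (simp add: BW)
    then show "(\<integral>\<^sup>+x. G y * W (x - y) \<partial>lborel) = G y * B"
      by (simp add: nn_integral_cmult)
  qed
  also have "\<dots> = A * B" by (simp add: nn_integral_multc AG)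
  finally show ?thesis .
qed

text \<open>The parallelogram law turns the map \<open>(\<xi>, \<eta>) \<mapsto> \<Sigma>(\<xi>) + \<Sigma>(\<eta>)\<close> into
  \<open>(s, u) \<mapsto> (s, (q(s) + q(u)) / 2)\<close> with \<open>s = \<xi> + \<eta>\<close> and \<open>u = \<xi> - \<eta>\<close>.\<close>

lemma sumset_density:
  fixes q :: "real^3 \<Rightarrow> real^2" and V :: "real^3 \<Rightarrow> real"
  assumes [measurable]: "q \<in> borel_measurable borel" "V \<in> borel_measurable borel"
    and para: "\<And>x y. q x + q y = (1/2) *\<^sub>R (q (x + y) + q (x - y))"
    and dens: "\<And>h. h \<in> borel_measurable borel \<Longrightarrow>
      (\<integral>\<^sup>+u. h (q u) * ennreal (V u) \<partial>lborel) \<le> C * (\<integral>\<^sup>+y. h y \<partial>lborel)"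
    and [measurable]: "h \<in> borel_measurable borel"
  shows "(\<integral>\<^sup>+z. h (join5 (fst z) (q (fst z)) + join5 (snd z) (q (snd z))) * ennreal (V (fst z - snd z)) \<partial>lborel)
    \<le> C * (\<integral>\<^sup>+y. h y \<partial>lborel)"
proof -
  define H where "H s u = h (join5 s ((1/2) *\<^sub>R q s + (1/2) *\<^sub>R q u)) * ennreal (V u)" for s u
  have H[measurable]: "(\<lambda>(s, u). H s u) \<in> borel_measurable (borel \<Otimes>\<^sub>M borel)"
    unfolding H_def by measurable
  have eq: "h (join5 x (q x) + join5 y (q y)) * ennreal (V (x - y)) = H (x + y) (x - y)" for x y
  proof -
    have "join5 x (q x) + join5 y (q y) = join5 (x + y) (q x + q y)"
      by (simp add: vec_eq_iff forall_5)
    then show ?thesis by (simp add: H_def para[of x y] scaleR_add_right)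
  qed
  have "(\<integral>\<^sup>+z. h (join5 (fst z) (q (fst z)) + join5 (snd z) (q (snd z))) * ennreal (V (fst z - snd z)) \<partial>lborel)
    = (\<integral>\<^sup>+z. H (fst z + snd z) (fst z - snd z) \<partial>lborel)"
    by (simp add: eq)
  also have "\<dots> = (\<integral>\<^sup>+x. \<integral>\<^sup>+y. H (x + y) (x - y) \<partial>lborel \<partial>lborel)"
    by (subst nn_integral_lborel_pair) (auto simp: borel_prod[symmetric])
  also have "\<dots> = (\<integral>\<^sup>+y. \<integral>\<^sup>+x. H (x + y) (x - y) \<partial>lborel \<partial>lborel)"
    by (rule nn_integral_swap) (simp add: borel_prod[symmetric])
  also have "\<dots> = (\<integral>\<^sup>+y. \<integral>\<^sup>+u. H (u + 2 *\<^sub>R y) u \<partial>lborel \<partial>lborel)"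
  proof (rule nn_integral_cong)
    fix y
    have "(\<lambda>x. H (x + y) (x - y)) \<in> borel_measurable borel" by measurable
    from nn_integral_lborel_translate[OF this, of y]
    show "(\<integral>\<^sup>+x. H (x + y) (x - y) \<partial>lborel) = (\<integral>\<^sup>+u. H (u + 2 *\<^sub>R y) u \<partial>lborel)"
      by (simp add: scaleR_2 add_ac)
  qed
  also have "\<dots> = (\<integral>\<^sup>+u. \<integral>\<^sup>+y. H (u + 2 *\<^sub>R y) u \<partial>lborel \<partial>lborel)"
    by (rule nn_integral_swap) (simp add: borel_prod[symmetric])
  \<comment> \<open>The factor 1/8 is the Jacobian of s = u + 2y in R^3. The factor 4 below comes
    from halving the two quadratic coordinates; the product 1/2 is finally bounded by 1.\<close>
  also have "\<dots> = (\<integral>\<^sup>+u. ennreal (1/8) * (\<integral>\<^sup>+s. H s u \<partial>lborel) \<partial>lborel)"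
    by (intro nn_integral_cong, subst nn_integral_lborel_affine_image[where f = "\<lambda>s. H s _"]) (auto simp: power3_eq_cube)
  also have "\<dots> = ennreal (1/8) * (\<integral>\<^sup>+u. \<integral>\<^sup>+s. H s u \<partial>lborel \<partial>lborel)"
    unfolding H_def by (rule nn_integral_cmult) measurable
  also have "(\<integral>\<^sup>+u. \<integral>\<^sup>+s. H s u \<partial>lborel \<partial>lborel) = (\<integral>\<^sup>+s. \<integral>\<^sup>+u. H s u \<partial>lborel \<partial>lborel)"
    by (rule nn_integral_swap) (simp add: borel_prod[symmetric] split_beta')
  also have "\<dots> \<le> (\<integral>\<^sup>+s. ennreal 4 * (C * (\<integral>\<^sup>+t. h (join5 s t) \<partial>lborel)) \<partial>lborel)"
  proof (rule nn_integral_mono)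
    fix s
    have "(\<integral>\<^sup>+u. H s u \<partial>lborel) \<le> C * (\<integral>\<^sup>+t. h (join5 s ((1/2) *\<^sub>R q s + (1/2) *\<^sub>R t)) \<partial>lborel)"
      unfolding H_def by (rule dens) measurable
    also have "(\<integral>\<^sup>+t. h (join5 s ((1/2) *\<^sub>R q s + (1/2) *\<^sub>R t)) \<partial>lborel) = ennreal 4 * (\<integral>\<^sup>+t. h (join5 s t) \<partial>lborel)"
      by (subst nn_integral_lborel_affine_image[where f = "\<lambda>t. h (join5 s t)"]) (auto simp: power2_eq_square)
    finally show "(\<integral>\<^sup>+u. H s u \<partial>lborel) \<le> ennreal 4 * (C * (\<integral>\<^sup>+t. h (join5 s t) \<partial>lborel))"
      by (simp only: mult.left_commute)
  qed
  also have "\<dots> = ennreal 4 * (C * (\<integral>\<^sup>+s. \<integral>\<^sup>+t. h (join5 s t) \<partial>lborel \<partial>lborel))"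
    by (subst nn_integral_cmult, measurable, subst nn_integral_cmult) auto
  also have "(\<integral>\<^sup>+s. \<integral>\<^sup>+t. h (join5 s t) \<partial>lborel \<partial>lborel) = (\<integral>\<^sup>+y. h y \<partial>lborel)"
    by (rule nn_integral_join5[symmetric]) measurable
  finally have "(\<integral>\<^sup>+z. h (join5 (fst z) (q (fst z)) + join5 (snd z) (q (snd z))) * ennreal (V (fst z - snd z)) \<partial>lborel)
    \<le> ennreal (1/8) * (ennreal 4 * (C * (\<integral>\<^sup>+y. h y \<partial>lborel)))" by (simp add: mult_left_mono)
  also have "\<dots> = ennreal (1/2) * (C * (\<integral>\<^sup>+y. h y \<partial>lborel))"
    unfolding mult.assoc[symmetric] by (subst ennreal_mult[symmetric]) auto
  also have "\<dots> \<le> 1 * (C * (\<integral>\<^sup>+y. h y \<partial>lborel))"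
    by (intro mult_right_mono) (simp_all only: ennreal_le_1, simp_all)
  finally show ?thesis by simp
qed

text \<open>The weight is \<open>w = 1 / V\<close>. Outside the support of \<open>V\<close> it is 0 because \<open>1 / 0 = 0\<close>, so the last
  condition is only local integrability.\<close>

definition weighted_density :: "(real^3 \<Rightarrow> real^2) \<Rightarrow> real \<Rightarrow> bool" where
  "weighted_density q r \<longleftrightarrow> (\<forall>K. bounded K \<longrightarrow> (\<exists>V C. V \<in> borel_measurable borel \<and> (\<forall>u. 0 \<le> V u) \<and>
     (AE u in lborel. u \<in> K \<longrightarrow> 0 < V u) \<and>
     (\<forall>h \<in> borel_measurable borel. (\<integral>\<^sup>+u. h (q u) * ennreal (V u) \<partial>lborel) \<le> ennreal C * (\<integral>\<^sup>+y. h y \<partial>lborel)) \<and>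
     (\<integral>\<^sup>+u. ennreal ((1 / V u) powr r) \<partial>lborel) < \<infinity>))"

text \<open>B is fixed before g, so the estimate is uniform over all functions supported in K whose
  2s-th moment is at most A. This uniformity is what later permits rescaling; 2s plays the role of
  the Lebesgue exponent p.\<close>

lemma extension_L4_bound:
  fixes q :: "real^3 \<Rightarrow> real^2"
  assumes q[measurable]: "q \<in> borel_measurable borel"
    and para: "\<And>x y. q x + q y = (1/2) *\<^sub>R (q (x + y) + q (x - y))"
    and s: "1 < s" "s \<le> 2" and wd: "weighted_density q (s / (2 * (s - 1)))"
    and K: "bounded K" and A: "A < \<infinity>"
  obtains B where "B < \<infinity>" and
    "\<And>g::real^3 \<Rightarrow> complex. integrable lborel g \<Longrightarrow> (\<And>x. x \<notin> K \<Longrightarrow> g x = 0) \<Longrightarrow>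
      (\<integral>\<^sup>+x. ennreal (norm (g x) powr (2 * s)) \<partial>lborel) \<le> A \<Longrightarrow>
      (\<integral>\<^sup>+x. ennreal (norm (LINT \<xi>|lborel. exp (\<i> * of_real (x \<bullet> join5 \<xi> (q \<xi>))) * g \<xi>) ^ 4) \<partial>lborel) \<le> B"
proof -
  \<comment> \<open>The weight is evaluated at differences of points of K, so it must be positive
    almost everywhere on the difference set.\<close>
  define D where "D = (\<lambda>(x, y). x - y) ` (K \<times> K)"
  have "bounded D" using bounded_minus[OF K K] by (simp add: D_def image_def split_beta')
  from wd[unfolded weighted_density_def, rule_format, OF this] obtain V C where
    V[measurable]: "V \<in> borel_measurable borel" and V0: "\<And>u. 0 \<le> V u"
    and Vpos: "AE u in lborel. u \<in> D \<longrightarrow> 0 < V u"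
    and dens: "\<And>h. h \<in> borel_measurable borel \<Longrightarrow> (\<integral>\<^sup>+u. h (q u) * ennreal (V u) \<partial>lborel) \<le> ennreal C * (\<integral>\<^sup>+y. h y \<partial>lborel)"
    and Vr: "(\<integral>\<^sup>+u. ennreal ((1 / V u) powr (s / (2 * (s - 1)))) \<partial>lborel) < \<infinity>"
    by blast
  let ?W = "\<integral>\<^sup>+u. ennreal ((1 / V u) powr (s / (2 * (s - 1)))) \<partial>lborel"
  define B where "B = ennreal ((2 * pi) ^ DIM(real^5)) * ennreal C * (A * A + A * ?W + A * ?W)"
  have "B < \<infinity>" unfolding B_def using A Vr by (auto simp: ennreal_mult_less_top)
  moreover have "(\<integral>\<^sup>+x. ennreal (norm (LINT \<xi>|lborel. exp (\<i> * of_real (x \<bullet> join5 \<xi> (q \<xi>))) * g \<xi>) ^ 4) \<partial>lborel) \<le> B"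
    if g: "integrable lborel g" and supp: "\<And>x. x \<notin> K \<Longrightarrow> g x = 0"
      and gA: "(\<integral>\<^sup>+x. ennreal (norm (g x) powr (2 * s)) \<partial>lborel) \<le> A" for g :: "real^3 \<Rightarrow> complex"
  proof -
    have [measurable]: "g \<in> borel_measurable borel" using g by auto
    define k where "k z = g (fst z) * g (snd z)" for z
    define \<Psi> where "\<Psi> z = join5 (fst z) (q (fst z)) + join5 (snd z) (q (snd z))" for z
    have k: "integrable lborel k"
      using integrable_pair_mult[OF sigma_finite_lborel sigma_finite_lborel g g]
      by (simp add: k_def[abs_def] split_beta' lborel_prod)
    have [measurable]: "\<Psi> \<in> borel_measurable borel"
      unfolding \<Psi>_def[abs_def] borel_prod[symmetric] by measurable
    have [measurable]: "(\<lambda>z::(real^3) \<times> (real^3). V (fst z - snd z)) \<in> borel_measurable borel"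
      unfolding borel_prod[symmetric] by measurable
    define E where "E x = (LINT \<xi>|lborel. exp (\<i> * of_real (x \<bullet> join5 \<xi> (q \<xi>))) * g \<xi>)" for x
    \<comment> \<open>Tonelli-Fubini on the product: the phase of a sum is the product of the
      phases, so the square of the extension is again an oscillatory integral, now over
      pairs.\<close>
    have E2: "(LINT z|lborel. exp (\<i> * of_real (x \<bullet> \<Psi> z)) * k z) = E x * E x" for x
    proof -
      have i: "integrable lborel (\<lambda>\<xi>. exp (\<i> * of_real (x \<bullet> join5 \<xi> (q \<xi>))) * g \<xi>)"
        by (rule Bochner_Integration.integrable_bound[OF g]) (auto simp: norm_mult)
      from integrable_pair_mult[OF sigma_finite_lborel sigma_finite_lborel i i]
      have "(LINT z|(lborel \<Otimes>\<^sub>M lborel). (case z of (\<xi>, \<eta>) \<Rightarrow> (exp (\<i> * of_real (x \<bullet> join5 \<xi> (q \<xi>))) * g \<xi>) * (exp (\<i> * of_real (x \<bullet> join5 \<eta> (q \<eta>))) * g \<eta>))) = E x * E x"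
        using lborel_pair.integral_fst[OF integrable_pair_mult[OF sigma_finite_lborel sigma_finite_lborel i i]]
        unfolding E_def by simp
      then show ?thesis unfolding lborel_prod
        by (simp add: split_beta' k_def \<Psi>_def inner_add_right distrib_left exp_add mult_ac)
    qed
    have pos: "AE z in lborel. k z \<noteq> 0 \<longrightarrow> 0 < V (fst z - snd z)"
      using AE_lborel_diff[OF Vpos]
    proof eventually_elim
      case (elim z)
      show ?case
      proof
        assume "k z \<noteq> 0"
        then have "fst z \<in> K" "snd z \<in> K" using supp by (auto simp: k_def)
        then have "fst z - snd z \<in> D" by (force simp: D_def)
        with elim show "0 < V (fst z - snd z)" by simp
      qed
    qed
    have "(\<integral>\<^sup>+x. ennreal (norm (E x) ^ 4) \<partial>lborel) = (\<integral>\<^sup>+x. ennreal ((norm (LINT z|lborel. exp (\<i> * of_real (x \<bullet> \<Psi> z)) * k z))\<^sup>2) \<partial>lborel)"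
      unfolding E2 norm_mult power2_eq_square by (simp add: power4_eq_xxxx mult.assoc)
    also have "\<dots> \<le> ennreal ((2 * pi) ^ DIM(real^5)) * ennreal C * (\<integral>\<^sup>+z. ennreal ((norm (k z))\<^sup>2 / V (fst z - snd z)) \<partial>lborel)"
    proof (rule fourier_L2_bound[OF sigma_finite_lborel k _ _ _ pos])
      show "(\<integral>\<^sup>+z. h (\<Psi> z) * ennreal (V (fst z - snd z)) \<partial>lborel) \<le> ennreal C * (\<integral>\<^sup>+y. h y \<partial>lborel)"
        if "h \<in> borel_measurable borel" for h
        unfolding \<Psi>_def by (rule sumset_density[OF q V para dens that])
    qed (auto simp: V0)
    also have "(\<integral>\<^sup>+z. ennreal ((norm (k z))\<^sup>2 / V (fst z - snd z)) \<partial>lborel) =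
      (\<integral>\<^sup>+x. \<integral>\<^sup>+y. ennreal ((norm (g x))\<^sup>2 * (norm (g y))\<^sup>2 * (1 / V (x - y))) \<partial>lborel \<partial>lborel)"
    proof (subst nn_integral_lborel_pair)
      show "(\<lambda>z. ennreal ((norm (k z))\<^sup>2 / V (fst z - snd z))) \<in> borel_measurable borel"
        using k by auto
    qed (simp add: k_def norm_mult power_mult_distrib)
    \<comment> \<open>Young's bound is applied to \<open>(norm (g x))\<^sup>2\<close>, whose s-th
      power is the moment of order 2s, with the weight 1 / V.\<close>
    also have "\<dots> \<le> (\<integral>\<^sup>+x. ennreal ((norm (g x))\<^sup>2 powr s) \<partial>lborel) * (\<integral>\<^sup>+x. ennreal ((norm (g x))\<^sup>2 powr s) \<partial>lborel)
      + (\<integral>\<^sup>+x. ennreal ((norm (g x))\<^sup>2 powr s) \<partial>lborel) * ?W + (\<integral>\<^sup>+x. ennreal ((norm (g x))\<^sup>2 powr s) \<partial>lborel) * ?W"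
      by (rule young_integral[OF s refl]) (auto simp: V0)
    also have "(\<lambda>x. ennreal ((norm (g x))\<^sup>2 powr s)) = (\<lambda>x. ennreal (norm (g x) powr (2 * s)))"
    proof
      fix x show "ennreal ((norm (g x))\<^sup>2 powr s) = ennreal (norm (g x) powr (2 * s))"
        by (cases "g x = 0") (simp_all add: powr_powr flip: powr_numeral)
    qed
    finally have "(\<integral>\<^sup>+x. ennreal (norm (E x) ^ 4) \<partial>lborel) \<le> ennreal ((2 * pi) ^ DIM(real^5)) * ennreal C *
      ((\<integral>\<^sup>+x. ennreal (norm (g x) powr (2 * s)) \<partial>lborel) * (\<integral>\<^sup>+x. ennreal (norm (g x) powr (2 * s)) \<partial>lborel)
      + (\<integral>\<^sup>+x. ennreal (norm (g x) powr (2 * s)) \<partial>lborel) * ?W + (\<integral>\<^sup>+x. ennreal (norm (g x) powr (2 * s)) \<partial>lborel) * ?W)"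
      by (simp add: mult_left_mono)
    also have "\<dots> \<le> B"
      unfolding B_def using gA by (intro mult_left_mono add_mono mult_mono) auto
    finally show ?thesis unfolding E_def .
  qed
  ultimately show ?thesis using that by blast
qed

subsection \<open>Weights for the normal forms and their equivalents\<close>

definition cube :: "real \<Rightarrow> (real^3) set" where
  "cube R = {v. \<forall>i. \<bar>v $ i\<bar> \<le> R}"

lemma indicator_cube: "indicator (cube R) v =
    (indicator {-R..R} (v $ 1) * indicator {-R..R} (v $ 2) * indicator {-R..R} (v $ 3) :: real)"
proof -
  have "t \<in> {-R..R} \<longleftrightarrow> \<bar>t\<bar> \<le> R" for t by auto
  then show ?thesis by (simp add: indicator_def cube_def forall_3)
qed

lemma nn_integral_powr_cube:
  assumes j: "j = 2 \<or> j = (3::3)" and \<gamma>: "\<gamma> < 1"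
  shows "(\<integral>\<^sup>+v. ennreal (\<bar>v $ 1 * v $ j\<bar> powr (- \<gamma>) * indicator (cube R) v) \<partial>lborel) < \<infinity>"
proof -
  define g where "g u = ennreal (\<bar>u\<bar> powr (- \<gamma>) * indicator {-R..R} u)" for u
  define i where "i u = ennreal (indicator {-R..R} u)" for u :: real
  have [measurable]: "g \<in> borel_measurable borel" "i \<in> borel_measurable borel"
    unfolding g_def i_def by measurable
  have gfin: "(\<integral>\<^sup>+u. g u \<partial>lborel) < \<infinity>" unfolding g_def by (rule nn_integral_powr_interval[OF \<gamma>])
  have ifin: "(\<integral>\<^sup>+u. i u \<partial>lborel) < \<infinity>"
  proof -
    have "(\<integral>\<^sup>+u. i u \<partial>lborel) = (\<integral>\<^sup>+u. indicator {-R..R} u \<partial>lborel)"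
      unfolding i_def by (intro nn_integral_cong) (simp add: indicator_def)
    then show ?thesis by (simp add: emeasure_lborel_Icc_eq)
  qed
  have triple: "(\<integral>\<^sup>+x. \<integral>\<^sup>+y. \<integral>\<^sup>+z. a x * b y * c z \<partial>lborel \<partial>lborel \<partial>lborel) =
      (\<integral>\<^sup>+x. a x \<partial>lborel) * (\<integral>\<^sup>+x. b x \<partial>lborel) * (\<integral>\<^sup>+x. c x \<partial>lborel)"
    if [measurable]: "a \<in> borel_measurable borel" "b \<in> borel_measurable borel" "c \<in> borel_measurable borel"
    for a b c :: "real \<Rightarrow> ennreal"
    by (simp add: nn_integral_cmult nn_integral_multc)
  show ?thesis
  proof (cases "j = 2")
    case True
    have "ennreal (\<bar>x * y\<bar> powr (- \<gamma>) * indicator (cube R) (vector [x, y, z])) = g x * g y * i z" for x y z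
      unfolding g_def i_def indicator_cube
      by (simp add: abs_mult powr_mult ennreal_mult[symmetric] mult_ac)
    then have "(\<integral>\<^sup>+v. ennreal (\<bar>v $ 1 * v $ j\<bar> powr (- \<gamma>) * indicator (cube R) v) \<partial>lborel) =
      (\<integral>\<^sup>+x. \<integral>\<^sup>+y. \<integral>\<^sup>+z. g x * g y * i z \<partial>lborel \<partial>lborel \<partial>lborel)"
      unfolding True by (subst nn_integral_vector3) (auto simp: indicator_cube[abs_def])
    also have "\<dots> < \<infinity>"
      using gfin ifin by (subst triple) (auto simp: ennreal_mult_less_top)
    finally show ?thesis .
  next
    case False
    then have j3: "j = 3" using j by simp
    have "ennreal (\<bar>x * z\<bar> powr (- \<gamma>) * indicator (cube R) (vector [x, y, z])) = g x * i y * g z" for x y z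
      unfolding g_def i_def indicator_cube
      by (simp add: abs_mult powr_mult ennreal_mult[symmetric] mult_ac)
    then have "(\<integral>\<^sup>+v. ennreal (\<bar>v $ 1 * v $ j\<bar> powr (- \<gamma>) * indicator (cube R) v) \<partial>lborel) =
      (\<integral>\<^sup>+x. \<integral>\<^sup>+y. \<integral>\<^sup>+z. g x * i y * g z \<partial>lborel \<partial>lborel \<partial>lborel)"
      unfolding j3 by (subst nn_integral_vector3) (auto simp: indicator_cube[abs_def])
    also have "\<dots> < \<infinity>"
      using gfin ifin by (subst triple) (auto simp: ennreal_mult_less_top)
    finally show ?thesis .
  qed
qed

lemma cube_measurable [measurable]: "cube R \<in> sets borel"
proof -
  have "{v \<in> space borel. \<bar>v $ 1\<bar> \<le> R \<and> \<bar>v $ 2\<bar> \<le> R \<and> \<bar>v $ 3\<bar> \<le> R} \<in> sets (borel :: (real^3) measure)"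
    by measurable
  then show ?thesis by (simp add: cube_def forall_3)
qed

text \<open>The weight degenerates only on coordinate planes, which are null. On the cube, its
  reciprocal to the power r is a product of one-dimensional powers of order
  \<open>\<alpha> * r < 1\<close>, so only the density bound depends on the particular form.\<close>

lemma weighted_density_powr:
  assumes j: "j = 2 \<or> j = (3::3)" and \<alpha>: "\<alpha> * r < 1" and r: "0 < r"
    and dens: "\<And>R. 0 < R \<Longrightarrow> \<exists>C. \<forall>h \<in> borel_measurable borel.
      (\<integral>\<^sup>+v. h (\<phi> v) * ennreal (\<bar>v $ 1 * v $ j\<bar> powr \<alpha> * indicator (cube R) v) \<partial>lborel)
      \<le> ennreal C * (\<integral>\<^sup>+y. h y \<partial>lborel)"
  shows "weighted_density \<phi> r"
  unfolding weighted_density_def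
proof (intro allI impI)
  fix K :: "(real^3) set" assume "bounded K"
  then obtain R where R: "0 < R" "\<And>v. v \<in> K \<Longrightarrow> norm v \<le> R" by (auto simp: bounded_pos)
  have KR: "K \<subseteq> cube R"
    using R(2) component_le_norm_cart order_trans by (fastforce simp: cube_def)
  obtain C where C: "\<And>h. h \<in> borel_measurable borel \<Longrightarrow>
      (\<integral>\<^sup>+v. h (\<phi> v) * ennreal (\<bar>v $ 1 * v $ j\<bar> powr \<alpha> * indicator (cube R) v) \<partial>lborel)
      \<le> ennreal C * (\<integral>\<^sup>+y. h y \<partial>lborel)"
    using dens[OF R(1)] by blast
  define V where "V v = \<bar>v $ 1 * v $ j\<bar> powr \<alpha> * indicator (cube R) v" for v :: "real^3"
  have "V \<in> borel_measurable borel" unfolding V_def by measurable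
  moreover have "\<forall>u. 0 \<le> V u" by (simp add: V_def)
  moreover have "AE u in lborel. u \<in> K \<longrightarrow> 0 < V u"
    using AE_vec_nth_nonzero[of 1] AE_vec_nth_nonzero[of j]
    by eventually_elim (use KR in \<open>auto simp: V_def\<close>)
  moreover have "\<forall>h \<in> borel_measurable borel. (\<integral>\<^sup>+u. h (\<phi> u) * ennreal (V u) \<partial>lborel) \<le> ennreal C * (\<integral>\<^sup>+y. h y \<partial>lborel)"
    using C by (simp add: V_def)
  moreover have "(\<integral>\<^sup>+u. ennreal ((1 / V u) powr r) \<partial>lborel) < \<infinity>"
  proof -
    have "(1 / V u) powr r = \<bar>u $ 1 * u $ j\<bar> powr (- (\<alpha> * r)) * indicator (cube R) u" for u
    proof (cases "u \<in> cube R \<and> u $ 1 * u $ j \<noteq> 0")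
      case True
      then show ?thesis by (simp add: V_def powr_minus_divide powr_divide powr_powr)
    next
      \<comment> \<open>Off the cube and on the coordinate planes both sides vanish, because
        \<open>1 / 0 = 0\<close> and a power of 0 is 0.\<close>
      case False
      then show ?thesis by (auto simp: V_def)
    qed
    then show ?thesis using nn_integral_powr_cube[OF j \<alpha>, of R] by simp
  qed
  ultimately show "\<exists>V C. V \<in> borel_measurable borel \<and> (\<forall>u. 0 \<le> V u) \<and>
     (AE u in lborel. u \<in> K \<longrightarrow> 0 < V u) \<and>
     (\<forall>h \<in> borel_measurable borel. (\<integral>\<^sup>+u. h (\<phi> u) * ennreal (V u) \<partial>lborel) \<le> ennreal C * (\<integral>\<^sup>+y. h y \<partial>lborel)) \<and>
     (\<integral>\<^sup>+u. ennreal ((1 / V u) powr r) \<partial>lborel) < \<infinity>"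
    by blast
qed

lemma weighted_density_form1:
  assumes r: "0 < r" "r < 3/2"
  shows "weighted_density form1 r"
proof (rule weighted_density_powr[of 2 "2/3"])
  fix R :: real assume R: "0 < R"
  have "(\<integral>\<^sup>+v. h (form1 v) * ennreal (\<bar>v $ 1 * v $ 2\<bar> powr (2/3) * indicator (cube R) v) \<partial>lborel)
      \<le> ennreal (6 * R powr (1/3)) * (\<integral>\<^sup>+y. h y \<partial>lborel)" if h: "h \<in> borel_measurable borel" for h
    unfolding indicator_cube
    by (rule order_trans[OF nn_integral_mono form1_density[OF R h]])
       (auto intro!: mult_left_mono ennreal_leI simp: indicator_def)
  then show "\<exists>C. \<forall>h \<in> borel_measurable borel.
      (\<integral>\<^sup>+v. h (form1 v) * ennreal (\<bar>v $ 1 * v $ 2\<bar> powr (2/3) * indicator (cube R) v) \<partial>lborel)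
      \<le> ennreal C * (\<integral>\<^sup>+y. h y \<partial>lborel)" by blast
qed (use r in auto)

lemma weighted_density_form2:
  assumes s: "\<bar>s\<bar> = 1" and r: "1 \<le> r" "r < 2"
  shows "weighted_density (form2 s) r"
proof -
  \<comment> \<open>The density bound wants \<alpha> > 1/2 and the integrability of the reciprocal
    weight wants \<alpha> < 1 / r; the interval is nonempty because r < 2. The hypothesis 1 \<le> r
    then yields \<alpha> < 1.\<close>
  obtain \<alpha> where \<alpha>: "1/2 < \<alpha>" "\<alpha> < 1 / r"
    using dense[of "1/2" "1/r"] r by (auto simp: field_simps)
  have "1 / r \<le> 1" using r by simp
  then have "\<alpha> < 1" using \<alpha> by linarith
  have \<alpha>r: "\<alpha> * r < 1" "\<alpha> < 1" using \<alpha> r \<open>\<alpha> < 1\<close> by (simp_all add: field_simps)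
  show ?thesis
  proof (rule weighted_density_powr[of 3 \<alpha>])
    fix R :: real assume R: "0 < R"
    obtain C where C: "\<And>h. h \<in> borel_measurable borel \<Longrightarrow>
      (\<integral>\<^sup>+v. h (form2 s v) * ennreal (\<bar>v $ 1 * v $ 3\<bar> powr \<alpha> * (indicator {-R..R} (v $ 1) * indicator {-R..R} (v $ 3))) \<partial>lborel)
      \<le> ennreal C * (\<integral>\<^sup>+y. h y \<partial>lborel)"
      using form2_density[OF s R \<alpha>(1) \<alpha>r(2)] by blast
    have "(\<integral>\<^sup>+v. h (form2 s v) * ennreal (\<bar>v $ 1 * v $ 3\<bar> powr \<alpha> * indicator (cube R) v) \<partial>lborel)
        \<le> ennreal C * (\<integral>\<^sup>+y. h y \<partial>lborel)" if h: "h \<in> borel_measurable borel" for h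
      unfolding indicator_cube
      by (rule order_trans[OF nn_integral_mono C[OF h]])
         (auto intro!: mult_left_mono ennreal_leI simp: indicator_def)
    then show "\<exists>C. \<forall>h \<in> borel_measurable borel.
        (\<integral>\<^sup>+v. h (form2 s v) * ennreal (\<bar>v $ 1 * v $ 3\<bar> powr \<alpha> * indicator (cube R) v) \<partial>lborel)
        \<le> ennreal C * (\<integral>\<^sup>+y. h y \<partial>lborel)" by blast
  qed (use \<alpha>r r in auto)
qed

text \<open>Substitute u = M1 v and test against h composed with the inverse P of M2: since q (M1 v)
  = P (\<phi> v), the weight for \<phi>, transported by the inverse N of M1, works for q with a
  changed constant.\<close>

lemma weighted_density_linear:
  fixes M1 :: "real^3^3" and M2 :: "real^2^2"
  assumes M1: "invertible M1" and M2: "invertible M2" and q[measurable]: "q \<in> borel_measurable borel"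
    and eq: "\<And>v. \<phi> v = M2 *v q (M1 *v v)" and wd: "weighted_density \<phi> r"
  shows "weighted_density q r"
  unfolding weighted_density_def
proof (intro allI impI)
  fix K :: "(real^3) set" assume K: "bounded K"
  obtain N where N: "M1 ** N = mat 1" "N ** M1 = mat 1" using M1 invertible_def by blast
  obtain P where P: "M2 ** P = mat 1" "P ** M2 = mat 1" using M2 invertible_def by blast
  have invN: "invertible N" and invP: "invertible P" using N P invertible_def by blast+
  have MN: "M1 *v (N *v x) = x" "N *v (M1 *v x) = x" for x
    by (simp_all add: matrix_vector_mul_assoc N)
  have PM: "P *v (M2 *v x) = x" for x
    by (simp add: matrix_vector_mul_assoc P)
  have "bounded ((*v) N ` K)"
    by (rule bounded_linear_image[OF K matrix_vector_mul_bounded_linear])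
  from wd[unfolded weighted_density_def, rule_format, OF this] obtain V C where
    V[measurable]: "V \<in> borel_measurable borel" and V0: "\<And>u. 0 \<le> V u"
    and Vpos: "AE u in lborel. u \<in> (*v) N ` K \<longrightarrow> 0 < V u"
    and dens: "\<And>h. h \<in> borel_measurable borel \<Longrightarrow> (\<integral>\<^sup>+u. h (\<phi> u) * ennreal (V u) \<partial>lborel) \<le> ennreal C * (\<integral>\<^sup>+y. h y \<partial>lborel)"
    and Vr: "(\<integral>\<^sup>+u. ennreal ((1 / V u) powr r) \<partial>lborel) < \<infinity>"
    by blast
  \<comment> \<open>\<open>det M1\<close> comes from u = M1 v, and
    \<open>1 / \<bar>det P\<bar>\<close> from undoing the linear map in the test function.
    \<open>max C 0\<close> makes the product of constants multiplicative under
    \<open>ennreal\<close>.\<close>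
  define D where "D = \<bar>det M1\<bar> * (max C 0 * (1 / \<bar>det P\<bar>))"
  have "(\<lambda>u. V (N *v u)) \<in> borel_measurable borel" by measurable
  moreover have "\<forall>u. 0 \<le> V (N *v u)" using V0 by simp
  moreover have "AE u in lborel. u \<in> K \<longrightarrow> 0 < V (N *v u)"
    using AE_lborel_linear[OF invN Vpos] by eventually_elim auto
  moreover have "(\<integral>\<^sup>+u. h (q u) * ennreal (V (N *v u)) \<partial>lborel) \<le> ennreal D * (\<integral>\<^sup>+y. h y \<partial>lborel)"
    if [measurable]: "h \<in> borel_measurable borel" for h
  proof -
    have "(\<integral>\<^sup>+u. h (q u) * ennreal (V (N *v u)) \<partial>lborel) =
      ennreal \<bar>det M1\<bar> * (\<integral>\<^sup>+v. h (q (M1 *v v)) * ennreal (V (N *v (M1 *v v))) \<partial>lborel)"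
      by (rule nn_integral_linear[OF M1]) measurable
    also have "(\<integral>\<^sup>+v. h (q (M1 *v v)) * ennreal (V (N *v (M1 *v v))) \<partial>lborel) = (\<integral>\<^sup>+v. h (P *v \<phi> v) * ennreal (V v) \<partial>lborel)"
      by (simp add: MN eq PM)
    also have "\<dots> \<le> ennreal C * (\<integral>\<^sup>+y. h (P *v y) \<partial>lborel)"
      by (rule dens) measurable
    also have "(\<integral>\<^sup>+y. h (P *v y) \<partial>lborel) = ennreal (1 / \<bar>det P\<bar>) * (\<integral>\<^sup>+y. h y \<partial>lborel)"
      by (rule nn_integral_linear_image[OF invP]) measurable
    finally have "(\<integral>\<^sup>+u. h (q u) * ennreal (V (N *v u)) \<partial>lborel) \<le>
      ennreal \<bar>det M1\<bar> * (ennreal C * (ennreal (1 / \<bar>det P\<bar>) * (\<integral>\<^sup>+y. h y \<partial>lborel)))"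
      by (simp add: mult_left_mono)
    also have "\<dots> = (ennreal \<bar>det M1\<bar> * (ennreal (max C 0) * ennreal (1 / \<bar>det P\<bar>))) * (\<integral>\<^sup>+y. h y \<partial>lborel)"
      by (simp add: mult.assoc max_def ennreal_neg)
    also have "ennreal \<bar>det M1\<bar> * (ennreal (max C 0) * ennreal (1 / \<bar>det P\<bar>)) = ennreal D"
      unfolding D_def by (subst ennreal_mult[symmetric], simp, simp, subst ennreal_mult[symmetric]) auto
    finally show ?thesis .
  qed
  moreover have "(\<integral>\<^sup>+u. ennreal ((1 / V (N *v u)) powr r) \<partial>lborel) < \<infinity>"
  proof -
    have "(\<integral>\<^sup>+u. ennreal ((1 / V (N *v u)) powr r) \<partial>lborel) =
      ennreal \<bar>det M1\<bar> * (\<integral>\<^sup>+v. ennreal ((1 / V (N *v (M1 *v v))) powr r) \<partial>lborel)"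
      by (rule nn_integral_linear[OF M1]) measurable
    also have "\<dots> < \<infinity>" using Vr by (simp add: MN ennreal_mult_less_top)
    finally show ?thesis .
  qed
  ultimately show "\<exists>V C. V \<in> borel_measurable borel \<and> (\<forall>u. 0 \<le> V u) \<and>
     (AE u in lborel. u \<in> K \<longrightarrow> 0 < V u) \<and>
     (\<forall>h \<in> borel_measurable borel. (\<integral>\<^sup>+u. h (q u) * ennreal (V u) \<partial>lborel) \<le> ennreal C * (\<integral>\<^sup>+y. h y \<partial>lborel)) \<and>
     (\<integral>\<^sup>+u. ennreal ((1 / V u) powr r) \<partial>lborel) < \<infinity>"
    by blast
qed

subsection \<open>From normalized functions to restriction estimates\<close>

lemma Lp_norm_finite_exponent:
  assumes "p \<noteq> \<infinity>" "Lp_norm p M f < \<infinity>"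
  obtains I where "0 \<le> I" "(\<integral>\<^sup>+x. ennreal (norm (f x) powr enn2real p) \<partial>M) = ennreal I"
    "Lp_norm p M f = ennreal (I powr (1 / enn2real p))"
proof (cases "(\<integral>\<^sup>+x. ennreal (norm (f x) powr enn2real p) \<partial>M)")
  case (real r)
  then show ?thesis using that[of r] assms by (simp add: Lp_norm_def)
next
  case top
  then show ?thesis using assms by (simp add: Lp_norm_def)
qed

lemma Lp_norm_eq_0D:
  assumes p: "0 < p" and f: "f \<in> borel_measurable M" and 0: "Lp_norm p M f = 0"
  shows "AE x in M. f x = 0"
proof (cases "p = \<infinity>")
  case True
  then have "esssup M (\<lambda>x. ennreal (norm (f x))) = 0" using 0 by (simp add: Lp_norm_def)
  then show ?thesis using esssup_AE[of "\<lambda>x. ennreal (norm (f x))" M] by simp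
next
  case False
  then obtain I where I: "0 \<le> I" "(\<integral>\<^sup>+x. ennreal (norm (f x) powr enn2real p) \<partial>M) = ennreal I"
    "Lp_norm p M f = ennreal (I powr (1 / enn2real p))"
    using Lp_norm_finite_exponent[of p M f] 0 by auto
  then have "I = 0" using 0 by simp
  then have "AE x in M. ennreal (norm (f x) powr enn2real p) = 0"
    using I f by (subst nn_integral_0_iff_AE[symmetric]) auto
  then show ?thesis by simp
qed

text \<open>Instead of Hoelder's inequality on a finite measure space, the pointwise bound a^t \<le>
  1 + a^P for t \<le> P suffices after dividing by the norm: the P-th moment is then 1. For p =
  \<infinity> the quotient is at most 1 almost everywhere.\<close>

lemma Lp_norm_normalized_moment:
  assumes t: "0 < t" and p: "ennreal t \<le> p" and [measurable]: "f \<in> borel_measurable M"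
    and n: "Lp_norm p M f = ennreal n" "0 < n"
  shows "(\<integral>\<^sup>+x. ennreal ((norm (f x) / n) powr t) \<partial>M) \<le> emeasure M (space M) + 1"
proof (cases "p = \<infinity>")
  case True
  then have "esssup M (\<lambda>x. ennreal (norm (f x))) = ennreal n" using n by (simp add: Lp_norm_def)
  then have "AE x in M. norm (f x) \<le> n"
    using esssup_AE[of "\<lambda>x. ennreal (norm (f x))" M] n by simp
  then have "(\<integral>\<^sup>+x. ennreal ((norm (f x) / n) powr t) \<partial>M) \<le> (\<integral>\<^sup>+x. 1 \<partial>M)"
  proof (intro nn_integral_mono_AE, eventually_elim)
    case (elim x)
    then have "(norm (f x) / n) powr t \<le> 1 powr t"
      using n t by (intro powr_mono2) auto
    then show ?case by simp
  qed
  then show ?thesis by (simp add: add_increasing2)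
next
  case False
  define P where "P = enn2real p"
  have "p = ennreal P" using False by (simp add: P_def less_top[symmetric])
  then have tP: "t \<le> P" using p t by (cases "0 \<le> P") (auto simp: ennreal_neg)
  obtain I where I: "0 \<le> I" "(\<integral>\<^sup>+x. ennreal (norm (f x) powr P) \<partial>M) = ennreal I"
    "Lp_norm p M f = ennreal (I powr (1 / P))"
    using Lp_norm_finite_exponent[of p M f] False n unfolding P_def by auto
  have nI: "n = I powr (1 / P)" using I n by auto
  then have nP: "n powr P = I" using n t tP I by (auto simp: powr_powr)
  have "(\<integral>\<^sup>+x. ennreal ((norm (f x) / n) powr t) \<partial>M) \<le> (\<integral>\<^sup>+x. 1 + ennreal (1 / I) * ennreal (norm (f x) powr P) \<partial>M)"
  proof (rule nn_integral_mono)
    fix x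
    let ?a = "norm (f x) / n"
    have a: "0 \<le> ?a" using n by simp
    have "?a powr t \<le> 1 + ?a powr P"
    proof (cases "?a \<le> 1")
      case True
      then have "?a powr t \<le> 1 powr t" using a t by (intro powr_mono2) auto
      then show ?thesis using powr_ge_zero[of ?a P] unfolding powr_one_eq_one by linarith
    next
      case False
      then have "?a powr t \<le> ?a powr P" using tP by (intro powr_mono) auto
      then show ?thesis by simp
    qed
    also have "?a powr P = 1 / I * norm (f x) powr P"
      using n nP by (simp add: powr_divide)
    finally have "ennreal (?a powr t) \<le> ennreal (1 + 1 / I * norm (f x) powr P)" by (rule ennreal_leI)
    also have "\<dots> = 1 + ennreal (1 / I) * ennreal (norm (f x) powr P)"
      using I(1) by (subst ennreal_plus) (auto simp: ennreal_mult[symmetric])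
    finally show "ennreal (?a powr t) \<le> 1 + ennreal (1 / I) * ennreal (norm (f x) powr P)" .
  qed
  also have "\<dots> = emeasure M (space M) + ennreal (1 / I) * ennreal I"
    by (simp add: nn_integral_add nn_integral_cmult I)
  also have "ennreal (1 / I) * ennreal I = 1"
    using nI n I by (subst ennreal_mult[symmetric]) auto
  finally show ?thesis .
qed

text \<open>Functions on \<open>lebesgue_on K\<close> are only Lebesgue measurable, whereas the
  product and substitution arguments run on \<open>lborel\<close>. The extension by zero therefore
  gets a Borel representative, found separately for real and imaginary part and cut off to
  K.\<close>

lemma lebesgue_on_ex_borel:
  fixes f :: "'a::euclidean_space \<Rightarrow> complex"
  assumes f: "f \<in> borel_measurable (lebesgue_on K)" and K: "K \<in> sets borel"
  obtains g where "g \<in> borel_measurable borel" "\<And>x. x \<notin> K \<Longrightarrow> g x = 0"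
    "AE x in lborel. indicator K x *\<^sub>R f x = g x"
proof -
  have "(\<lambda>x. indicator K x *\<^sub>R f x) \<in> borel_measurable lebesgue"
    using f K by (subst borel_measurable_restrict_space_iff[symmetric]) auto
  then have "(\<lambda>x. Re (indicator K x *\<^sub>R f x)) \<in> borel_measurable lebesgue"
      "(\<lambda>x. Im (indicator K x *\<^sub>R f x)) \<in> borel_measurable lebesgue"
    by measurable
  from this[THEN completion_ex_borel_measurable_real]
  obtain g1 g2 where [measurable]: "g1 \<in> borel_measurable lborel" "g2 \<in> borel_measurable lborel"
    and g: "AE x in lborel. Re (indicator K x *\<^sub>R f x) = g1 x" "AE x in lborel. Im (indicator K x *\<^sub>R f x) = g2 x"
    by blast
  define h where "h x = complex_of_real (g1 x) + \<i> * complex_of_real (g2 x)" for x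
  have [measurable]: "h \<in> borel_measurable borel" "K \<in> sets borel" using K unfolding h_def by auto
  show thesis
  proof (rule that[of "\<lambda>x. indicator K x *\<^sub>R h x"])
    show "(\<lambda>x. indicator K x *\<^sub>R h x) \<in> borel_measurable borel" by measurable
    show "indicator K x *\<^sub>R h x = 0" if "x \<notin> K" for x using that by simp
    show "AE x in lborel. indicator K x *\<^sub>R f x = indicator K x *\<^sub>R h x"
      using g by eventually_elim (auto simp: h_def complex_eq_iff indicator_def)
  qed
qed

definition quadratic_pair :: "real^3^3 \<Rightarrow> real^3^3 \<Rightarrow> real^3 \<Rightarrow> real^2" where
  "quadratic_pair A B \<xi> = vector [quadratic_form A \<xi>, quadratic_form B \<xi>]"

lemma surface_map_eq: "surface_map A B \<xi> = join5 \<xi> (quadratic_pair A B \<xi>)"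
  by (simp add: surface_map_def join5_def quadratic_pair_def)

lemma quadratic_form_measurable [measurable]: "quadratic_form A \<in> borel_measurable borel"
  unfolding quadratic_form_def[abs_def]
  by (intro borel_measurable_inner borel_measurable_matrix_vector_mult) simp

lemma quadratic_pair_measurable [measurable]: "quadratic_pair A B \<in> borel_measurable borel"
  unfolding quadratic_pair_def[abs_def] by measurable

lemma quadratic_form_parallelogram:
  "quadratic_form A (x + y) + quadratic_form A (x - y) = 2 * (quadratic_form A x + quadratic_form A y)"
  by (simp add: quadratic_form_def matrix_vector_right_distrib matrix_vector_mult_diff_distrib
      inner_add_left inner_add_right inner_diff_left inner_diff_right algebra_simps)

lemma quadratic_pair_parallelogram:
  "quadratic_pair A B x + quadratic_pair A B y =
    (1/2) *\<^sub>R (quadratic_pair A B (x + y) + quadratic_pair A B (x - y))"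
  using quadratic_form_parallelogram[of A x y] quadratic_form_parallelogram[of B x y]
  by (simp add: vec_eq_iff forall_2 quadratic_pair_def)

lemma extension_operator_eq_lborel:
  assumes K: "K \<in> sets borel" and [measurable]: "g \<in> borel_measurable borel" "\<Sigma> \<in> borel_measurable borel"
    and f: "f \<in> borel_measurable (lebesgue_on K)"
    and ae: "AE \<xi> in lborel. indicator K \<xi> *\<^sub>R f \<xi> = g \<xi>"
  shows "extension_operator \<Sigma> K f x = (LINT \<xi>|lborel. exp (\<i> * of_real (x \<bullet> \<Sigma> \<xi>)) * g \<xi>)"
proof -
  have m: "(\<lambda>\<xi>. indicator K \<xi> *\<^sub>R f \<xi>) \<in> borel_measurable lebesgue"
    using f K by (subst borel_measurable_restrict_space_iff[symmetric]) auto
  have e: "(\<lambda>\<xi>. exp (\<i> * of_real (x \<bullet> \<Sigma> \<xi>)) * h \<xi>) \<in> borel_measurable lebesgue"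
    if [measurable]: "h \<in> borel_measurable lebesgue" for h
  proof -
    have "(\<lambda>\<xi>. exp (\<i> * of_real (x \<bullet> \<Sigma> \<xi>))) \<in> borel_measurable lborel" by measurable
    then have [measurable]: "(\<lambda>\<xi>. exp (\<i> * of_real (x \<bullet> \<Sigma> \<xi>))) \<in> borel_measurable lebesgue"
      by (rule measurable_completion)
    show ?thesis by measurable
  qed
  have g': "g \<in> borel_measurable lebesgue" by (rule measurable_completion) simp
  have "extension_operator \<Sigma> K f x = (LINT \<xi>|lebesgue. exp (\<i> * of_real (x \<bullet> \<Sigma> \<xi>)) * (indicator K \<xi> *\<^sub>R f \<xi>))"
    unfolding extension_operator_def using K by (subst integral_restrict_space) auto
  also have "\<dots> = (LINT \<xi>|lebesgue. exp (\<i> * of_real (x \<bullet> \<Sigma> \<xi>)) * g \<xi>)"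
    by (intro integral_cong_AE e m g') (use AE_completion[OF ae] in eventually_elim, simp)
  also have "\<dots> = (LINT \<xi>|lborel. exp (\<i> * of_real (x \<bullet> \<Sigma> \<xi>)) * g \<xi>)"
    by (rule integral_completion) measurable
  finally show ?thesis .
qed

text \<open>Homogeneity: f divided by its norm has 2s-th moment at most |K| + 1, so
  \<open>extension_L4_bound\<close> with that A gives one bound for all normalized functions, and
  linearity restores the norm. This also passes from the exponent 2s to every larger p, including
  \<infinity>.\<close>

theorem restriction_estimate_of_weighted_density:
  assumes K: "compact K" and s: "1 < s" "s \<le> 2"
    and wd: "weighted_density (quadratic_pair A B) (s / (2 * (s - 1)))"
    and p: "ennreal (2 * s) \<le> p"
  shows "restriction_estimate (surface_map A B) K p 4"
proof -
  have Kb[measurable]: "K \<in> sets borel" using K by (simp add: compact_imp_closed borel_closed)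
  have fin: "emeasure lborel K + 1 < \<infinity>"
    using emeasure_bounded_finite[OF compact_imp_bounded[OF K]] by simp
  obtain B0 where B0: "B0 < \<infinity>" and bound:
    "\<And>g::real^3 \<Rightarrow> complex. integrable lborel g \<Longrightarrow> (\<And>x. x \<notin> K \<Longrightarrow> g x = 0) \<Longrightarrow>
      (\<integral>\<^sup>+x. ennreal (norm (g x) powr (2 * s)) \<partial>lborel) \<le> emeasure lborel K + 1 \<Longrightarrow>
      (\<integral>\<^sup>+x. ennreal (norm (LINT \<xi>|lborel. exp (\<i> * of_real (x \<bullet> join5 \<xi> (quadratic_pair A B \<xi>))) * g \<xi>) ^ 4) \<partial>lborel) \<le> B0"
    using extension_L4_bound[OF quadratic_pair_measurable quadratic_pair_parallelogram s wd compact_imp_bounded[OF K] fin]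
    by blast
  \<comment> \<open>Adding 1 makes the constant strictly positive even if the bound
    \<open>B0\<close> is 0.\<close>
  define b where "b = enn2real B0 + 1"
  have "B0 = ennreal (enn2real B0)" using B0 by simp
  also have "\<dots> \<le> ennreal b" unfolding b_def by (intro ennreal_leI) simp
  finally have b: "0 < b" "B0 \<le> ennreal b"
    using enn2real_nonneg[of B0] unfolding b_def by linarith+
  have S[measurable]: "surface_map A B \<in> borel_measurable borel"
    unfolding surface_map_eq[abs_def] by measurable
  have p0: "0 < p" using p s by (intro less_le_trans[OF _ p]) auto
  show ?thesis unfolding restriction_estimate_def
  proof (intro exI[of _ "b powr (1/4)"] conjI ballI)
    show "0 < b powr (1/4)" using b by simp
    fix f assume "f \<in> Lp_space p (lebesgue_on K)"
    then have f: "f \<in> borel_measurable (lebesgue_on K)" and fp: "Lp_norm p (lebesgue_on K) f < \<infinity>"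
      by (auto simp: Lp_space_def)
    obtain g where g[measurable]: "g \<in> borel_measurable borel" and g0: "\<And>x. x \<notin> K \<Longrightarrow> g x = 0"
      and ae: "AE x in lborel. indicator K x *\<^sub>R f x = g x"
      using lebesgue_on_ex_borel[OF f Kb] by blast
    have Eg: "extension_operator (surface_map A B) K f x = (LINT \<xi>|lborel. exp (\<i> * of_real (x \<bullet> surface_map A B \<xi>)) * g \<xi>)" for x
      by (rule extension_operator_eq_lborel[OF Kb g S f ae])
    obtain n where n: "Lp_norm p (lebesgue_on K) f = ennreal n" "0 \<le> n"
      using fp by (cases "Lp_norm p (lebesgue_on K) f") auto
    have Lp4: "Lp_norm 4 lebesgue F \<le> ennreal c"
      if c: "0 \<le> c" "(\<integral>\<^sup>+x. ennreal (norm (F x) ^ 4) \<partial>lborel) \<le> ennreal (c ^ 4)" for c and F :: "real^5 \<Rightarrow> complex"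
    proof -
      have "norm (F x) powr 4 = norm (F x) ^ 4" for x by (cases "F x = 0") simp_all
      then have I: "(\<integral>\<^sup>+x. ennreal (norm (F x) powr enn2real 4) \<partial>lebesgue) \<le> ennreal (c ^ 4)"
        using c(2) by (simp add: nn_integral_completion)
      then obtain J where J: "0 \<le> J" "(\<integral>\<^sup>+x. ennreal (norm (F x) powr enn2real 4) \<partial>lebesgue) = ennreal J"
        by (cases "\<integral>\<^sup>+x. ennreal (norm (F x) powr enn2real 4) \<partial>lebesgue") (auto simp: top_unique)
      then have "J \<le> c ^ 4" using I c(1) by simp
      then have "J powr (1/4) \<le> (c ^ 4) powr (1/4)" using J by (intro powr_mono2) auto
      also have "\<dots> = c" using c(1) by (cases "c = 0") (simp_all add: powr_powr flip: powr_numeral)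
      finally show ?thesis unfolding Lp_norm_def using J by (simp add: ennreal_leI)
    qed
    show "Lp_norm 4 lebesgue (extension_operator (surface_map A B) K f) \<le> ennreal (b powr (1/4)) * Lp_norm p (lebesgue_on K) f"
    \<comment> \<open>Normalization is impossible when the norm vanishes, but then f vanishes almost
      everywhere and so does its extension identically.\<close>
    proof (cases "n = 0")
      case True
      have "AE x in lebesgue_on K. f x = 0" using Lp_norm_eq_0D[OF p0 f] n True by simp
      then have "AE x in lebesgue. x \<in> K \<longrightarrow> f x = 0"
        using Kb by (subst (asm) AE_restrict_space_iff) auto
      then have "AE x in lborel. x \<in> K \<longrightarrow> f x = 0" by (simp add: AE_completion_iff)
      then have g_0: "AE x in lborel. g x = 0" using ae by eventually_elim (auto simp: indicator_def split: if_splits)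
      have "extension_operator (surface_map A B) K f x = 0" for x
        unfolding Eg by (intro integral_eq_zero_AE) (use g_0 in eventually_elim, simp)
      then show ?thesis using Lp4[of 0 "extension_operator (surface_map A B) K f"] by simp
    next
      case False
      then have n0: "0 < n" using n by simp
      define g' where "g' x = g x / of_real n" for x
      have [measurable]: "g' \<in> borel_measurable borel" unfolding g'_def by measurable
      have sp: "emeasure (lebesgue_on K) (space (lebesgue_on K)) = emeasure lborel K"
        using Kb by (simp add: emeasure_restrict_space)
      have "(\<integral>\<^sup>+x. ennreal (norm (g' x) powr (2 * s)) \<partial>lborel) = (\<integral>\<^sup>+x. ennreal ((norm (f x) / n) powr (2 * s)) * indicator K x \<partial>lebesgue)"
        unfolding nn_integral_completion
      proof (rule nn_integral_cong_AE, use ae in eventually_elim)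
        case (elim x)
        then show ?case using g0[of x] n0 by (cases "x \<in> K") (auto simp: g'_def norm_divide)
      qed
      also have "\<dots> = (\<integral>\<^sup>+x. ennreal ((norm (f x) / n) powr (2 * s)) \<partial>lebesgue_on K)"
        using Kb by (subst nn_integral_restrict_space) auto
      also have "\<dots> \<le> emeasure lborel K + 1"
        using Lp_norm_normalized_moment[OF _ p f n(1) n0] s unfolding sp by simp
      finally have mom: "(\<integral>\<^sup>+x. ennreal (norm (g' x) powr (2 * s)) \<partial>lborel) \<le> emeasure lborel K + 1" .
      \<comment> \<open>Pointwise, |g'| is at most the indicator of K plus |g'|^(2s): compare with 1
        and use 2s \<ge> 1.\<close>
      have int: "integrable lborel g'"
      proof (rule integrableI_bounded)
        have "(\<integral>\<^sup>+x. ennreal (norm (g' x)) \<partial>lborel) \<le> (\<integral>\<^sup>+x. indicator K x + ennreal (norm (g' x) powr (2 * s)) \<partial>lborel)"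
        proof (rule nn_integral_mono)
          fix x
          show "ennreal (norm (g' x)) \<le> indicator K x + ennreal (norm (g' x) powr (2 * s))"
          proof (cases "norm (g' x) \<le> 1")
            case True
            then show ?thesis
              by (cases "x \<in> K") (auto simp: g0 g'_def add_increasing2)
          next
            case False
            then have "norm (g' x) powr 1 \<le> norm (g' x) powr (2 * s)" using s by (intro powr_mono) auto
            then show ?thesis using False by (intro add_increasing ennreal_leI) auto
          qed
        qed
        also have "\<dots> = emeasure lborel K + (\<integral>\<^sup>+x. ennreal (norm (g' x) powr (2 * s)) \<partial>lborel)"
          by (subst nn_integral_add) auto
        also have "\<dots> < \<infinity>" using fin le_less_trans[OF mom fin] by simp
        finally show "(\<integral>\<^sup>+x. ennreal (norm (g' x)) \<partial>lborel) < \<infinity>" .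
      qed simp
      have "extension_operator (surface_map A B) K f x = of_real n * (LINT \<xi>|lborel. exp (\<i> * of_real (x \<bullet> join5 \<xi> (quadratic_pair A B \<xi>))) * g' \<xi>)" for x
      proof -
        have "(\<lambda>\<xi>. exp (\<i> * of_real (x \<bullet> surface_map A B \<xi>)) * g \<xi>) =
          (\<lambda>\<xi>. of_real n * (exp (\<i> * of_real (x \<bullet> join5 \<xi> (quadratic_pair A B \<xi>))) * g' \<xi>))"
          using n0 by (simp add: fun_eq_iff g'_def surface_map_eq)
        then show ?thesis unfolding Eg by (simp only: integral_mult_right_zero)
      qed
      then have "(\<integral>\<^sup>+x. ennreal (norm (extension_operator (surface_map A B) K f x) ^ 4) \<partial>lborel) =
        (\<integral>\<^sup>+x. ennreal (n ^ 4) * ennreal (norm (LINT \<xi>|lborel. exp (\<i> * of_real (x \<bullet> join5 \<xi> (quadratic_pair A B \<xi>))) * g' \<xi>) ^ 4) \<partial>lborel)"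
        using n0 by (simp add: norm_mult power_mult_distrib ennreal_mult)
      also have "\<dots> = ennreal (n ^ 4) * (\<integral>\<^sup>+x. ennreal (norm (LINT \<xi>|lborel. exp (\<i> * of_real (x \<bullet> join5 \<xi> (quadratic_pair A B \<xi>))) * g' \<xi>) ^ 4) \<partial>lborel)"
        by (rule nn_integral_cmult) measurable
      also have "\<dots> \<le> ennreal (n ^ 4) * ennreal b"
        by (intro mult_left_mono order_trans[OF bound b(2)] int mom) (auto simp: g'_def g0)
      also have "\<dots> = ennreal ((b powr (1/4) * n) ^ 4)"
        using b n0 by (simp add: power_mult_distrib powr_powr ennreal_mult[symmetric] mult.commute flip: powr_numeral)
      finally have "Lp_norm 4 lebesgue (extension_operator (surface_map A B) K f) \<le> ennreal (b powr (1/4) * n)"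
        using n0 by (intro Lp4) auto
      then show ?thesis using n by (simp add: ennreal_mult)
    qed
  qed
qed

subsection \<open>Knapp examples\<close>

lemma norm_iexp_diff_le: "norm (exp (\<i> * of_real a) - exp (\<i> * of_real b)) \<le> \<bar>a - b\<bar>"
proof -
  have "exp (\<i> * of_real a) - exp (\<i> * of_real b) = exp (\<i> * of_real b) * (exp (\<i> * of_real (a - b)) - 1)"
    by (simp add: right_diff_distrib exp_diff)
  then have "norm (exp (\<i> * of_real a) - exp (\<i> * of_real b)) = norm (exp (\<i> * of_real (a - b)) - 1)"
    by (simp only: norm_mult norm_exp_i_times mult_1)
  also have "\<dots> \<le> \<bar>a - b\<bar>" using iexp_approx1[of "a - b" 0] by simp
  finally show ?thesis .
qed

text \<open>The exponential is 1-Lipschitz in the phase, so on T the integrand stays within 1/2 of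
  the constant exp(i \<theta>), whose integral over T has modulus m.\<close>

lemma norm_indicator_extension_ge:
  fixes \<Sigma> :: "'a::euclidean_space \<Rightarrow> 'b::euclidean_space"
  assumes T: "T \<in> sets borel" "emeasure lborel T = ennreal m" "0 \<le> m"
    and [measurable]: "\<Sigma> \<in> borel_measurable borel"
    and small: "\<And>\<xi>. \<xi> \<in> T \<Longrightarrow> \<bar>x \<bullet> \<Sigma> \<xi> - \<theta>\<bar> \<le> 1/2"
  shows "m / 2 \<le> norm (LINT \<xi>|lborel. exp (\<i> * of_real (x \<bullet> \<Sigma> \<xi>)) * indicator T \<xi>)"
proof -
  have [measurable]: "T \<in> sets borel" by fact
  have ind: "indicator T = (\<lambda>x. complex_of_real (indicator T x))"
    by (auto simp: indicator_def fun_eq_iff)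
  have iT2: "integrable lborel (indicator T :: 'a \<Rightarrow> real)"
    using T by (intro integrable_real_indicator) auto
  then have iT1: "integrable lborel (indicator T :: 'a \<Rightarrow> complex)"
    unfolding ind by (rule integrable_of_real)
  note iT = iT1 iT2
  have m: "measure lborel T = m" using T by (simp add: measure_def)
  let ?E = "LINT \<xi>|lborel. exp (\<i> * of_real (x \<bullet> \<Sigma> \<xi>)) * indicator T \<xi>"
  have i1: "integrable lborel (\<lambda>\<xi>. exp (\<i> * of_real (x \<bullet> \<Sigma> \<xi>)) * indicator T \<xi>)"
    by (rule Bochner_Integration.integrable_bound[OF iT(1)]) (auto simp: norm_mult)
  have "(LINT \<xi>|lborel. exp (\<i> * of_real \<theta>) * indicator T \<xi>) = exp (\<i> * of_real \<theta>) * of_real m"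
    unfolding ind using m by simp
  then have "?E - exp (\<i> * of_real \<theta>) * of_real m =
      (LINT \<xi>|lborel. exp (\<i> * of_real (x \<bullet> \<Sigma> \<xi>)) * indicator T \<xi> - exp (\<i> * of_real \<theta>) * indicator T \<xi>)"
    using i1 iT by (subst Bochner_Integration.integral_diff) auto
  also have "norm \<dots> \<le> (LINT \<xi>|lborel. norm (exp (\<i> * of_real (x \<bullet> \<Sigma> \<xi>)) * indicator T \<xi> - exp (\<i> * of_real \<theta>) * indicator T \<xi>))"
    by (rule integral_norm_bound)
  also have "\<dots> \<le> (LINT \<xi>|lborel. 1/2 * indicator T \<xi>)"
  proof (rule Bochner_Integration.integral_mono)
    fix \<xi>
    show "norm (exp (\<i> * of_real (x \<bullet> \<Sigma> \<xi>)) * indicator T \<xi> - exp (\<i> * of_real \<theta>) * indicator T \<xi>) \<le> 1/2 * indicator T \<xi>"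
      using norm_iexp_diff_le[of "x \<bullet> \<Sigma> \<xi>" \<theta>] small[of \<xi>] by (cases "\<xi> \<in> T") auto
  qed (use i1 iT in auto)
  also have "\<dots> = m / 2" using m by simp
  finally have "norm (?E - exp (\<i> * of_real \<theta>) * of_real m) \<le> m / 2" .
  moreover have "norm (exp (\<i> * of_real \<theta>) * of_real m) = m"
    using T(3) by (simp add: norm_mult)
  ultimately show ?thesis
    using norm_triangle_ineq4[of ?E "?E - exp (\<i> * of_real \<theta>) * of_real m"] by simp
qed

text \<open>The middle term is the gradient of the form at x paired with z. In the Knapp example it
  is compensated by a shear of the physical variables.\<close>

lemma quadratic_form_add:
  "quadratic_form A (x + z) = quadratic_form A x + (A *v x + transpose A *v x) \<bullet> z + quadratic_form A z"
  by (simp add: quadratic_form_def matrix_vector_right_distrib inner_add_left inner_add_right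
      transpose_matrix_vector dot_lmul_matrix inner_commute[of z "A *v x"])

text \<open>The phase \<open>x \<bullet> \<Sigma>(\<xi>)\<close> varies by at most \<open>1/2\<close> on the box \<open>T\<close> when \<open>x\<close> lies in the preimage of
  \<open>D3 \<times> D2\<close> under a linear map that does not depend on \<open>\<delta>\<close>, so that \<open>|E1\<^sub>T(x)| \<ge> |T| / 2\<close> there.\<close>

lemma knapp_lower_bound:
  fixes M1 :: "real^3^3" and M2 :: "real^2^2" and a :: "3 \<Rightarrow> nat" and b :: "2 \<Rightarrow> nat"
  assumes M1: "invertible M1" and M2: "invertible M2"
    and eq: "\<And>v. \<phi> v = M2 *v quadratic_pair A B (M1 *v v)"
    and small: "\<And>\<delta> v k. 0 < \<delta> \<Longrightarrow> \<delta> \<le> 1 \<Longrightarrow> (\<And>i. \<bar>v $ i\<bar> \<le> \<delta> ^ a i) \<Longrightarrow> \<bar>\<phi> v $ k\<bar> \<le> 2 * \<delta> ^ b k"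
    and \<rho>: "0 < \<rho>" "\<rho> \<le> 1"
  obtains c1 c2 where "0 < c1" "0 < c2"
    "\<And>\<delta>. 0 < \<delta> \<Longrightarrow> \<delta> \<le> 1 \<Longrightarrow> \<exists>T. compact T \<and> T \<subseteq> (\<lambda>v. \<zeta> + M1 *v v) ` {v. \<forall>i. \<bar>v $ i\<bar> \<le> \<rho>} \<and>
      emeasure lborel T = ennreal (c1 * \<delta> ^ sum a UNIV) \<and>
      ennreal (c2 * (\<delta> ^ (3 * sum a UNIV) / \<delta> ^ sum b UNIV)) \<le>
        (\<integral>\<^sup>+x. ennreal (norm (LINT \<xi>|lborel. exp (\<i> * of_real (x \<bullet> surface_map A B \<xi>)) * indicator T \<xi>) ^ 4) \<partial>lborel)"
proof -
  obtain P where P: "M2 ** P = mat 1" "P ** M2 = mat 1" using M2 invertible_def by blast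
  have PM: "quadratic_pair A B (M1 *v v) = P *v \<phi> v" for v
    by (simp add: eq matrix_vector_mul_assoc P)
  have invPt: "invertible (transpose P)" using P invertible_def transpose_invertible by blast
  have invM1t: "invertible (transpose M1)" using M1 transpose_invertible by blast
  have d1: "det M1 \<noteq> 0" using M1 invertible_det_nz by blast
  have dP: "det (transpose P) \<noteq> 0" using invPt invertible_det_nz by blast
  define N where "N = sum a UNIV"
  define \<beta> where "\<beta> = sum b UNIV"
  define c1 where "c1 = \<bar>det M1\<bar> * (2 * \<rho>) ^ 3"
  \<comment> \<open>\<open>c3\<close> collects the delta-free part of the measure of the set of good
    x: the boxes \<open>D3\<close> and \<open>D2\<close> below have sides (1/6) / \<delta>^(a_i) and
    (1/8) / \<delta>^(b_k), and the determinants come from the linear change of variables.\<close>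
  define c3 where "c3 = 1 / \<bar>det (transpose M1)\<bar> * (1/6) ^ 3 * (1 / \<bar>det (transpose P)\<bar> * (1/8) ^ 2)"
  define c2 where "c2 = (c1 / 2) ^ 4 * c3"
  have c1: "0 < c1" using d1 \<rho> by (simp add: c1_def)
  have c3: "0 < c3" using d1 dP by (simp add: c3_def det_transpose)
  have c2: "0 < c2" using c1 c3 by (simp add: c2_def)
  have [measurable]: "surface_map A B \<in> borel_measurable borel"
    unfolding surface_map_eq[abs_def] by measurable
  \<comment> \<open>The gradients of the forms at the base point \<zeta>, pulled back to the box
    coordinates: with this shift, \<open>w t + transpose M1 *v s\<close> is the full linear
    coefficient of the phase in v.\<close>
  define w where "w t = transpose M1 *v (t $ 1 *\<^sub>R (A *v \<zeta> + transpose A *v \<zeta>) + t $ 2 *\<^sub>R (B *v \<zeta> + transpose B *v \<zeta>))" for t :: "real^2"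
  have phase: "join5 s t \<bullet> surface_map A B (\<zeta> + M1 *v v) - join5 s t \<bullet> surface_map A B \<zeta> =
      (w t + transpose M1 *v s) \<bullet> v + (transpose P *v t) \<bullet> \<phi> v" for s t v
  proof -
    have j: "join5 s t \<bullet> surface_map A B \<xi> = s \<bullet> \<xi> + (t $ 1 * quadratic_form A \<xi> + t $ 2 * quadratic_form B \<xi>)" for \<xi>
      by (simp add: inner_vec_def sum_UNIV_5 sum_3 surface_map_def)
    have t: "(transpose P *v t) \<bullet> \<phi> v = t $ 1 * quadratic_form A (M1 *v v) + t $ 2 * quadratic_form B (M1 *v v)"
    proof -
      have "(transpose P *v t) \<bullet> \<phi> v = t \<bullet> quadratic_pair A B (M1 *v v)"
        by (simp add: PM transpose_matrix_vector dot_lmul_matrix)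
      then show ?thesis by (simp add: inner_vec_def sum_2 quadratic_pair_def)
    qed
    have tr: "(transpose M1 *v y) \<bullet> v = y \<bullet> (M1 *v v)" for y
      by (simp add: transpose_matrix_vector dot_lmul_matrix)
    show ?thesis
      unfolding j t w_def inner_add_left tr quadratic_form_add
      by (simp add: inner_add_left inner_add_right algebra_simps)
  qed
  show thesis
  proof (rule that[OF c1 c2])
    fix \<delta> :: real assume \<delta>: "0 < \<delta>" "\<delta> \<le> 1"
    define X where "X = {v::real^3. \<forall>i. \<bar>v $ i\<bar> \<le> \<rho> * \<delta> ^ a i}"
    define T where "T = (\<lambda>v. \<zeta> + M1 *v v) ` X"
    \<comment> \<open>The constants split the allowed phase variation 1/2: three linear terms
      contribute at most 1/12 each, and two quadratic ones at most 2/16 each, the 2 being the factor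
      in \<open>small\<close>.\<close>
    define D3 where "D3 = {y::real^3. \<forall>i. \<bar>y $ i\<bar> \<le> 1/12 * (1 / \<delta> ^ a i)}"
    define D2 where "D2 = {y::real^2. \<forall>k. \<bar>y $ k\<bar> \<le> 1/16 * (1 / \<delta> ^ b k)}"
    have [measurable]: "X \<in> sets borel" "D3 \<in> sets borel" "D2 \<in> sets borel"
      unfolding X_def D3_def D2_def by (intro borel_closed compact_imp_closed symmetric_box_compact)+
    have "compact X" unfolding X_def by (rule symmetric_box_compact)
    then have Tc: "compact T"
      unfolding T_def by (intro compact_continuous_image continuous_intros matrix_vector_mult_linear_continuous_on)
    then have [measurable]: "T \<in> sets borel" by (simp add: borel_closed compact_imp_closed)
    have Tsub: "T \<subseteq> (\<lambda>v. \<zeta> + M1 *v v) ` {v. \<forall>i. \<bar>v $ i\<bar> \<le> \<rho>}"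
    proof -
      have "\<rho> * \<delta> ^ a i \<le> \<rho>" for i using \<delta> \<rho> by (simp add: power_le_one mult_left_le)
      then show ?thesis unfolding T_def X_def by (intro image_mono) (auto intro: order_trans)
    qed
    have T: "emeasure lborel T = ennreal (c1 * \<delta> ^ N)"
    proof -
      have inj: "\<zeta> + M1 *v v \<in> T \<longleftrightarrow> v \<in> X" for v
        by (auto simp: T_def dest: injD[OF inj_matrix_vector_mult[OF M1]])
      have "emeasure lborel T = (\<integral>\<^sup>+\<xi>. indicator T \<xi> \<partial>lborel)" by simp
      also have "\<dots> = (\<integral>\<^sup>+z. indicator T (\<zeta> + z) \<partial>lborel)"
        by (rule nn_integral_lborel_translate[symmetric]) measurable
      also have "\<dots> = ennreal \<bar>det M1\<bar> * (\<integral>\<^sup>+v. indicator T (\<zeta> + M1 *v v) \<partial>lborel)"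
        by (rule nn_integral_linear[OF M1]) measurable
      also have "(\<integral>\<^sup>+v. indicator T (\<zeta> + M1 *v v) \<partial>lborel) = (\<integral>\<^sup>+v. indicator X v \<partial>lborel)"
        by (simp add: indicator_def inj)
      also have "\<dots> = emeasure lborel X" by simp
      also have "\<dots> = ennreal (\<Prod>i\<in>UNIV. 2 * (\<rho> * \<delta> ^ a i))"
        unfolding X_def by (rule emeasure_symmetric_box) (use \<rho> \<delta> in auto)
      also have "(\<Prod>i\<in>UNIV. 2 * (\<rho> * \<delta> ^ a i)) = (2 * \<rho>) ^ 3 * \<delta> ^ N"
        by (simp add: N_def power_sum prod.distrib mult.assoc[symmetric] power_mult_distrib)
      also have "ennreal \<bar>det M1\<bar> * ennreal ((2 * \<rho>) ^ 3 * \<delta> ^ N) = ennreal (c1 * \<delta> ^ N)"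
        using \<rho> \<delta> by (subst ennreal_mult[symmetric]) (auto simp: c1_def mult.assoc)
      finally show ?thesis .
    qed
    define F where "F x = (LINT \<xi>|lborel. exp (\<i> * of_real (x \<bullet> surface_map A B \<xi>)) * indicator T \<xi>)" for x
    have [measurable]: "F \<in> borel_measurable borel" unfolding F_def by measurable
    have lower: "c1 * \<delta> ^ N / 2 \<le> norm (F (join5 s t))"
      if s: "w t + transpose M1 *v s \<in> D3" and t: "transpose P *v t \<in> D2" for s t
      unfolding F_def
    proof (rule norm_indicator_extension_ge[OF _ T])
      fix \<xi> assume "\<xi> \<in> T"
      then obtain v where v: "\<xi> = \<zeta> + M1 *v v" "v \<in> X" by (auto simp: T_def)
      have v1: "\<bar>v $ i\<bar> \<le> \<delta> ^ a i" for i
      proof -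
        have "\<bar>v $ i\<bar> \<le> \<rho> * \<delta> ^ a i" using v by (simp add: X_def)
        also have "\<dots> \<le> 1 * \<delta> ^ a i" using \<rho> \<delta> by (intro mult_right_mono) auto
        finally show ?thesis by simp
      qed
      have "\<bar>(w t + transpose M1 *v s) $ i * v $ i\<bar> \<le> 1/12" for i
      proof -
        have "\<bar>(w t + transpose M1 *v s) $ i * v $ i\<bar> \<le> (1/12 * (1 / \<delta> ^ a i)) * \<delta> ^ a i"
          unfolding abs_mult using s v1 \<delta> by (intro mult_mono) (auto simp: D3_def)
        then show ?thesis using \<delta> by simp
      qed
      then have 1: "\<bar>(w t + transpose M1 *v s) \<bullet> v\<bar> \<le> 1/12 + 1/12 + 1/12"
        unfolding inner_vec_def sum_3 inner_real_def by (intro order_trans[OF abs_triangle_ineq] add_mono)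
      have "\<bar>(transpose P *v t) $ k * \<phi> v $ k\<bar> \<le> 1/8" for k
      proof -
        have "\<bar>(transpose P *v t) $ k * \<phi> v $ k\<bar> \<le> (1/16 * (1 / \<delta> ^ b k)) * (2 * \<delta> ^ b k)"
          unfolding abs_mult using t small[OF \<delta> v1] \<delta> by (intro mult_mono) (auto simp: D2_def)
        then show ?thesis using \<delta> by simp
      qed
      then have 2: "\<bar>(transpose P *v t) \<bullet> \<phi> v\<bar> \<le> 1/8 + 1/8"
        unfolding inner_vec_def sum_2 inner_real_def by (intro order_trans[OF abs_triangle_ineq] add_mono)
      show "\<bar>join5 s t \<bullet> surface_map A B \<xi> - join5 s t \<bullet> surface_map A B \<zeta>\<bar> \<le> 1/2"
        unfolding v(1) phase using 1 2 by linarith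
    qed (use c1 \<delta> in auto)
    \<comment> \<open>The fourth power of the amplitude, of order \<delta>^(4N), times the measure
      of the set of good x, of order \<delta>^(-N-\<beta>), has order \<delta>^(3N-\<beta>).\<close>
    have "ennreal (c2 * (\<delta> ^ (3 * N) / \<delta> ^ \<beta>)) = ennreal ((c1 * \<delta> ^ N / 2) ^ 4) * ennreal (c3 * (1 / \<delta> ^ N * (1 / \<delta> ^ \<beta>)))"
    proof -
      have d3: "\<delta> ^ (3 * N) = \<delta> ^ N * \<delta> ^ N * \<delta> ^ N"
        by (simp add: mult.commute[of 3] power_mult power3_eq_cube)
      have "c2 * (\<delta> ^ (3 * N) / \<delta> ^ \<beta>) = (c1 * \<delta> ^ N / 2) ^ 4 * (c3 * (1 / \<delta> ^ N * (1 / \<delta> ^ \<beta>)))"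
        unfolding c2_def d3 using \<delta> by (simp add: field_simps power4_eq_xxxx)
      moreover have "ennreal ((c1 * \<delta> ^ N / 2) ^ 4 * (c3 * (1 / \<delta> ^ N * (1 / \<delta> ^ \<beta>)))) =
          ennreal ((c1 * \<delta> ^ N / 2) ^ 4) * ennreal (c3 * (1 / \<delta> ^ N * (1 / \<delta> ^ \<beta>)))"
        by (rule ennreal_mult) (use c1 c3 \<delta> in auto)
      ultimately show ?thesis by (simp only:)
    qed
    \<comment> \<open>Integrating over s first makes the shift \<open>w t\<close> a mere
      translation, so the measure of the sheared set is that of a product.\<close>
    also have "ennreal (c3 * (1 / \<delta> ^ N * (1 / \<delta> ^ \<beta>))) = (\<integral>\<^sup>+t. \<integral>\<^sup>+s. indicator D3 (w t + transpose M1 *v s) * indicator D2 (transpose P *v t) \<partial>lborel \<partial>lborel)"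
    proof -
      have "(\<integral>\<^sup>+s. indicator D3 (w t + transpose M1 *v s) * indicator D2 (transpose P *v t) \<partial>lborel) =
        ennreal (1 / \<bar>det (transpose M1)\<bar>) * emeasure lborel D3 * indicator D2 (transpose P *v t)" for t
      proof -
        have "(\<integral>\<^sup>+s. indicator D3 (w t + transpose M1 *v s) * indicator D2 (transpose P *v t) \<partial>lborel) =
          (\<integral>\<^sup>+s. indicator D3 (w t + transpose M1 *v s) \<partial>lborel) * indicator D2 (transpose P *v t)"
          by (rule nn_integral_multc) measurable
        also have "(\<integral>\<^sup>+s. indicator D3 (w t + transpose M1 *v s) \<partial>lborel) = ennreal (1 / \<bar>det (transpose M1)\<bar>) * (\<integral>\<^sup>+s. indicator D3 (w t + s) \<partial>lborel)"
          by (rule nn_integral_linear_image[OF invM1t]) measurable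
        also have "(\<integral>\<^sup>+s. indicator D3 (w t + s) \<partial>lborel) = (\<integral>\<^sup>+s. indicator D3 s \<partial>lborel)"
          by (rule nn_integral_lborel_translate) measurable
        finally show ?thesis by simp
      qed
      then have "(\<integral>\<^sup>+t. \<integral>\<^sup>+s. indicator D3 (w t + transpose M1 *v s) * indicator D2 (transpose P *v t) \<partial>lborel \<partial>lborel) =
        (\<integral>\<^sup>+t. ennreal (1 / \<bar>det (transpose M1)\<bar>) * emeasure lborel D3 * indicator D2 (transpose P *v t) \<partial>lborel)"
        by simp
      also have "\<dots> = ennreal (1 / \<bar>det (transpose M1)\<bar>) * emeasure lborel D3 * (\<integral>\<^sup>+t. indicator D2 (transpose P *v t) \<partial>lborel)"
        by (rule nn_integral_cmult) measurable
      also have "(\<integral>\<^sup>+t. indicator D2 (transpose P *v t) \<partial>lborel) = ennreal (1 / \<bar>det (transpose P)\<bar>) * (\<integral>\<^sup>+t. indicator D2 t \<partial>lborel)"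
        by (rule nn_integral_linear_image[OF invPt]) measurable
      also have "(\<integral>\<^sup>+t. indicator D2 t \<partial>lborel) = emeasure lborel D2" by simp
      also have "emeasure lborel D2 = ennreal (\<Prod>k\<in>UNIV. 2 * (1/16 * (1 / \<delta> ^ b k)))"
        unfolding D2_def by (rule emeasure_symmetric_box) (use \<delta> in auto)
      also have "(\<Prod>k\<in>UNIV. 2 * (1/16 * (1 / \<delta> ^ b k))) = (1/8)\<^sup>2 * (1 / \<delta> ^ \<beta>)"
        by (simp add: \<beta>_def power_sum prod.distrib prod_dividef power_divide)
      also have "emeasure lborel D3 = ennreal (\<Prod>k\<in>UNIV. 2 * (1/12 * (1 / \<delta> ^ a k)))"
        unfolding D3_def by (rule emeasure_symmetric_box) (use \<delta> in auto)
      also have "(\<Prod>k\<in>UNIV. 2 * (1/12 * (1 / \<delta> ^ a k))) = (1/6) ^ 3 * (1 / \<delta> ^ N)"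
        by (simp add: N_def power_sum prod.distrib prod_dividef power_divide)
      also have "ennreal (1 / \<bar>det (transpose M1)\<bar>) * ennreal ((1/6) ^ 3 * (1 / \<delta> ^ N)) *
        (ennreal (1 / \<bar>det (transpose P)\<bar>) * ennreal ((1/8)\<^sup>2 * (1 / \<delta> ^ \<beta>))) =
        ennreal ((1 / \<bar>det (transpose M1)\<bar> * ((1/6) ^ 3 * (1 / \<delta> ^ N))) * (1 / \<bar>det (transpose P)\<bar> * ((1/8)\<^sup>2 * (1 / \<delta> ^ \<beta>))))"
        using \<delta> by (subst (1 2 3) ennreal_mult) auto
      also have "(1 / \<bar>det (transpose M1)\<bar> * ((1/6) ^ 3 * (1 / \<delta> ^ N))) * (1 / \<bar>det (transpose P)\<bar> * ((1/8)\<^sup>2 * (1 / \<delta> ^ \<beta>))) =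
        c3 * (1 / \<delta> ^ N * (1 / \<delta> ^ \<beta>))"
        unfolding c3_def by (simp only: mult_ac)
      finally show ?thesis ..
    qed
    also have "ennreal ((c1 * \<delta> ^ N / 2) ^ 4) * (\<integral>\<^sup>+t. \<integral>\<^sup>+s. indicator D3 (w t + transpose M1 *v s) * indicator D2 (transpose P *v t) \<partial>lborel \<partial>lborel) =
      (\<integral>\<^sup>+t. \<integral>\<^sup>+s. ennreal ((c1 * \<delta> ^ N / 2) ^ 4) * (indicator D3 (w t + transpose M1 *v s) * indicator D2 (transpose P *v t)) \<partial>lborel \<partial>lborel)"
    proof -
      have [measurable]: "w \<in> borel_measurable borel"
        unfolding w_def
        by (rule measurable_compose[OF _ borel_measurable_matrix_vector_mult]) measurable
      show ?thesis by (subst nn_integral_cmult[symmetric], measurable, intro nn_integral_cong nn_integral_cmult[symmetric]) measurable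
    qed
    also have "\<dots> \<le> (\<integral>\<^sup>+t. \<integral>\<^sup>+s. ennreal (norm (F (join5 s t)) ^ 4) \<partial>lborel \<partial>lborel)"
    proof (intro nn_integral_mono)
      fix t s
      show "ennreal ((c1 * \<delta> ^ N / 2) ^ 4) * (indicator D3 (w t + transpose M1 *v s) * indicator D2 (transpose P *v t)) \<le> ennreal (norm (F (join5 s t)) ^ 4)"
        using lower[of t s] c1 \<delta> by (auto simp: indicator_def intro!: ennreal_leI power_mono)
    qed
    also have "\<dots> = (\<integral>\<^sup>+s. \<integral>\<^sup>+t. ennreal (norm (F (join5 s t)) ^ 4) \<partial>lborel \<partial>lborel)"
      by (rule nn_integral_swap) (simp add: borel_prod[symmetric] split_beta')
    also have "\<dots> = (\<integral>\<^sup>+x. ennreal (norm (F x) ^ 4) \<partial>lborel)"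
      by (rule nn_integral_join5[symmetric]) measurable
    finally show "\<exists>T. compact T \<and> T \<subseteq> (\<lambda>v. \<zeta> + M1 *v v) ` {v. \<forall>i. \<bar>v $ i\<bar> \<le> \<rho>} \<and>
      emeasure lborel T = ennreal (c1 * \<delta> ^ sum a UNIV) \<and>
      ennreal (c2 * (\<delta> ^ (3 * sum a UNIV) / \<delta> ^ sum b UNIV)) \<le>
        (\<integral>\<^sup>+x. ennreal (norm (LINT \<xi>|lborel. exp (\<i> * of_real (x \<bullet> surface_map A B \<xi>)) * indicator T \<xi>) ^ 4) \<partial>lborel)"
      unfolding F_def N_def[symmetric] \<beta>_def[symmetric] using Tc Tsub T by blast
  qed
qed

lemma no_uniform_power_bound:
  fixes \<kappa> C e :: real
  assumes "0 < \<kappa>" "0 \<le> C" "0 < e" and bound: "\<And>\<delta>. 0 < \<delta> \<Longrightarrow> \<delta> \<le> 1 \<Longrightarrow> \<kappa> \<le> C * \<delta> powr e"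
  shows False
proof -
  \<comment> \<open>Chosen so that C * \<eta> \<le> \<kappa> / 2 and \<eta> \<le> 1/2; \<delta> is
    then the e-th root of \<eta>.\<close>
  define \<eta> where "\<eta> = \<kappa> / (2 * C + 2 * \<kappa>)"
  have \<eta>: "0 < \<eta>" "\<eta> \<le> 1" using assms by (auto simp: \<eta>_def field_simps)
  define \<delta> where "\<delta> = \<eta> powr (1 / e)"
  have "\<delta> powr e = \<eta>" using \<eta> assms by (simp add: \<delta>_def powr_powr)
  moreover have "0 < \<delta>" "\<delta> \<le> 1" using \<eta> assms by (auto simp: \<delta>_def intro!: powr_le1)
  ultimately have "\<kappa> \<le> C * \<eta>" using bound[of \<delta>] by simp
  then have "\<kappa> * (2 * C + 2 * \<kappa>) \<le> C * \<kappa>" using assms by (simp add: \<eta>_def field_simps)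
  also have "C * \<kappa> = \<kappa> * C" by (rule mult.commute)
  finally have "2 * C + 2 * \<kappa> \<le> C" using assms(1) by (simp only: mult_le_cancel_left_pos)
  then show False using assms by simp
qed

text \<open>Testing the estimate on the box indicators gives, up to constants, \<delta>^(3N-\<beta>)
  \<le> \<delta>^(4N/p) for all \<delta> in (0, 1], where N and \<beta> are the sums of the a_i and
  b_k. The condition on p says 3N - \<beta> < 4N/p, which is contradictory as \<delta> tends to
  0.\<close>

theorem restriction_estimate_knapp_failure:
  fixes M1 :: "real^3^3" and M2 :: "real^2^2" and a :: "3 \<Rightarrow> nat" and b :: "2 \<Rightarrow> nat"
  assumes K: "compact K" "interior K \<noteq> {}"
    and M1: "invertible M1" and M2: "invertible M2"
    and eq: "\<And>v. \<phi> v = M2 *v quadratic_pair A B (M1 *v v)"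
    and small: "\<And>\<delta> v k. 0 < \<delta> \<Longrightarrow> \<delta> \<le> 1 \<Longrightarrow> (\<And>i. \<bar>v $ i\<bar> \<le> \<delta> ^ a i) \<Longrightarrow> \<bar>\<phi> v $ k\<bar> \<le> 2 * \<delta> ^ b k"
    and p: "1 \<le> p" "p < \<infinity>" "enn2real p * (3 * real (sum a UNIV) - real (sum b UNIV)) < 4 * real (sum a UNIV)"
  shows "\<not> restriction_estimate (surface_map A B) K p 4"
proof
  assume "restriction_estimate (surface_map A B) K p 4"
  then obtain C where C: "0 < C" and est: "\<And>f. f \<in> Lp_space p (lebesgue_on K) \<Longrightarrow>
      Lp_norm 4 lebesgue (extension_operator (surface_map A B) K f) \<le> ennreal C * Lp_norm p (lebesgue_on K) f"
    unfolding restriction_estimate_def by blast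
  define N where "N = sum a UNIV"
  define \<beta> where "\<beta> = sum b UNIV"
  define P where "P = enn2real p"
  have pP: "p = ennreal P" using p by (simp add: P_def)
  have P1: "1 \<le> P" using p(1) unfolding pP by (cases "0 \<le> P") (auto simp: ennreal_neg)
  obtain \<zeta> where "\<zeta> \<in> interior K" using K by blast
  then obtain r where r: "0 < r" "ball \<zeta> r \<subseteq> K" by (auto simp: mem_interior)
  obtain L where L: "0 < L" "\<And>v. norm (M1 *v v) \<le> L * norm v"
    using linear_bounded_pos[OF matrix_vector_mul_linear[of M1]] by blast
  \<comment> \<open>A vector with entries at most \<rho> has norm at most 3\<rho>, so its image
    under M1 has norm at most r / 2 and all boxes fit into one ball inside K.\<close>
  define \<rho> where "\<rho> = min 1 (r / (2 * (L * 3)))"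
  have \<rho>: "0 < \<rho>" "\<rho> \<le> 1" using r L by (auto simp: \<rho>_def)
  have sub: "(\<lambda>v. \<zeta> + M1 *v v) ` {v. \<forall>i. \<bar>v $ i\<bar> \<le> \<rho>} \<subseteq> K"
  proof safe
    fix v :: "real^3" assume v: "\<forall>i. \<bar>v $ i\<bar> \<le> \<rho>"
    have "norm v \<le> (\<Sum>i\<in>UNIV. \<bar>v $ i\<bar>)" by (rule norm_le_l1_cart)
    also have "\<dots> \<le> (\<Sum>i\<in>(UNIV::3 set). \<rho>)" using v by (intro sum_mono) auto
    also have "\<dots> = 3 * \<rho>" by simp
    finally have "norm (M1 *v v) \<le> L * (3 * \<rho>)" using L by (intro order_trans[OF L(2)] mult_left_mono) auto
    also have "\<dots> \<le> L * (3 * (r / (2 * (L * 3))))" using L unfolding \<rho>_def by (intro mult_left_mono) auto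
    also have "\<dots> < r" using r L by (simp add: field_simps)
    finally have "\<zeta> + M1 *v v \<in> ball \<zeta> r" by (simp add: dist_norm)
    then show "\<zeta> + M1 *v v \<in> K" using r by blast
  qed
  obtain c1 c2 where c: "0 < c1" "0 < c2" and knapp:
    "\<And>\<delta>. 0 < \<delta> \<Longrightarrow> \<delta> \<le> 1 \<Longrightarrow> \<exists>T. compact T \<and> T \<subseteq> (\<lambda>v. \<zeta> + M1 *v v) ` {v. \<forall>i. \<bar>v $ i\<bar> \<le> \<rho>} \<and>
      emeasure lborel T = ennreal (c1 * \<delta> ^ N) \<and>
      ennreal (c2 * (\<delta> ^ (3 * N) / \<delta> ^ \<beta>)) \<le>
        (\<integral>\<^sup>+x. ennreal (norm (LINT \<xi>|lborel. exp (\<i> * of_real (x \<bullet> surface_map A B \<xi>)) * indicator T \<xi>) ^ 4) \<partial>lborel)"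
    using knapp_lower_bound[where \<zeta> = \<zeta>, OF M1 M2 eq small \<rho>] unfolding N_def \<beta>_def by blast
  have Kb: "K \<in> sets borel" using K by (simp add: compact_imp_closed borel_closed)
  have S: "surface_map A B \<in> borel_measurable borel"
    unfolding surface_map_eq[abs_def] by measurable
  \<comment> \<open>The gap between the two powers of \<delta>; its positivity is the assumption on
    p divided by P.\<close>
  define e where "e = real N * 4 / P - (3 * real N - real \<beta>)"
  have e: "0 < e" using p(3) P1 unfolding e_def N_def[symmetric] \<beta>_def[symmetric] P_def[symmetric]
    by (simp add: field_simps)
  have "c2 \<le> (C ^ 4 * c1 powr (4 / P)) * \<delta> powr e" if \<delta>: "0 < \<delta>" "\<delta> \<le> 1" for \<delta>
  proof -
    from knapp[OF \<delta>] obtain T where T: "compact T" "T \<subseteq> (\<lambda>v. \<zeta> + M1 *v v) ` {v. \<forall>i. \<bar>v $ i\<bar> \<le> \<rho>}"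
        "emeasure lborel T = ennreal (c1 * \<delta> ^ N)" and
      low: "ennreal (c2 * (\<delta> ^ (3 * N) / \<delta> ^ \<beta>)) \<le>
        (\<integral>\<^sup>+x. ennreal (norm (LINT \<xi>|lborel. exp (\<i> * of_real (x \<bullet> surface_map A B \<xi>)) * indicator T \<xi>) ^ 4) \<partial>lborel)"
      by (elim exE conjE)
    have TK: "T \<subseteq> K" using T(2) sub by (rule order_trans)
    have Tb[measurable]: "T \<in> sets borel" using T(1) by (simp add: compact_imp_closed borel_closed)
    define f :: "real^3 \<Rightarrow> complex" where "f = indicator T"
    have fb: "f \<in> borel_measurable borel" unfolding f_def by measurable
    have "f \<in> borel_measurable lebesgue" using measurable_completion[of f lborel borel] fb by simp
    then have fm: "f \<in> borel_measurable (lebesgue_on K)" by (rule measurable_restrict_space1)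
    define m where "m = c1 * \<delta> ^ N"
    have m: "0 < m" using c \<delta> by (simp add: m_def)
    have "(\<integral>\<^sup>+x. ennreal (norm (f x) powr P) \<partial>lebesgue_on K) = (\<integral>\<^sup>+x. ennreal (norm (f x) powr P) * indicator K x \<partial>lebesgue)"
      by (rule nn_integral_restrict_space) (use Kb in auto)
    also have "\<dots> = (\<integral>\<^sup>+x. indicator T x \<partial>lborel)"
      unfolding nn_integral_completion by (intro nn_integral_cong) (use TK in \<open>auto simp: f_def indicator_def\<close>)
    also have "\<dots> = ennreal m" using T(3) by (simp add: m_def)
    finally have "Lp_norm p (lebesgue_on K) f = ennreal (m powr (1 / P))"
      using p(2)[unfolded less_top[symmetric] infinity_ennreal_def] m by (simp add: Lp_norm_def P_def[symmetric])
    then have est': "Lp_norm 4 lebesgue (extension_operator (surface_map A B) K f) \<le> ennreal (C * m powr (1 / P))"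
      using est[of f] fm C by (simp add: Lp_space_def ennreal_mult)
    have Ef: "extension_operator (surface_map A B) K f x = (LINT \<xi>|lborel. exp (\<i> * of_real (x \<bullet> surface_map A B \<xi>)) * indicator T \<xi>)" for x
    proof -
      have "indicator K \<xi> *\<^sub>R f \<xi> = f \<xi>" for \<xi>
        using TK by (auto simp: f_def indicator_def)
      then show ?thesis
        using extension_operator_eq_lborel[OF Kb fb S fm, of x] by (simp add: f_def)
    qed
    have "norm (extension_operator (surface_map A B) K f x) powr 4 = norm (extension_operator (surface_map A B) K f x) ^ 4" for x
      by (cases "extension_operator (surface_map A B) K f x = 0") simp_all
    then have I: "ennreal (c2 * (\<delta> ^ (3 * N) / \<delta> ^ \<beta>)) \<le> (\<integral>\<^sup>+x. ennreal (norm (extension_operator (surface_map A B) K f x) powr enn2real 4) \<partial>lebesgue)"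
      using low by (simp add: nn_integral_completion Ef)
    obtain J where J: "0 \<le> J" "(\<integral>\<^sup>+x. ennreal (norm (extension_operator (surface_map A B) K f x) powr enn2real 4) \<partial>lebesgue) = ennreal J"
      "Lp_norm 4 lebesgue (extension_operator (surface_map A B) K f) = ennreal (J powr (1 / enn2real 4))"
      using Lp_norm_finite_exponent[of 4 lebesgue "extension_operator (surface_map A B) K f"] le_less_trans[OF est'] by auto
    have "J powr (1 / 4) \<le> C * m powr (1 / P)"
      using est' C unfolding J(3) by (simp add: ennreal_le_iff)
    then have "(J powr (1 / 4)) ^ 4 \<le> (C * m powr (1 / P)) ^ 4" by (rule power_mono) simp
    moreover have "(J powr (1 / 4)) ^ 4 = J"
      using J(1) by (cases "J = 0") (simp_all add: powr_powr flip: powr_numeral)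
    moreover have "(C * m powr (1 / P)) ^ 4 = C ^ 4 * m powr (4 / P)"
      using m by (simp add: power_mult_distrib powr_powr flip: powr_numeral[of "m powr (1 / P)"])
    moreover have "m powr (4 / P) = c1 powr (4 / P) * \<delta> powr (real N * 4 / P)"
      using c \<delta> by (simp add: m_def powr_mult powr_powr flip: powr_realpow)
    moreover have "c2 * (\<delta> ^ (3 * N) / \<delta> ^ \<beta>) \<le> J"
      using I J by simp
    moreover have "\<delta> ^ (3 * N) / \<delta> ^ \<beta> = \<delta> powr (3 * real N - real \<beta>)"
      using \<delta> by (simp add: powr_diff flip: powr_realpow)
    ultimately have "c2 * \<delta> powr (3 * real N - real \<beta>) \<le> C ^ 4 * c1 powr (4 / P) * \<delta> powr (real N * 4 / P)"
      by simp
    also have "\<delta> powr (real N * 4 / P) = \<delta> powr e * \<delta> powr (3 * real N - real \<beta>)"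
      unfolding e_def powr_add[symmetric] by simp
    finally show ?thesis using \<delta> by (simp add: mult.assoc[symmetric])
  qed
  from no_uniform_power_bound[OF c(2) _ e this] show False using C by simp
qed

subsection \<open>The two cases\<close>

text \<open>Equivalence of forms supplies its own representing matrices, possibly other than A and
  B; only the values of the forms enter \<open>quadratic_pair\<close>, and these agree.\<close>

lemma equivalent_formsE:
  assumes "equivalent_forms (quadratic_form A, quadratic_form B) (P1, P2)"
  obtains M1 :: "real^3^3" and M2 :: "real^2^2" where "invertible M1" "invertible M2"
    "\<And>v. vector [P1 v, P2 v] = M2 *v quadratic_pair A B (M1 *v v)"
proof -
  obtain A0 B0 A' B' where "quadratic_form A = quadratic_form A0" "quadratic_form B = quadratic_form B0"
    "P1 = quadratic_form A'" "P2 = quadratic_form B'" "equivalent_pairs A0 B0 A' B'"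
    using assms unfolding equivalent_forms_def by auto
  then show thesis using that unfolding equivalent_pairs_def quadratic_pair_def by auto
qed

text \<open>The bilinear estimate works for exponents 2s \<le> 4 only. Below 4 take 2s = p; from 4
  on, including \<infinity>, take s = 2 and let the finite measure of K absorb the
  difference.\<close>

lemma ex_subcritical_exponent:
  assumes "ennreal p0 < p" "0 \<le> p0" "p0 < 4"
  obtains s where "p0 / 2 < s" "s \<le> 2" "ennreal (2 * s) \<le> p"
proof (cases "4 \<le> p")
  case True
  then show thesis using assms by (intro that[of 2]) auto
next
  case False
  then obtain P where P: "p = ennreal P" "0 \<le> P" by (cases p) auto
  with False have "P < 4" by (simp add: not_le flip: ennreal_numeral)
  then show thesis using assms P by (intro that[of "P / 2"]) (auto simp: ennreal_less_iff)
qed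

lemma enn2real_less:
  assumes "p < ennreal c" "0 < c"
  shows "p < \<infinity>" "enn2real p < c"
proof -
  show "p < \<infinity>" using assms less_trans[OF assms(1) ennreal_less_top] by simp
  then obtain P where "p = ennreal P" "0 \<le> P" by (cases p) auto
  then show "enn2real p < c" using assms by (simp add: ennreal_less_iff)
qed

text \<open>The box (\<delta>^2, \<delta>, 1) balances the two terms v_1 v_3 and v_2^2 at size
  \<delta>^2, while v_1 v_2 gains a third power. Thus N = 3 and \<beta> = 5, and p (3N - \<beta>) <
  4N reads p < 3.\<close>

lemma form1_anisotropic:
  fixes a :: "3 \<Rightarrow> nat" and b :: "2 \<Rightarrow> nat"
  defines "a \<equiv> \<lambda>i. if i = 1 then 2 else if i = 2 then 1 else 0" and "b \<equiv> \<lambda>k. if k = 1 then 3 else 2"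
  assumes \<delta>: "0 < \<delta>" and v: "\<And>i. \<bar>v $ i\<bar> \<le> \<delta> ^ a i"
  shows "\<bar>form1 v $ k\<bar> \<le> 2 * \<delta> ^ b k"
proof -
  have v': "\<bar>v $ 1\<bar> \<le> \<delta>\<^sup>2" "\<bar>v $ 2\<bar> \<le> \<delta>" "\<bar>v $ 3\<bar> \<le> 1"
    using v[of 1] v[of 2] v[of 3] by (auto simp: a_def)
  have "\<bar>v $ 1\<bar> * \<bar>v $ 2\<bar> \<le> \<delta>\<^sup>2 * \<delta>" "\<bar>v $ 1\<bar> * \<bar>v $ 3\<bar> \<le> \<delta>\<^sup>2 * 1" "\<bar>v $ 2\<bar> * \<bar>v $ 2\<bar> \<le> \<delta> * \<delta>"
    using v' \<delta> by (intro mult_mono; simp)+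
  then have *: "\<bar>v $ 1 * v $ 2\<bar> \<le> \<delta> ^ 3" "\<bar>v $ 1 * v $ 3\<bar> \<le> \<delta>\<^sup>2" "\<bar>(v $ 2)\<^sup>2\<bar> \<le> \<delta>\<^sup>2"
    by (simp_all add: abs_mult power2_eq_square power3_eq_cube)
  have "0 \<le> \<delta> ^ 3" using \<delta> by simp
  then have "\<bar>v $ 1 * v $ 2\<bar> \<le> 2 * \<delta> ^ 3" "\<bar>v $ 1 * v $ 3 + (v $ 2)\<^sup>2\<bar> \<le> 2 * \<delta>\<^sup>2"
    using * by linarith+
  then show ?thesis using exhaust_2[of k] by (auto simp: form1_def b_def)
qed

text \<open>The long side lies along v_2, which enters only through the product v_1 v_2. The form
  sizes are \<delta> and \<delta>^2, so N = 2 and \<beta> = 3, and p (3N - \<beta>) < 4N reads p <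
  8/3.\<close>

lemma form2_anisotropic:
  fixes a :: "3 \<Rightarrow> nat" and b :: "2 \<Rightarrow> nat"
  defines "a \<equiv> \<lambda>i. if i = 2 then 0 else 1" and "b \<equiv> \<lambda>k. if k = 1 then 1 else 2"
  assumes s: "\<bar>s\<bar> = 1" and \<delta>: "0 < \<delta>" and v: "\<And>i. \<bar>v $ i\<bar> \<le> \<delta> ^ a i"
  shows "\<bar>form2 s v $ k\<bar> \<le> 2 * \<delta> ^ b k"
proof -
  have v': "\<bar>v $ 1\<bar> \<le> \<delta>" "\<bar>v $ 2\<bar> \<le> 1" "\<bar>v $ 3\<bar> \<le> \<delta>"
    using v[of 1] v[of 2] v[of 3] by (auto simp: a_def)
  have "\<bar>v $ 1\<bar> * \<bar>v $ 2\<bar> \<le> \<delta> * 1" "\<bar>v $ 1\<bar> * \<bar>v $ 1\<bar> \<le> \<delta> * \<delta>" "\<bar>v $ 3\<bar> * \<bar>v $ 3\<bar> \<le> \<delta> * \<delta>"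
    using v' \<delta> by (intro mult_mono; simp)+
  then have *: "\<bar>v $ 1 * v $ 2\<bar> \<le> \<delta>" "\<bar>(v $ 1)\<^sup>2\<bar> \<le> \<delta>\<^sup>2" "\<bar>s * (v $ 3)\<^sup>2\<bar> \<le> \<delta>\<^sup>2"
    using s by (simp_all add: abs_mult power2_eq_square)
  have "\<bar>v $ 1 * v $ 2\<bar> \<le> 2 * \<delta>" "\<bar>(v $ 1)\<^sup>2 + s * (v $ 3)\<^sup>2\<bar> \<le> 2 * \<delta>\<^sup>2"
    using * \<delta> by linarith+
  then show ?thesis using exhaust_2[of k] by (auto simp: form2_def b_def)
qed

theorem restriction_form1:
  assumes K: "compact K"
    and equiv: "equivalent_forms (quadratic_form A, quadratic_form B)
        (\<lambda>\<xi>. \<xi> $ 1 * \<xi> $ 2, \<lambda>\<xi>. \<xi> $ 1 * \<xi> $ 3 + (\<xi> $ 2)\<^sup>2)"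
  shows "3 < p \<Longrightarrow> restriction_estimate (surface_map A B) K p 4"
    and "interior K \<noteq> {} \<Longrightarrow> 1 \<le> p \<Longrightarrow> p < 3 \<Longrightarrow> \<not> restriction_estimate (surface_map A B) K p 4"
proof -
  obtain M1 :: "real^3^3" and M2 :: "real^2^2" where M: "invertible M1" "invertible M2"
    and "\<And>v. vector [v $ 1 * v $ 2, v $ 1 * v $ 3 + (v $ 2)\<^sup>2] = M2 *v quadratic_pair A B (M1 *v v)"
    using equivalent_formsE[OF equiv] by blast
  then have eq: "form1 v = M2 *v quadratic_pair A B (M1 *v v)" for v by (simp add: form1_def)
  show "restriction_estimate (surface_map A B) K p 4" if p: "3 < p"
  proof -
    obtain s where s: "3 / 2 < s" "s \<le> 2" "ennreal (2 * s) \<le> p"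
      using ex_subcritical_exponent[of 3 p] p by auto
    \<comment> \<open>For s > 1, the condition s / (2 (s - 1)) < 3/2 is s > 3/2.\<close>
    then have "weighted_density form1 (s / (2 * (s - 1)))"
      by (intro weighted_density_form1) (simp_all add: field_simps)
    from weighted_density_linear[OF M quadratic_pair_measurable eq this]
    show ?thesis using s by (intro restriction_estimate_of_weighted_density[OF K]) auto
  qed
  show "\<not> restriction_estimate (surface_map A B) K p 4" if "interior K \<noteq> {}" and p: "1 \<le> p" "p < 3"
  proof -
    have "p < ennreal 3" using p by simp
    then show ?thesis
      using enn2real_less[of p 3]
      by (intro restriction_estimate_knapp_failure[where
            a = "\<lambda>i. if i = 1 then 2 else if i = 2 then 1 else 0" and b = "\<lambda>k. if k = 1 then 3 else 2",
            OF K \<open>interior K \<noteq> {}\<close> M eq form1_anisotropic p(1)])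
        (simp_all add: sum_3 sum_2)
  qed
qed

theorem restriction_form2:
  assumes K: "compact K" and s1: "\<bar>s1\<bar> = 1"
    and equiv: "equivalent_forms (quadratic_form A, quadratic_form B)
        (\<lambda>\<xi>. \<xi> $ 1 * \<xi> $ 2, \<lambda>\<xi>. (\<xi> $ 1)\<^sup>2 + s1 * (\<xi> $ 3)\<^sup>2)"
  shows "ennreal (8/3) < p \<Longrightarrow> restriction_estimate (surface_map A B) K p 4"
    and "interior K \<noteq> {} \<Longrightarrow> 1 \<le> p \<Longrightarrow> p < ennreal (8/3) \<Longrightarrow> \<not> restriction_estimate (surface_map A B) K p 4"
proof -
  obtain M1 :: "real^3^3" and M2 :: "real^2^2" where M: "invertible M1" "invertible M2"
    and "\<And>v. vector [v $ 1 * v $ 2, (v $ 1)\<^sup>2 + s1 * (v $ 3)\<^sup>2] = M2 *v quadratic_pair A B (M1 *v v)"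
    using equivalent_formsE[OF equiv] by blast
  then have eq: "form2 s1 v = M2 *v quadratic_pair A B (M1 *v v)" for v by (simp add: form2_def)
  show "restriction_estimate (surface_map A B) K p 4" if p: "ennreal (8/3) < p"
  proof -
    obtain s where s: "8 / 3 / 2 < s" "s \<le> 2" "ennreal (2 * s) \<le> p"
      using ex_subcritical_exponent[of "8/3" p] p by auto
    \<comment> \<open>For s > 1, the condition s / (2 (s - 1)) < 2 is s > 4/3, and s \<le> 2 gives
      the lower bound 1 on this exponent.\<close>
    then have "weighted_density (form2 s1) (s / (2 * (s - 1)))"
      by (intro weighted_density_form2 s1) (simp_all add: field_simps)
    from weighted_density_linear[OF M quadratic_pair_measurable eq this]
    show ?thesis using s by (intro restriction_estimate_of_weighted_density[OF K]) auto
  qed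
  show "\<not> restriction_estimate (surface_map A B) K p 4" if "interior K \<noteq> {}" and p: "1 \<le> p" "p < ennreal (8/3)"
    using enn2real_less[OF p(2)]
    by (intro restriction_estimate_knapp_failure[where
          a = "\<lambda>i. if i = 2 then 0 else 1" and b = "\<lambda>k. if k = 1 then 1 else 2",
          OF K \<open>interior K \<noteq> {}\<close> M eq form2_anisotropic[OF s1] p(1)])
      (simp_all add: sum_3 sum_2)
qed

theorem theorem1p3:
  fixes A B :: "real^3^3" and K :: "(real^3) set"
  assumes "symmetric_matrix A" and "symmetric_matrix B"
    and "D_condition A B" and "R_condition 1 A B"
    and "compact K"
  shows
    "(equivalent_forms (quadratic_form A, quadratic_form B)
        (\<lambda>\<xi>. \<xi> $ 1 * \<xi> $ 2, \<lambda>\<xi>. \<xi> $ 1 * \<xi> $ 3 + (\<xi> $ 2)\<^sup>2)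
      \<longrightarrow>
        (\<forall>p::ennreal. p > 3 \<longrightarrow> restriction_estimate (surface_map A B) K p 4) \<and>
        (interior K \<noteq> {} \<longrightarrow>
          (\<forall>p::ennreal. 1 \<le> p \<and> p < 3 \<longrightarrow> \<not> restriction_estimate (surface_map A B) K p 4)))
     \<and>
     (equivalent_forms (quadratic_form A, quadratic_form B)
        (\<lambda>\<xi>. \<xi> $ 1 * \<xi> $ 2, \<lambda>\<xi>. (\<xi> $ 1)\<^sup>2 + (\<xi> $ 3)\<^sup>2) \<or>
      equivalent_forms (quadratic_form A, quadratic_form B)
        (\<lambda>\<xi>. \<xi> $ 1 * \<xi> $ 2, \<lambda>\<xi>. (\<xi> $ 1)\<^sup>2 - (\<xi> $ 3)\<^sup>2)
      \<longrightarrow>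
        (\<forall>p::ennreal. p > ennreal (8/3) \<longrightarrow> restriction_estimate (surface_map A B) K p 4) \<and>
        (interior K \<noteq> {} \<longrightarrow>
          (\<forall>p::ennreal. 1 \<le> p \<and> p < ennreal (8/3) \<longrightarrow>
             \<not> restriction_estimate (surface_map A B) K p 4)))"
proof -
  \<comment> \<open>Both signs of the second form are handled together; they are the instances s = 1
    and s = -1.\<close>
  have *: "(\<forall>p::ennreal. p > ennreal (8/3) \<longrightarrow> restriction_estimate (surface_map A B) K p 4) \<and>
        (interior K \<noteq> {} \<longrightarrow>
          (\<forall>p::ennreal. 1 \<le> p \<and> p < ennreal (8/3) \<longrightarrow>
             \<not> restriction_estimate (surface_map A B) K p 4))"
    if "\<bar>s\<bar> = 1" "equivalent_forms (quadratic_form A, quadratic_form B)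
        (\<lambda>\<xi>. \<xi> $ 1 * \<xi> $ 2, \<lambda>\<xi>. (\<xi> $ 1)\<^sup>2 + s * (\<xi> $ 3)\<^sup>2)" for s
    using restriction_form2[OF assms(5) that] by blast
  show ?thesis
    using restriction_form1[OF assms(5), of A B] *[of 1] *[of "-1"] by auto
qed

end
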